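(* Algorithm 2, the procedure written out in full in the context, runs in polynomial space of the size of its input $(A,B)$.
   Context: Conventions. A procedure runs in polynomial space if the deterministic Turing machine executing it runs in space bounded by some polynomial in the size of the input. Integers are encoded in binary. Input. A Katsura pair $(A,B)$ consists of square integer matrices of the same dimension $\mathfrak N\ge1$, where $A$ has nonnegative entries and no zero row, and $A_{u,v}=0$ implies $B_{u,v}=0$. Graphs. $E_A$ is the directed graph with vertex set $E_A^0=\{1,\dots,\mathfrak N\}$ and, for all $u,v$, exactly $A_{u,v}$ edges with range $u$ and source $v$. Its underlying simple graph $\overline E_A$ is obtained by collapsing multiple edges: it has the same vertices and one edge with range $u$ and source $v$ whenever $A_{u,v}\ne0$. For an edge $e$ with range $u$ and source $v$ put $A_e=A_{u,v}$, $B_e=B_{u,v}$. A path $p=e_1\cdots e_n$ is a sequence of edges with source of $e_i$ equal to range of $e_{i+1}$; its range $\mathbf r(p)$ is the range of $e_1$ and its source $\mathbf s(p)$ is the source of $e_n$. Vertices are paths of length $0$, each being its own range and source. Put $A_p=\prod_l A_{e_l}$, $B_p=\prod_l B_{e_l}$, and $A_v=B_v=1$ for a vertex $v$. $v\overline E_A^*$ is the set of finite paths of $\overline E_A$ with range $v$, and $v\overline E_A^*v$ the set of those with range and source $v$. A cycle is a path of positive length with equal range and source. A path is simple if it contains no cycle as a subsequence of edges; a cycle is simple if it contains no cycle as a proper subsequence of edges. In the algorithms, paths of $\overline E_A$ are encoded as their vertex sequences, and vertices, simple paths and simple cycles are cycled through in lexicographic order. Algorithm 1, procedure Faithful$(A,B,v)$: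 - For all simple paths $p\in v\overline E_A^*$ with $B_p\ne0$: -- For all simple cycles $c\in \mathbf s(p)\overline E_A^*\mathbf s(p)$: --- If $B_c/A_c\notin\mathbb Z$: halt and return TRUE. - Return FALSE. Algorithm 2, on input $(A,B)$ (T1 is a variable): - For all $v\in E_A^0$: -- If Faithful$(A,B,v)$ = FALSE: --- For all simple paths $r\in v\overline E_A^*$ with $B_r\ne0$, and for all simple cycles $c\in\mathbf s(r)\overline E_A^*\mathbf s(r)$: if $B_c\ne0$, set T1 $\gets$ TRUE. --- If T1 = TRUE: ---- For all simple paths $p\in v\overline E_A^*$ with $B_p\ne0$: ----- For all simple paths $q\in\mathbf s(p)\overline E_A^*$: if $B_q=0$, continue with next $p$. ----- Continue with next $v$. ---- Halt and return NO. - Return YES. *)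

theory Defs
  imports
    "Jordan_Normal_Form.Matrix"
    "HOL-Library.Sublist"
    "HOL-Library.List_Lexorder"
    "HOL-Computational_Algebra.Polynomial"
begin

section \<open>Deterministic Turing machines\<close>

text \<open>Letters are the symbols used to write inputs and values of variables. A machine may use
  further symbols of its own, written \<open>Aux i\<close>.\<close>

datatype letter = Bit bool | Minus | None_Mark | End_Num | End_List | End_Mat

datatype symbol = Blank | Left_End | Letter letter | Aux nat

datatype move = Go_Left | Stay | Go_Right

record tm =
  tapes :: nat
  states :: "nat set"
  symbols :: "symbol set"
  start :: nat
  accept :: nat
  reject :: nat
  trans :: "nat \<Rightarrow> symbol list \<Rightarrow> nat \<times> (symbol \<times> move) list"

definition wf_tm :: "tm \<Rightarrow> bool" where
  "wf_tm M \<longleftrightarrow>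
     2 \<le> tapes M \<and> finite (states M) \<and> finite (symbols M) \<and>
     {start M, accept M, reject M} \<subseteq> states M \<and> accept M \<noteq> reject M \<and>
     {Blank, Left_End} \<union> range Letter \<subseteq> symbols M \<and>
     (\<forall>q\<in>states M. \<forall>w. length w = tapes M \<and> set w \<subseteq> symbols M \<longrightarrow>
        fst (trans M q w) \<in> states M \<and>
        length (snd (trans M q w)) = tapes M \<and>
        fst ` set (snd (trans M q w)) \<subseteq> symbols M)"

text \<open>Tapes and cells are numbered from 0; tapes are infinite to the right only.\<close>

record config =
  state :: nat
  content :: "nat \<Rightarrow> nat \<Rightarrow> symbol"
  head :: "nat \<Rightarrow> nat"

definition written :: "letter list \<Rightarrow> nat \<Rightarrow> symbol" where
  "written w i =
     (if i = 0 then Left_End else if i \<le> length w then Letter (w ! (i - 1)) else Blank)"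

definition initial_config :: "tm \<Rightarrow> letter list \<Rightarrow> config" where
  "initial_config M w =
     \<lparr>state = start M, content = (\<lambda>j. written (if j = 0 then w else [])), head = (\<lambda>j. 0)\<rparr>"

text \<open>Truncated subtraction: a head on cell 0 that is told to move left stays there.\<close>

fun move_head :: "move \<Rightarrow> nat \<Rightarrow> nat" where
  "move_head Go_Left i = i - 1"
| "move_head Stay i = i"
| "move_head Go_Right i = i + 1"

definition step_config :: "tm \<Rightarrow> config \<Rightarrow> config" where
  "step_config M c =
     (if state c \<in> {accept M, reject M} then c
      else
        let (q, acts) = trans M (state c) (map (\<lambda>j. content c j (head c j)) [0..<tapes M])
        in \<lparr>state = q,
            content = (\<lambda>j. if j < tapes M
                           then (content c j)(head c j := fst (acts ! j)) else content c j),
            head = (\<lambda>j. if j < tapes M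
                        then move_head (snd (acts ! j)) (head c j) else head c j)\<rparr>)"

definition config_at :: "tm \<Rightarrow> letter list \<Rightarrow> nat \<Rightarrow> config" where
  "config_at M w t = (step_config M ^^ t) (initial_config M w)"

definition visited_cells :: "tm \<Rightarrow> letter list \<Rightarrow> (nat \<times> nat) set" where
  "visited_cells M w = {(j, head (config_at M w t) j) | j t. j < tapes M}"

definition uses_space_at_most :: "tm \<Rightarrow> letter list \<Rightarrow> nat \<Rightarrow> bool" where
  "uses_space_at_most M w b \<longleftrightarrow> finite (visited_cells M w) \<and> card (visited_cells M w) \<le> b"


section \<open>Procedures and polynomial space\<close>

text \<open>A procedure is given by its steps, i.e. by the way in which its program point and the values
  of its variables change, together with the encodings of inputs and of program points with
  variable values as words. A step may use the input, which is not part of the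
  \<^typ>\<open>'s\<close>-valued state.\<close>

record ('i, 's) procedure =
  valid_input :: "'i \<Rightarrow> bool"
  encode_input :: "'i \<Rightarrow> letter list"
  initial :: "'i \<Rightarrow> 's"
  next_state :: "'i \<Rightarrow> 's \<Rightarrow> 's"
  result :: "'s \<Rightarrow> bool option"
  encode_state :: "'s \<Rightarrow> letter list"

definition state_after :: "('i, 's) procedure \<Rightarrow> 'i \<Rightarrow> nat \<Rightarrow> 's" where
  "state_after P x i = (next_state P x ^^ i) (initial P x)"

text \<open>A machine executes a procedure if it does not merely compute the same answer, but goes
  through the states of the procedure one after the other: the successive times at which the
  machine is in its state \<open>q\<close> (the checkpoint) are in bijection with the steps of the
  procedure, and at each of them tape 1 contains exactly the encoding of the current state of the
  procedure. Between two checkpoints the machine works out a single step. When the procedure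
  halts, so does the machine, with the same answer.\<close>

definition executes_on :: "tm \<Rightarrow> nat \<Rightarrow> ('i, 's) procedure \<Rightarrow> 'i \<Rightarrow> bool" where
  "executes_on M q P x \<longleftrightarrow>
     (\<exists>n answer time.
        (\<forall>i<n. result P (state_after P x i) = None) \<and>
        result P (state_after P x n) = Some answer \<and>
        strict_mono_on {..n} time \<and>
        {t. state (config_at M (encode_input P x) t) = q} = time ` {..n} \<and>
        (\<forall>i\<le>n. content (config_at M (encode_input P x) (time i)) 1
                = written (encode_state P (state_after P x i))) \<and>
        (\<exists>t. state (config_at M (encode_input P x) t) = (if answer then accept M else reject M)))"

definition runs_in_polynomial_space :: "('i, 's) procedure \<Rightarrow> bool" where
  "runs_in_polynomial_space P \<longleftrightarrow>
     (\<exists>M q. \<exists>f :: nat poly. wf_tm M \<and>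
        (\<forall>x. valid_input P x \<longrightarrow>
           executes_on M q P x \<and>
           uses_space_at_most M (encode_input P x) (poly f (length (encode_input P x)))))"


section \<open>Katsura pairs and their graphs\<close>

definition katsura_pair :: "int mat \<Rightarrow> int mat \<Rightarrow> bool" where
  "katsura_pair A B \<longleftrightarrow>
     (\<exists>N\<ge>1. A \<in> carrier_mat N N \<and> B \<in> carrier_mat N N \<and>
        (\<forall>u<N. \<forall>v<N. 0 \<le> A $$ (u, v)) \<and>
        (\<forall>u<N. \<exists>v<N. A $$ (u, v) \<noteq> 0) \<and>
        (\<forall>u<N. \<forall>v<N. A $$ (u, v) = 0 \<longrightarrow> B $$ (u, v) = 0))"

text \<open>The vertices are \<open>0, \<dots>, N - 1\<close> instead of \<open>1, \<dots>, N\<close>. An edge of the underlying simple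
  graph is a pair (range, source), and a path \<open>e\<^sub>1 \<dots> e\<^sub>n\<close> is represented by the sequence
  of \<open>n + 1\<close> vertices starting with its range and ending with its source; a path of length 0 is
  a one-element list.\<close>

type_synonym path = "nat list"

definition edges :: "path \<Rightarrow> (nat \<times> nat) list" where
  "edges p = zip p (tl p)"

abbreviation range_of :: "path \<Rightarrow> nat" where "range_of p \<equiv> hd p"
abbreviation source_of :: "path \<Rightarrow> nat" where "source_of p \<equiv> last p"

definition is_path :: "int mat \<Rightarrow> path \<Rightarrow> bool" where
  "is_path A p \<longleftrightarrow> p \<noteq> [] \<and> set p \<subseteq> {..<dim_row A} \<and> (\<forall>e\<in>set (edges p). A $$ e \<noteq> 0)"

definition is_cycle :: "int mat \<Rightarrow> path \<Rightarrow> bool" where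
  "is_cycle A c \<longleftrightarrow> is_path A c \<and> edges c \<noteq> [] \<and> range_of c = source_of c"

definition is_simple_path :: "int mat \<Rightarrow> path \<Rightarrow> bool" where
  "is_simple_path A p \<longleftrightarrow> is_path A p \<and> (\<nexists>z. is_cycle A z \<and> subseq (edges z) (edges p))"

definition is_simple_cycle :: "int mat \<Rightarrow> path \<Rightarrow> bool" where
  "is_simple_cycle A c \<longleftrightarrow>
     is_cycle A c \<and> (\<nexists>z. is_cycle A z \<and> strict_subseq (edges z) (edges c))"

definition simple_paths :: "int mat \<Rightarrow> nat \<Rightarrow> path set" where
  "simple_paths A v = {p. is_simple_path A p \<and> range_of p = v}"

definition simple_cycles :: "int mat \<Rightarrow> nat \<Rightarrow> path set" where
  "simple_cycles A v = {c. is_simple_cycle A c \<and> range_of c = v}"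

definition weight :: "int mat \<Rightarrow> path \<Rightarrow> int" where
  "weight M p = (\<Prod>e\<leftarrow>edges p. M $$ e)"

definition nonzero_simple_paths :: "int mat \<Rightarrow> int mat \<Rightarrow> nat \<Rightarrow> path set" where
  "nonzero_simple_paths A B v = {p \<in> simple_paths A v. weight B p \<noteq> 0}"


section \<open>Algorithm 2\<close>

text \<open>One loop iteration: the element of the finite set \<open>S\<close> that follows \<open>prev\<close> (or the first
  one, if the loop has just been entered), or \<open>None\<close> at the end of the loop. Paths are ordered by
  the lexicographic order of \<^theory>\<open>HOL-Library.List_Lexorder\<close>, in which a proper prefix of a
  list precedes it.\<close>

definition next_in :: "'a::linorder set \<Rightarrow> 'a option \<Rightarrow> 'a option" where
  "next_in S prev =
     (let R = {y \<in> S. case prev of None \<Rightarrow> True | Some x \<Rightarrow> x < y}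
      in if R = {} then None else Some (Min R))"

text \<open>The arguments of the constructors are the variables in scope at the program point. At the
  head of a loop, the loop variable has an \<open>option\<close> type and holds the element treated last.
  The final \<^typ>\<open>bool\<close> is \<open>T1\<close>. The three states named \<open>Faithful\<close> are those of the
  procedure \<open>Faithful\<close>, called by the main program with argument \<open>v\<close>, and \<open>Returned\<close> is
  the point right after the call.\<close>

datatype alg2_state =
    For_Vertex "nat option" bool
  | Faithful_For_Path nat "path option" bool
  | Faithful_For_Cycle nat path "path option" bool
  | Faithful_Test nat path path bool
  | Returned nat bool bool
  | For_R nat "path option" bool
  | For_C nat path "path option" bool
  | Test_C nat path path bool
  | Test_T1 nat bool
  | For_P nat "path option" bool
  | For_Q nat path "path option" bool
  | Test_Q nat path path bool
  | Halted bool

fun alg2_step :: "int mat \<times> int mat \<Rightarrow> alg2_state \<Rightarrow> alg2_state" where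
  "alg2_step (A, B) (For_Vertex v t1) =
     (case next_in {..<dim_row A} v of
        None \<Rightarrow> Halted True
      | Some v' \<Rightarrow> Faithful_For_Path v' None t1)"
| "alg2_step (A, B) (Faithful_For_Path v p t1) =
     (case next_in (nonzero_simple_paths A B v) p of
        None \<Rightarrow> Returned v False t1
      | Some p' \<Rightarrow> Faithful_For_Cycle v p' None t1)"
| "alg2_step (A, B) (Faithful_For_Cycle v p c t1) =
     (case next_in (simple_cycles A (source_of p)) c of
        None \<Rightarrow> Faithful_For_Path v (Some p) t1
      | Some c' \<Rightarrow> Faithful_Test v p c' t1)"
| "alg2_step (A, B) (Faithful_Test v p c t1) =
     (if (of_int (weight B c) / of_int (weight A c) :: rat) \<notin> \<int>
      then Returned v True t1
      else Faithful_For_Cycle v p (Some c) t1)"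
| "alg2_step (A, B) (Returned v faithful t1) =
     (if \<not> faithful then For_R v None t1 else For_Vertex (Some v) t1)"
| "alg2_step (A, B) (For_R v r t1) =
     (case next_in (nonzero_simple_paths A B v) r of
        None \<Rightarrow> Test_T1 v t1
      | Some r' \<Rightarrow> For_C v r' None t1)"
| "alg2_step (A, B) (For_C v r c t1) =
     (case next_in (simple_cycles A (source_of r)) c of
        None \<Rightarrow> For_R v (Some r) t1
      | Some c' \<Rightarrow> Test_C v r c' t1)"
| "alg2_step (A, B) (Test_C v r c t1) =
     For_C v r (Some c) (if weight B c \<noteq> 0 then True else t1)"
| "alg2_step (A, B) (Test_T1 v t1) =
     (if t1 then For_P v None t1 else For_Vertex (Some v) t1)"
| "alg2_step (A, B) (For_P v p t1) =
     (case next_in (nonzero_simple_paths A B v) p of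
        None \<Rightarrow> Halted False
      | Some p' \<Rightarrow> For_Q v p' None t1)"
| "alg2_step (A, B) (For_Q v p q t1) =
     (case next_in (simple_paths A (source_of p)) q of
        None \<Rightarrow> For_Vertex (Some v) t1
      | Some q' \<Rightarrow> Test_Q v p q' t1)"
| "alg2_step (A, B) (Test_Q v p q t1) =
     (if weight B q = 0 then For_P v (Some p) t1 else For_Q v p (Some q) t1)"
| "alg2_step (A, B) (Halted answer) = Halted answer"

fun alg2_result :: "alg2_state \<Rightarrow> bool option" where
  "alg2_result (Halted answer) = Some answer"
| "alg2_result _ = None"


section \<open>Encodings\<close>

fun binary :: "nat \<Rightarrow> letter list" where
  "binary n = (if n < 2 then [Bit (n = 1)] else binary (n div 2) @ [Bit (odd n)])"

declare binary.simps [simp del]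

definition encode_nat :: "nat \<Rightarrow> letter list" where
  "encode_nat n = binary n @ [End_Num]"

definition encode_int :: "int \<Rightarrow> letter list" where
  "encode_int z = (if z < 0 then [Minus] else []) @ encode_nat (nat \<bar>z\<bar>)"

definition encode_list :: "('a \<Rightarrow> letter list) \<Rightarrow> 'a list \<Rightarrow> letter list" where
  "encode_list enc xs = concat (map enc xs) @ [End_List]"

definition encode_mat :: "int mat \<Rightarrow> letter list" where
  "encode_mat M = concat (map (encode_list encode_int) (mat_to_list M)) @ [End_Mat]"

definition encode_pair :: "int mat \<times> int mat \<Rightarrow> letter list" where
  "encode_pair AB = encode_mat (fst AB) @ encode_mat (snd AB)"

abbreviation encode_path :: "path \<Rightarrow> letter list" where
  "encode_path \<equiv> encode_list encode_nat"

definition encode_option :: "('a \<Rightarrow> letter list) \<Rightarrow> 'a option \<Rightarrow> letter list" where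
  "encode_option enc x = (case x of None \<Rightarrow> [None_Mark] | Some y \<Rightarrow> enc y)"

text \<open>The leading number identifies the program point.\<close>

fun encode_alg2_state :: "alg2_state \<Rightarrow> letter list" where
  "encode_alg2_state (For_Vertex v t1) =
     encode_nat 0 @ encode_option encode_nat v @ [Bit t1]"
| "encode_alg2_state (Faithful_For_Path v p t1) =
     encode_nat 1 @ encode_nat v @ encode_option encode_path p @ [Bit t1]"
| "encode_alg2_state (Faithful_For_Cycle v p c t1) =
     encode_nat 2 @ encode_nat v @ encode_path p @ encode_option encode_path c @ [Bit t1]"
| "encode_alg2_state (Faithful_Test v p c t1) =
     encode_nat 3 @ encode_nat v @ encode_path p @ encode_path c @ [Bit t1]"
| "encode_alg2_state (Returned v faithful t1) =
     encode_nat 4 @ encode_nat v @ [Bit faithful] @ [Bit t1]"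
| "encode_alg2_state (For_R v r t1) =
     encode_nat 5 @ encode_nat v @ encode_option encode_path r @ [Bit t1]"
| "encode_alg2_state (For_C v r c t1) =
     encode_nat 6 @ encode_nat v @ encode_path r @ encode_option encode_path c @ [Bit t1]"
| "encode_alg2_state (Test_C v r c t1) =
     encode_nat 7 @ encode_nat v @ encode_path r @ encode_path c @ [Bit t1]"
| "encode_alg2_state (Test_T1 v t1) =
     encode_nat 8 @ encode_nat v @ [Bit t1]"
| "encode_alg2_state (For_P v p t1) =
     encode_nat 9 @ encode_nat v @ encode_option encode_path p @ [Bit t1]"
| "encode_alg2_state (For_Q v p q t1) =
     encode_nat 10 @ encode_nat v @ encode_path p @ encode_option encode_path q @ [Bit t1]"
| "encode_alg2_state (Test_Q v p q t1) =
     encode_nat 11 @ encode_nat v @ encode_path p @ encode_path q @ [Bit t1]"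
| "encode_alg2_state (Halted answer) =
     encode_nat 12 @ [Bit answer]"

text \<open>\<open>T1\<close> is initially \<open>False\<close>; it is never reset between two vertices.\<close>

definition algorithm2 :: "(int mat \<times> int mat, alg2_state) procedure" where
  "algorithm2 =
     \<lparr>valid_input = (\<lambda>(A, B). katsura_pair A B),
      encode_input = encode_pair,
      initial = (\<lambda>_. For_Vertex None False),
      next_state = alg2_step,
      result = alg2_result,
      encode_state = encode_alg2_state\<rparr>"

end

theory Submission
  imports Defs "HOL-Library.Countable_Set"
begin

text \<open>Let \<open>N\<close> be the number of vertices. At every moment the algorithm remembers a vertex, at most
  two vertex sequences, each of length at most \<open>N + 1\<close> (a simple path has no repeated vertex, a
  simple cycle repeats only its base point), and two bits. All of this fits into polynomial space. A single
  step is harmless as well. The next simple path or cycle in lexicographic order is found by running through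
  \<^emph>\<open>all\<close> sequences of at most \<open>N + 1\<close> vertices, starting from the current
  one, until one passes the test; this takes exponential time, but only one sequence is stored. The products
  \<open>A_c\<close> and \<open>B_c\<close> have at most \<open>N\<close> factors, so their binary length is
  polynomial, and divisibility can be decided by trying all quotients. Signs never matter, because the
  entries of \<open>A\<close> and \<open>B\<close> enter only through the questions whether an integer is
  zero and whether it is divisible by another one.

  What has to be added to this argument is an actual Turing machine that passes through the states of the
  algorithm. It is produced in three layers.

  \<^item> Programs over finitely many stacks of letters, with loops and case distinctions, are compiled to
    Turing machines. The finite control of the machine is the list of programs that remain to be
    executed, and the head of each tape stands on the top of the corresponding stack, so that space
    is the height of the stacks (\<open>machine.run\<close>).

  \<^item> A function between types whose elements are written as words is called \<open>pspace\<close> if such a program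
    computes it within polynomially high stacks. These functions are closed under composition,
    pairing, case distinction, loops whose intermediate values stay of polynomial size
    (\<open>pspace_while\<close>), hence under folds over lists, recursion up to exponentially large numbers and
    bounded quantifiers. Membership in this class is then shown by following the syntax of a function
    definition.

  \<^item> If the step function, the output function and the halting test of a procedure are \<open>pspace\<close> and
    all its states are of polynomial size, then the procedure runs in polynomial space
    (\<open>runs_in_polynomial_spaceI\<close>).

  For the algorithm itself, the definitions of simple paths and simple cycles in terms of subsequences of
  edges are first turned into conditions on repeated vertices (\<open>is_simple_path_iff\<close>,
  \<open>is_simple_cycle_iff\<close>). Then its step is programmed on natural numbers, lists and truth
  values (\<open>step_code\<close>) and shown to agree with the original one (\<open>simulation\<close>).
  Termination follows since each loop runs through a finite set in increasing order
  (\<open>rank_decreases\<close>).\<close>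

section \<open>Stack programs and their Turing machines\<close>

type_synonym store = "nat \<Rightarrow> letter list"

fun peek :: "'a list \<Rightarrow> 'a option" where
  "peek [] = None"
| "peek (l # w) = Some l"

text \<open>A register holds a word, used as a stack whose top is the head of the list. \<open>Move a R\<close> pops a
  letter from \<open>a\<close> and pushes it onto every register in \<open>R\<close>; with \<open>R =
  []\<close> it just deletes the letter, and with two targets it copies. Conditions only look at the top of
  one register. This is close enough to a multitape machine that an elementary command takes at most two
  machine steps.\<close>

datatype com =
    Skip
  | Push nat letter
  | Move nat "nat list"
  | Seq com com
  | Cond nat "letter option set" com com
  | Loop nat "letter option set" com

definition pushed :: "letter \<Rightarrow> nat list \<Rightarrow> store \<Rightarrow> store" where
  "pushed l R s = (\<lambda>r. if r \<in> set R then l # s r else s r)"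

text \<open>Big-step semantics. The parameter \<open>b\<close> bounds the height that a push may produce and says
  nothing about registers that are merely present. Hence an execution stays valid in a store where other
  registers are arbitrarily long, which is what makes programs composable.\<close>

inductive exec :: "nat \<Rightarrow> com \<Rightarrow> store \<Rightarrow> store \<Rightarrow> bool" for b where
  Skip: "exec b Skip s s"
| Push: "length (s r) < b \<Longrightarrow> exec b (Push r l) s (pushed l [r] s)"
| Move: "s a = l # w \<Longrightarrow> a \<notin> set R \<Longrightarrow> \<forall>r\<in>set R. length (s r) < b
    \<Longrightarrow> exec b (Move a R) s (pushed l R (s(a := w)))"
| Seq: "exec b c s s' \<Longrightarrow> exec b d s' s'' \<Longrightarrow> exec b (Seq c d) s s''"
| Cond_True: "peek (s r) \<in> P \<Longrightarrow> exec b c s s' \<Longrightarrow> exec b (Cond r P c d) s s'"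
| Cond_False: "peek (s r) \<notin> P \<Longrightarrow> exec b d s s' \<Longrightarrow> exec b (Cond r P c d) s s'"
| Loop_True: "peek (s r) \<in> P \<Longrightarrow> exec b c s s' \<Longrightarrow> exec b (Loop r P c) s' s''
    \<Longrightarrow> exec b (Loop r P c) s s''"
| Loop_False: "peek (s r) \<notin> P \<Longrightarrow> exec b (Loop r P c) s s"

lemma exec_mono: "exec b c s s' \<Longrightarrow> b \<le> b' \<Longrightarrow> exec b' c s s'"
  by (induction rule: exec.induct) (auto intro: exec.intros order_less_le_trans)

fun registers :: "com \<Rightarrow> nat set" where
  "registers Skip = {}"
| "registers (Push r l) = {r}"
| "registers (Move a R) = insert a (set R)"
| "registers (Seq c d) = registers c \<union> registers d"
| "registers (Cond r P c d) = insert r (registers c \<union> registers d)"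
| "registers (Loop r P c) = insert r (registers c)"

lemma finite_registers: "finite (registers c)"
  by (induction c) auto

lemma exec_frame: "exec b c s s' \<Longrightarrow> j \<notin> registers c \<Longrightarrow> s' j = s j"
  by (induction rule: exec.induct) (auto simp: pushed_def)

lemma exec_frame_above:
  "exec b c s s' \<Longrightarrow> registers c \<subseteq> {..<T} \<Longrightarrow> \<forall>j\<ge>T. s j = [] \<Longrightarrow> \<forall>j\<ge>T. s' j = []"
  by (metis exec_frame lessThan_iff linorder_not_le subsetD)

lemma exec_length:
  "exec b c s s' \<Longrightarrow> b \<le> B \<Longrightarrow> \<forall>j. length (s j) \<le> B \<Longrightarrow> length (s' j) \<le> B"
proof (induction arbitrary: j rule: exec.induct)
  case (Move s a l w R)
  have "length w \<le> B"
    using Move.prems(2)[rule_format, of a] Move.hyps(1) by simp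
  then show ?case using Move by (auto simp: pushed_def Suc_le_eq)
qed (auto simp: pushed_def Suc_le_eq)

text \<open>Finite control of the compiled machine. \<open>Run K\<close> means that the programs in \<open>K\<close>
  are still to be executed, one after the other. A push needs two steps: the head first moves onto the free
  cell, then the machine passes through \<open>Write l R K\<close> to put the letter down.
  \<open>Scan\<close> is the initial phase, in which the head of the input tape walks to the end of the
  input.\<close>

datatype control =
    Scan
  | Checkpoint
  | Run "com list"
  | Write letter "nat list" "com list"
  | Done bool

text \<open>The control states that can occur while \<open>c\<close> is executed in front of \<open>K\<close>. Loops
  reuse their own continuation, so this set is finite although runs may be arbitrarily long.\<close>

fun controls_of :: "com \<Rightarrow> com list \<Rightarrow> control set" where
  "controls_of Skip K = {Run (Skip # K)}"
| "controls_of (Push r l) K = {Run (Push r l # K), Write l [r] K}"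
| "controls_of (Move a R) K = insert (Run (Move a R # K)) (range (\<lambda>l. Write l R K))"
| "controls_of (Seq c d) K =
     insert (Run (Seq c d # K)) (controls_of c (d # K) \<union> controls_of d K)"
| "controls_of (Cond r P c d) K =
     insert (Run (Cond r P c d # K)) (controls_of c K \<union> controls_of d K)"
| "controls_of (Loop r P c) K =
     insert (Run (Loop r P c # K)) (controls_of c (Loop r P c # K))"

lemma UNIV_letter:
  "(UNIV :: letter set) = {Bit True, Bit False, Minus, None_Mark, End_Num, End_List, End_Mat}"
proof -
  have "l \<in> {Bit True, Bit False, Minus, None_Mark, End_Num, End_List, End_Mat}" for l
    by (cases l) auto
  then show ?thesis by auto
qed

instance letter :: finite
  by standard (simp add: UNIV_letter)

lemma finite_controls_of: "finite (controls_of c K)"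
  by (induction c arbitrary: K) auto

lemma Run_in_controls_of: "Run (c # K) \<in> controls_of c K"
  by (cases c) auto

definition letter_read :: "(nat \<Rightarrow> symbol) \<Rightarrow> nat \<Rightarrow> letter option" where
  "letter_read u j = (case u j of Letter l \<Rightarrow> Some l | _ \<Rightarrow> None)"

text \<open>The machine executes \<open>init\<close> once and then repeats \<open>body\<close>, passing through the state
  \<open>Checkpoint\<close> before each round. After a round it looks at the register \<open>ans\<close>: an empty register
  means to go on, a bit is the final answer. \<open>T\<close> is the number of tapes.\<close>

locale machine =
  fixes init body :: com and ans T :: nat
  assumes registers: "registers init \<union> registers body \<subseteq> {..<T}"
    and ans: "ans < T" and two_tapes: "2 \<le> T"
begin

fun next_control :: "control \<Rightarrow> (nat \<Rightarrow> symbol) \<Rightarrow> control" where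
  "next_control Scan u = (if u 0 = Blank then Run [init] else Scan)"
| "next_control Checkpoint u = Run [body]"
| "next_control (Run []) u =
     (case letter_read u ans of Some (Bit b) \<Rightarrow> Done b | _ \<Rightarrow> Checkpoint)"
| "next_control (Run (Skip # K)) u = Run K"
| "next_control (Run (Push r l # K)) u = Write l [r] K"
| "next_control (Run (Move a R # K)) u =
     (case letter_read u a of None \<Rightarrow> Run K | Some l \<Rightarrow> Write l R K)"
| "next_control (Run (Seq c d # K)) u = Run (c # d # K)"
| "next_control (Run (Cond r P c d # K)) u =
     (if letter_read u r \<in> P then Run (c # K) else Run (d # K))"
| "next_control (Run (Loop r P c # K)) u =
     (if letter_read u r \<in> P then Run (c # Loop r P c # K) else Run K)"
| "next_control (Write l R K) u = Run K"
| "next_control (Done b) u = Done b"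

fun action :: "control \<Rightarrow> (nat \<Rightarrow> symbol) \<Rightarrow> nat \<Rightarrow> symbol \<times> move" where
  "action Scan u j = (u j, if j = 0 then if u 0 = Blank then Go_Left else Go_Right else Stay)"
| "action (Run (Push r l # K)) u j = (u j, if j = r then Go_Right else Stay)"
| "action (Run (Move a R # K)) u j =
     (if letter_read u a = None then (u j, Stay)
      else if j = a then (Blank, Go_Left)
      else (u j, if j \<in> set R then Go_Right else Stay))"
| "action (Write l R K) u j = (if j \<in> set R then Letter l else u j, Stay)"
| "action k u j = (u j, Stay)"

definition controls :: "control set" where
  "controls = {Scan, Checkpoint, Run [], Done True, Done False}
     \<union> controls_of init [] \<union> controls_of body []"

abbreviation code :: "control \<Rightarrow> nat" where
  "code \<equiv> to_nat_on controls"

abbreviation decode :: "nat \<Rightarrow> control" where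
  "decode \<equiv> from_nat_into controls"

definition read_symbols :: "symbol list \<Rightarrow> nat \<Rightarrow> symbol" where
  "read_symbols w j = (if j < length w then w ! j else Left_End)"

definition M :: tm where
  "M = \<lparr>tapes = T, states = code ` controls, symbols = {Blank, Left_End} \<union> range Letter,
        start = code Scan, accept = code (Done True), reject = code (Done False),
        trans = (\<lambda>q w. (code (next_control (decode q) (read_symbols w)),
                        map (action (decode q) (read_symbols w)) [0..<T]))\<rparr>"

lemma finite_controls: "finite controls"
  by (simp add: controls_def finite_controls_of)

lemma decode_code: "k \<in> controls \<Longrightarrow> decode (code k) = k"
  by (simp add: countable_finite finite_controls)

lemma code_eq_iff: "k \<in> controls \<Longrightarrow> k' \<in> controls \<Longrightarrow> code k = code k' \<longleftrightarrow> k = k'"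
  by (metis decode_code)

lemma next_control_controls_of:
  "k \<in> controls_of c K \<Longrightarrow> next_control k u \<in> insert (Run K) (controls_of c K)"
proof (induction c arbitrary: K)
  case (Move a R)
  then show ?case by (auto split: option.splits)
next
  case (Seq c d)
  show ?case
  proof (cases "k \<in> controls_of c (d # K)")
    case True
    then have "next_control k u \<in> insert (Run (d # K)) (controls_of c (d # K))"
      by (rule Seq.IH(1))
    then show ?thesis using Run_in_controls_of[of d K] by auto
  next
    case False
    then show ?thesis
      using Seq.prems Seq.IH(2)[of K] Run_in_controls_of[of c "d # K"] by auto
  qed
next
  case (Loop r P c)
  then show ?case using Loop.IH[of "Loop r P c # K"] Run_in_controls_of[of c "Loop r P c # K"]
    by (auto split: if_splits)
qed (auto simp: Run_in_controls_of)

lemma next_control_controls: "k \<in> controls \<Longrightarrow> next_control k u \<in> controls"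
proof -
  assume "k \<in> controls"
  then consider "k \<in> {Scan, Checkpoint, Run [], Done True, Done False}"
    | "k \<in> controls_of init []" | "k \<in> controls_of body []"
    by (auto simp: controls_def)
  then show ?thesis
  proof cases
    case 1
    then show ?thesis
      by (auto simp: controls_def Run_in_controls_of split: option.splits letter.splits)
  qed (use next_control_controls_of in \<open>auto simp: controls_def\<close>)
qed

lemma action_symbols:
  assumes "range u \<subseteq> symbols M"
  shows "fst (action k u j) \<in> symbols M"
proof -
  have "u j \<in> symbols M" using assms by auto
  then show ?thesis
    by (induction k u j rule: action.induct) (auto simp: M_def)
qed

lemma wf: "wf_tm M"
proof -
  have mem: "Scan \<in> controls" "Done True \<in> controls" "Done False \<in> controls"
    by (auto simp: controls_def)
  have "code (Done True) \<noteq> code (Done False)"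
    using mem by (simp add: code_eq_iff)
  have "range (read_symbols w) \<subseteq> symbols M" if "set w \<subseteq> symbols M" for w
    using that by (auto simp: read_symbols_def M_def dest: nth_mem)
  then have act: "fst (action k (read_symbols w) j) \<in> symbols M" if "set w \<subseteq> symbols M" for k w j
    using that by (auto intro: action_symbols)
  have trans: "trans M q w = (code (next_control (decode q) (read_symbols w)),
      map (action (decode q) (read_symbols w)) [0..<T])" for q w
    by (simp add: M_def)
  have "fst ` set (snd (trans M q w)) \<subseteq> symbols M" if "set w \<subseteq> symbols M" for q w
    using act[OF that] by (auto simp: trans)
  moreover have "fst (trans M q w) \<in> states M" if "q \<in> states M" for q w
    using that by (auto simp: trans M_def decode_code next_control_controls)
  moreover have "length (snd (trans M q w)) = tapes M" for q w
    by (simp add: M_def)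
  moreover have "{start M, accept M, reject M} \<subseteq> states M" "accept M \<noteq> reject M"
      "finite (states M)" "finite (symbols M)" "2 \<le> tapes M"
      "{Blank, Left_End} \<union> range Letter \<subseteq> symbols M"
    using mem two_tapes finite_controls \<open>code (Done True) \<noteq> code (Done False)\<close>
    by (auto simp: M_def)
  ultimately show ?thesis
    by (simp add: wf_tm_def)
qed

text \<open>The configuration that represents a store. Words are reversed, so that the top of a stack is the last
  letter on the tape and the head stands on it, or on the left end marker if the stack is empty. In a
  \<open>Write\<close> state the heads of the target tapes have already advanced by one cell.\<close>

definition conf :: "control \<Rightarrow> store \<Rightarrow> config" where
  "conf k s = \<lparr>state = code k, content = (\<lambda>j. written (rev (s j))),
     head = (\<lambda>j. length (s j) + (case k of Write l R K \<Rightarrow> if j \<in> set R then 1 else 0 | _ \<Rightarrow> 0))\<rparr>"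

lemma step_config_code:
  assumes "k \<in> controls" "\<And>b. k \<noteq> Done b"
    and "u = (\<lambda>j. if j < T then C j (h j) else Left_End)"
  shows "step_config M \<lparr>state = code k, content = C, head = h\<rparr> =
    \<lparr>state = code (next_control k u),
     content = (\<lambda>j. if j < T then (C j)(h j := fst (action k u j)) else C j),
     head = (\<lambda>j. if j < T then move_head (snd (action k u j)) (h j) else h j)\<rparr>"
proof -
  have "code k \<noteq> code (Done b)" for b
  proof -
    have "Done b \<in> controls" by (cases b) (auto simp: controls_def)
    then show ?thesis using assms(1,2) by (simp add: code_eq_iff)
  qed
  moreover have "read_symbols (map (\<lambda>j. C j (h j)) [0..<T]) = u"
    by (auto simp: read_symbols_def assms(3))
  ultimately show ?thesis
    using assms(1) by (auto simp: step_config_def M_def decode_code cong: if_cong)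
qed

lemma written_top: "written (rev w) (length w) = (case w of [] \<Rightarrow> Left_End | l # _ \<Rightarrow> Letter l)"
  by (cases w) (auto simp: written_def nth_append)

lemma written_Cons: "(written (rev w))(Suc (length w) := Letter l) = written (rev w @ [l])"
  by (auto simp: written_def fun_eq_iff nth_append le_Suc_eq)

text \<open>The symbols under the heads in such a configuration. On the infinitely many unused tapes this is the left
  end marker, which agrees with the default of \<open>read_symbols\<close>.\<close>

definition tops :: "store \<Rightarrow> nat \<Rightarrow> symbol" where
  "tops s j = (case s j of [] \<Rightarrow> Left_End | l # _ \<Rightarrow> Letter l)"

lemma tops_written: "tops s j = written (rev (s j)) (length (s j))"
  by (simp add: tops_def written_top)

lemma letter_read_tops: "letter_read (tops s) j = peek (s j)"
  by (auto simp: letter_read_def tops_def split: list.split)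

lemma step_conf:
  assumes "k \<in> controls" "\<And>b. k \<noteq> Done b" "\<And>l R K. k \<noteq> Write l R K" "\<forall>j\<ge>T. s j = []"
  shows "step_config M (conf k s) =
    \<lparr>state = code (next_control k (tops s)),
     content = (\<lambda>j. if j < T
        then (written (rev (s j)))(length (s j) := fst (action k (tops s) j))
        else written []),
     head = (\<lambda>j. if j < T then move_head (snd (action k (tops s) j)) (length (s j)) else 0)\<rparr>"
proof -
  let ?h = "\<lambda>j. length (s j)"
  have "conf k s = \<lparr>state = code k, content = (\<lambda>j. written (rev (s j))), head = ?h\<rparr>"
    using assms(3) by (auto simp: conf_def split: control.split)
  moreover have tops: "tops s = (\<lambda>j. if j < T then written (rev (s j)) (?h j) else Left_End)"
    using assms(4) by (auto simp: fun_eq_iff tops_def written_top split: list.split)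
  ultimately show ?thesis
    using assms(4) by (simp add: step_config_code[OF assms(1,2), where C = "\<lambda>j. written (rev (s j))" and h = ?h, OF tops])
      (auto simp: fun_eq_iff)
qed

lemma step_conf_still:
  assumes "k \<in> controls" "\<And>b. k \<noteq> Done b" "\<And>l R K. k \<noteq> Write l R K" "\<forall>j\<ge>T. s j = []"
    and "\<And>j. action k (tops s) j = (tops s j, Stay)"
    and "next_control k (tops s) = k'" "\<And>l R K. k' \<noteq> Write l R K"
  shows "step_config M (conf k s) = conf k' s"
proof -
  show ?thesis
    using assms by (subst step_conf) (auto simp: conf_def fun_eq_iff tops_written split: control.split)
qed

lemma step_conf_Push:
  assumes "Run (Push r l # K) \<in> controls" "r < T" "\<forall>j\<ge>T. s j = []"
  shows "step_config M (conf (Run (Push r l # K)) s) = conf (Write l [r] K) s"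
proof -
  show ?thesis
    using assms by (subst step_conf) (auto simp: conf_def fun_eq_iff tops_written)
qed

lemma step_conf_Move:
  assumes "Run (Move a R # K) \<in> controls" "a < T" "set R \<subseteq> {..<T}" "\<forall>j\<ge>T. s j = []"
    and "s a = l # w" "a \<notin> set R"
  shows "step_config M (conf (Run (Move a R # K)) s) = conf (Write l R K) (s(a := w))"
proof -
  have "written (rev w @ [l]) x = written (rev w) x" if "x \<noteq> Suc (length w)" for x
    using that by (auto simp: written_def nth_append)
  moreover have "written (rev w) (Suc (length w)) = Blank"
    by (simp add: written_def)
  ultimately show ?thesis
    using assms by (subst step_conf) (auto simp: conf_def fun_eq_iff letter_read_tops tops_written)
qed

lemma step_conf_Write:
  assumes "Write l R K \<in> controls" "set R \<subseteq> {..<T}" "\<forall>j\<ge>T. s j = []"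
  shows "step_config M (conf (Write l R K) s) = conf (Run K) (pushed l R s)"
proof -
  let ?h = "\<lambda>j. length (s j) + (if j \<in> set R then 1 else 0)"
  let ?u = "\<lambda>j. if j < T then written (rev (s j)) (?h j) else Left_End"
  have "conf (Write l R K) s =
      \<lparr>state = code (Write l R K), content = (\<lambda>j. written (rev (s j))), head = ?h\<rparr>"
    by (simp add: conf_def)
  moreover have "(written (rev (s j)))(Suc (length (s j)) := Letter l) = written (rev (l # s j))" for j
    by (simp add: written_Cons)
  moreover have "j \<in> set R \<Longrightarrow> j < T" for j using assms(2) by auto
  ultimately show ?thesis
    using assms
    by (simp add: step_config_code[OF assms(1) _ refl]) (auto simp: conf_def pushed_def fun_eq_iff)
qed


text \<open>The machine gets from one configuration to another without meeting the checkpoint on the way and without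
  leaving the first \<open>B\<close> cells after the left end marker. The final configuration is exempt, so
  that a checkpoint may be the end of such a passage but not an intermediate point.\<close>

definition reaches :: "nat \<Rightarrow> config \<Rightarrow> config \<Rightarrow> bool" where
  "reaches B c c' \<longleftrightarrow> (\<exists>t. (step_config M ^^ t) c = c' \<and>
     (\<forall>i<t. state ((step_config M ^^ i) c) \<noteq> code Checkpoint \<and>
            (\<forall>j. head ((step_config M ^^ i) c) j \<le> B)))"

lemma reaches_refl: "reaches B c c"
  unfolding reaches_def by (rule exI[of _ 0]) simp

lemma reaches_step:
  assumes "state c \<noteq> code Checkpoint" "\<And>j. head c j \<le> B" "reaches B (step_config M c) c'"
  shows "reaches B c c'"
proof -
  obtain t where t: "(step_config M ^^ t) (step_config M c) = c'"
    "\<And>i. i < t \<Longrightarrow> state ((step_config M ^^ i) (step_config M c)) \<noteq> code Checkpoint \<and>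
            (\<forall>j. head ((step_config M ^^ i) (step_config M c)) j \<le> B)"
    using assms(3) unfolding reaches_def by blast
  have "state ((step_config M ^^ i) c) \<noteq> code Checkpoint \<and>
      (\<forall>j. head ((step_config M ^^ i) c) j \<le> B)" if "i < Suc t" for i
    using that assms(1,2) t(2)[of "i - 1"] by (cases i) (auto simp: funpow_swap1)
  then show ?thesis
    unfolding reaches_def using t(1) by (intro exI[of _ "Suc t"]) (simp add: funpow_swap1)
qed

lemma reaches_trans:
  assumes "reaches B c c'" "reaches B c' c''"
  shows "reaches B c c''"
proof -
  obtain t where t: "(step_config M ^^ t) c = c'"
    "\<And>i. i < t \<Longrightarrow> state ((step_config M ^^ i) c) \<noteq> code Checkpoint \<and>
            (\<forall>j. head ((step_config M ^^ i) c) j \<le> B)"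
    using assms(1) unfolding reaches_def by blast
  have "reaches B ((step_config M ^^ (t - k)) c) c''" if "k \<le> t" for k
    using that
  proof (induction k)
    case 0
    then show ?case using t(1) assms(2) by simp
  next
    case (Suc k)
    have "step_config M ((step_config M ^^ (t - Suc k)) c) = (step_config M ^^ (t - k)) c"
      using Suc.prems by (metis Suc_diff_Suc Suc_le_lessD comp_apply funpow.simps(2))
    then show ?case
      using Suc.IH Suc.prems t(2)[of "t - Suc k"]
      by (intro reaches_step[where c = "(step_config M ^^ (t - Suc k)) c"]) simp_all
  qed
  from this[of t] show ?thesis by simp
qed

lemma Checkpoint_in_controls: "Checkpoint \<in> controls"
  by (simp add: controls_def)

lemma head_conf:
  "head (conf k s) j =
     length (s j) + (case k of Write l R K \<Rightarrow> if j \<in> set R then 1 else 0 | _ \<Rightarrow> 0)"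
  by (simp add: conf_def)

lemma reaches_conf_step:
  assumes "k \<in> controls" "k \<noteq> Checkpoint" "\<And>j. head (conf k s) j \<le> B"
    and "reaches B (step_config M (conf k s)) c"
  shows "reaches B (conf k s) c"
  using assms by - (rule reaches_step, auto simp: conf_def code_eq_iff Checkpoint_in_controls)

lemma reaches_still:
  assumes "next_control k (tops s) = k'" "reaches B (conf k' s) c" "k \<in> controls"
    and "k \<noteq> Checkpoint" "\<And>b. k \<noteq> Done b"
    and "\<And>l R K. k \<noteq> Write l R K" "\<forall>j\<ge>T. s j = []" "\<forall>j. length (s j) \<le> B"
    and "\<And>j. action k (tops s) j = (tops s j, Stay)" "\<And>l R K. k' \<noteq> Write l R K"
  shows "reaches B (conf k s) c"
proof (rule reaches_conf_step[OF assms(3,4)])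
  show "head (conf k s) j \<le> B" for j
    using assms(6,8) by (auto simp: conf_def split: control.split)
  show "reaches B (step_config M (conf k s)) c"
    using assms by (simp add: step_conf_still)
qed

lemma reaches_pushed:
  assumes "Write l R K \<in> controls" "set R \<subseteq> {..<T}" "\<forall>j\<ge>T. s j = []"
    and "\<forall>j. length (s j) \<le> B" "\<forall>r\<in>set R. length (s r) < B"
  shows "reaches B (conf (Write l R K) s) (conf (Run K) (pushed l R s))"
  by (rule reaches_conf_step[OF assms(1)])
    (use assms in \<open>auto simp: step_conf_Write head_conf Suc_le_eq intro: reaches_refl\<close>)

text \<open>Correctness of the compilation. The height bound \<open>B\<close> must also cover the registers at the
  beginning, since their heads already stand at that height.\<close>

lemma reaches_exec:
  assumes "exec b c s s'" "registers c \<subseteq> {..<T}" "controls_of c K \<subseteq> controls"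
    and "b \<le> B" "\<forall>j. length (s j) \<le> B" "\<forall>j\<ge>T. s j = []"
  shows "reaches B (conf (Run (c # K)) s) (conf (Run K) s')"
  using assms
proof (induction arbitrary: K rule: exec.induct)
  case (Skip s)
  show ?case
    by (rule reaches_still[where k' = "Run K"]) (use Skip.prems in \<open>auto intro: reaches_refl\<close>)
next
  case (Push s r l)
  have k: "Run (Push r l # K) \<in> controls" and k': "Write l [r] K \<in> controls"
    using Push.prems by auto
  have "reaches B (conf (Write l [r] K) s) (conf (Run K) (pushed l [r] s))"
    by (rule reaches_pushed[OF k']) (use Push in auto)
  then show ?case
    using step_conf_Push[OF k] Push.prems
    by (intro reaches_conf_step[OF k]) (simp_all add: head_conf)
next
  case (Move s a l w R)
  have k: "Run (Move a R # K) \<in> controls" and k': "Write l R K \<in> controls"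
    using Move.prems by auto
  have "length w \<le> B" using Move.hyps(1) Move.prems(4)[rule_format, of a] by simp
  then have "reaches B (conf (Write l R K) (s(a := w))) (conf (Run K) (pushed l R (s(a := w))))"
    by (intro reaches_pushed[OF k']) (use Move in auto)
  then show ?case
    using step_conf_Move[OF k] Move.prems Move.hyps
    by (intro reaches_conf_step[OF k]) (simp_all add: head_conf)
next
  case (Seq c s s' d s'')
  have "\<forall>j. length (s' j) \<le> B" "\<forall>j\<ge>T. s' j = []"
    using Seq.prems exec_length[OF Seq.hyps(1), of B] exec_frame_above[OF Seq.hyps(1), of T]
    by simp_all
  then have "reaches B (conf (Run (d # K)) s') (conf (Run K) s'')"
    using Seq.prems by (intro Seq.IH(2)) auto
  moreover have "reaches B (conf (Run (c # d # K)) s) (conf (Run (d # K)) s')"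
    using Seq.prems by (intro Seq.IH(1)) auto
  ultimately have "reaches B (conf (Run (c # d # K)) s) (conf (Run K) s'')"
    by (blast intro: reaches_trans)
  then show ?case
    by (rule reaches_still[rotated]) (use Seq.prems in auto)
next
  case (Cond_True s r P c s' d)
  have "reaches B (conf (Run (c # K)) s) (conf (Run K) s')"
    using Cond_True.prems by (intro Cond_True.IH) auto
  then show ?case
    by (rule reaches_still[rotated])
      (use Cond_True.prems Cond_True.hyps in \<open>auto simp: letter_read_tops\<close>)
next
  case (Cond_False s r P d s' c)
  have "reaches B (conf (Run (d # K)) s) (conf (Run K) s')"
    using Cond_False.prems by (intro Cond_False.IH) auto
  then show ?case
    by (rule reaches_still[rotated])
      (use Cond_False.prems Cond_False.hyps in \<open>auto simp: letter_read_tops\<close>)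
next
  case (Loop_True s r P c s' s'')
  have "\<forall>j. length (s' j) \<le> B" "\<forall>j\<ge>T. s' j = []"
    using Loop_True.prems exec_length[OF Loop_True.hyps(2), of B] exec_frame_above[OF Loop_True.hyps(2), of T]
    by simp_all
  then have "reaches B (conf (Run (Loop r P c # K)) s') (conf (Run K) s'')"
    using Loop_True.prems by (intro Loop_True.IH(2)) auto
  moreover have "reaches B (conf (Run (c # Loop r P c # K)) s) (conf (Run (Loop r P c # K)) s')"
    using Loop_True.prems by (intro Loop_True.IH(1)) auto
  ultimately have "reaches B (conf (Run (c # Loop r P c # K)) s) (conf (Run K) s'')"
    by (blast intro: reaches_trans)
  then show ?case
    by (rule reaches_still[rotated])
      (use Loop_True.prems Loop_True.hyps in \<open>auto simp: letter_read_tops\<close>)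
next
  case (Loop_False s r P c)
  show ?case
    by (rule reaches_still[where k' = "Run K"])
      (use Loop_False in \<open>auto simp: letter_read_tops intro: reaches_refl\<close>)
qed

definition initial_store :: "letter list \<Rightarrow> store" where
  "initial_store w = (\<lambda>j. if j = 0 then rev w else [])"

lemma reaches_init:
  assumes "length w < B"
  shows "reaches B (initial_config M w) (conf (Run [init]) (initial_store w))"
proof -
  let ?c = "\<lambda>i. \<lparr>state = code Scan, content = (\<lambda>j. written (if j = 0 then w else [])),
     head = (\<lambda>j. if j = 0 then i else 0)\<rparr>"
  have Scan: "Scan \<in> controls" by (simp add: controls_def)
  have u: "(if 0 < T then written w i else Left_End) = written w i" for i
    using two_tapes by simp
  have step: "step_config M (?c i) = (if i \<le> length w then ?c (Suc i)
      else conf (Run [init]) (initial_store w))" if "i \<le> Suc (length w)" for i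
    using that two_tapes
    by (subst step_config_code[OF Scan _ refl])
      (auto simp: fun_eq_iff conf_def initial_store_def written_def)
  have "reaches B (?c (Suc (length w) - k)) (conf (Run [init]) (initial_store w))"
    if "k \<le> Suc (length w)" for k
    using that
  proof (induction k)
    case 0
    show ?case
      using assms Scan
      by - (rule reaches_step,
        auto simp: step reaches_refl code_eq_iff Checkpoint_in_controls)
  next
    case (Suc k)
    then have "step_config M (?c (Suc (length w) - Suc k)) = ?c (Suc (length w) - k)"
      by (subst step) (auto simp: Suc_diff_le)
    moreover have "reaches B (?c (Suc (length w) - k)) (conf (Run [init]) (initial_store w))"
      using Suc by simp
    ultimately show ?case
      using assms Scan
      by (intro reaches_step[where c = "?c (Suc (length w) - Suc k)"])
        (simp_all only:, auto simp: code_eq_iff Checkpoint_in_controls)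
  qed
  from this[of "Suc (length w)"] show ?thesis
    by (simp add: initial_config_def M_def cong: if_cong)
qed

lemma step_Done: "step_config M (conf (Done a) s) = conf (Done a) s"
  by (cases a) (simp_all add: step_config_def conf_def M_def)

text \<open>The store at the \<open>i\<close>-th checkpoint is \<open>\<sigma> i\<close>, and \<open>\<sigma> (Suc
  n)\<close> is the store after the last round. The checkpoint times are obtained by adding up the durations
  of the passages between consecutive checkpoints; every other time lies before the first one, strictly
  inside a passage, or after the machine has halted.\<close>

lemma run:
  fixes \<sigma> :: "nat \<Rightarrow> store"
  assumes init: "exec b init (initial_store w) (\<sigma> 0)" and w: "length w < b"
    and body: "\<And>i. i \<le> n \<Longrightarrow> exec b body (\<sigma> i) (\<sigma> (Suc i))"
    and continue: "\<And>i. i \<le> n \<Longrightarrow> peek (\<sigma> i ans) = None"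
    and stop: "peek (\<sigma> (Suc n) ans) = Some (Bit answer)"
  obtains time where "strict_mono_on {..n} time"
    "{t. state (config_at M w t) = code Checkpoint} = time ` {..n}"
    "\<And>i. i \<le> n \<Longrightarrow> content (config_at M w (time i)) = (\<lambda>j. written (rev (\<sigma> i j)))"
    "\<exists>t. state (config_at M w t) = (if answer then accept M else reject M)"
    "\<And>t j. head (config_at M w t) j \<le> b"
proof -
  have regs: "registers init \<subseteq> {..<T}" "registers body \<subseteq> {..<T}"
    using registers by auto
  have lengths: "length (\<sigma> i j) \<le> b" if "i \<le> Suc n" for i j
    using that
  proof (induction i arbitrary: j)
    case 0
    show ?case using w by (intro exec_length[OF init]) (auto simp: initial_store_def)
  next
    case (Suc i)
    then show ?case by (intro exec_length[OF body]) auto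
  qed
  have frame: "\<sigma> i j = []" if "i \<le> Suc n" "T \<le> j" for i j
    using that
  proof (induction i)
    case 0
    then show ?case
      using exec_frame[OF init, of j] regs two_tapes by (force simp: initial_store_def)
  next
    case (Suc i)
    then show ?case using exec_frame[OF body, of i j] regs by force
  qed
  define X where "X i = (if i \<le> n then conf Checkpoint (\<sigma> i) else conf (Done answer) (\<sigma> (Suc n)))" for i
  have controls: "Run [] \<in> controls" "controls_of init [] \<subseteq> controls"
    "controls_of body [] \<subseteq> controls" "Done answer \<in> controls"
    by (cases answer; auto simp: controls_def)+
  have end_run: "step_config M (conf (Run []) (\<sigma> i)) = X i" if "i \<le> Suc n" for i
  proof (cases "i \<le> n")
    case True
    then show ?thesis
      using that controls frame continue[of i] unfolding X_def
      by (subst step_conf_still) (auto simp: letter_read_tops)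
  next
    case False
    then have "i = Suc n" using that by simp
    then show ?thesis
      using that controls frame stop unfolding X_def
      by (subst step_conf_still) (auto simp: letter_read_tops)
  qed
  have to_X: "reaches b (conf (Run []) (\<sigma> i)) (X i)" if "i \<le> Suc n" for i
    using that controls lengths
    by - (rule reaches_conf_step, auto simp: end_run reaches_refl head_conf)
  have "reaches b (conf (Run [init]) (initial_store w)) (conf (Run []) (\<sigma> 0))"
    using init regs controls w two_tapes
    by (intro reaches_exec[OF init]) (auto simp: initial_store_def)
  then have "reaches b (initial_config M w) (X 0)"
    using reaches_init[OF w] to_X[of 0] reaches_trans by blast
  then obtain t0 where t0: "config_at M w t0 = X 0"
    "\<And>t. t < t0 \<Longrightarrow> state (config_at M w t) \<noteq> code Checkpoint"
    "\<And>t j. t < t0 \<Longrightarrow> head (config_at M w t) j \<le> b"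
    unfolding reaches_def config_at_def by blast
  have gap: "\<exists>d. (step_config M ^^ Suc d) (X i) = X (Suc i) \<and>
      (\<forall>e<d. state ((step_config M ^^ Suc e) (X i)) \<noteq> code Checkpoint \<and>
         (\<forall>j. head ((step_config M ^^ Suc e) (X i)) j \<le> b))" if "i \<le> n" for i
  proof -
    have "step_config M (X i) = conf (Run [body]) (\<sigma> i)"
      using that frame Checkpoint_in_controls unfolding X_def
      by (subst if_P, simp, subst step_conf_still) auto
    moreover have "reaches b (conf (Run [body]) (\<sigma> i)) (X (Suc i))"
    proof (rule reaches_trans)
      show "reaches b (conf (Run [body]) (\<sigma> i)) (conf (Run []) (\<sigma> (Suc i)))"
        using that regs controls lengths frame by (intro reaches_exec[OF body]) auto
      show "reaches b (conf (Run []) (\<sigma> (Suc i))) (X (Suc i))"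
        using that by (intro to_X) simp
    qed
    ultimately show ?thesis
      unfolding reaches_def by (auto simp: funpow_swap1)
  qed
  then obtain d where d: "\<And>i. i \<le> n \<Longrightarrow> (step_config M ^^ Suc (d i)) (X i) = X (Suc i)"
    "\<And>i e. i \<le> n \<Longrightarrow> e < d i \<Longrightarrow> state ((step_config M ^^ Suc e) (X i)) \<noteq> code Checkpoint"
    "\<And>i e j. i \<le> n \<Longrightarrow> e < d i \<Longrightarrow> head ((step_config M ^^ Suc e) (X i)) j \<le> b"
    by metis
  define time where "time = rec_nat t0 (\<lambda>i t. t + Suc (d i))"
  have time_simps: "time 0 = t0" "time (Suc i) = time i + Suc (d i)" for i
    by (simp_all add: time_def)
  have mono: "strict_mono time"
    by (simp add: strict_mono_Suc_iff time_simps)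
  have shift: "config_at M w (s + t) = (step_config M ^^ t) (config_at M w s)" for s t
    unfolding config_at_def by (subst add.commute) (simp add: funpow_add)
  have at_time: "config_at M w (time i) = X i" if "i \<le> Suc n" for i
    using that by (induction i) (simp_all add: time_simps t0 shift d del: funpow.simps add_Suc_right)
  have between: "\<exists>i\<le>n. \<exists>e. t = time i + e \<and> e \<le> d i" if "t0 \<le> t" "t < time (Suc n)" for t
    using that(2)
  proof (induction n)
    case 0
    then show ?case using that(1) by (auto simp: time_simps intro!: exI[of _ "t - t0"])
  next
    case (Suc m)
    show ?case
    proof (cases "t < time (Suc m)")
      case True
      then show ?thesis using Suc.IH by (metis le_SucI)
    next
      case False
      then show ?thesis
        using Suc.prems
        by (intro exI[of _ "Suc m"] conjI exI[of _ "t - time (Suc m)"]) (auto simp: time_simps)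
    qed
  qed
  have after: "config_at M w (time (Suc n) + t) = X (Suc n)" for t
  proof -
    have "(step_config M ^^ t) (X (Suc n)) = X (Suc n)"
      by (induction t) (simp_all add: X_def step_Done)
    then show ?thesis by (simp add: shift at_time)
  qed
  have classify: "(t < t0) \<or> (\<exists>i\<le>n. t = time i) \<or> (\<exists>i\<le>n. \<exists>e<d i. t = time i + Suc e)
      \<or> (\<exists>t'. t = time (Suc n) + t')" for t
  proof (cases "t0 \<le> t \<and> t < time (Suc n)")
    case True
    then obtain i e where "i \<le> n" "t = time i + e" "e \<le> d i" using between by blast
    then show ?thesis by (cases e) auto
  next
    case False
    then show ?thesis using le_Suc_ex[of "time (Suc n)" t] by fastforce
  qed
  have mid: "config_at M w (time i + Suc e) = (step_config M ^^ Suc e) (X i)" if "i \<le> n" for i e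
    using that by (simp add: shift at_time del: funpow.simps add_Suc_right)
  have X_head: "head (X i) j \<le> b" for i j
    using lengths[of i j] lengths[of "Suc n" j] by (auto simp: X_def conf_def)
  show ?thesis
  proof (rule that)
    show "strict_mono_on {..n} time"
      using mono by (auto simp: strict_mono_on_def strict_mono_def)
    show "{t. state (config_at M w t) = code Checkpoint} = time ` {..n}" (is "?L = ?R")
    proof
      show "?R \<subseteq> ?L" by (auto simp: at_time X_def conf_def)
      show "?L \<subseteq> ?R"
      proof
        fix t assume "t \<in> ?L"
        moreover have "state (X (Suc n)) \<noteq> code Checkpoint"
          using controls by (auto simp: X_def conf_def code_eq_iff Checkpoint_in_controls)
        ultimately show "t \<in> ?R"
          using classify[of t] t0(2)[of t] d(2) mid after by auto
      qed
    qed
    show "content (config_at M w (time i)) = (\<lambda>j. written (rev (\<sigma> i j)))" if "i \<le> n" for i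
      using that by (simp add: at_time X_def conf_def)
    show "\<exists>t. state (config_at M w t) = (if answer then accept M else reject M)"
      using after[of 0] by (auto simp: X_def conf_def M_def intro!: exI[of _ "time (Suc n)"])
    show "head (config_at M w t) j \<le> b" for t j
      using classify[of t] t0(3)[of t j] d(3) mid after at_time X_head by auto
  qed
qed

end

section \<open>Functions computable in polynomial space\<close>

text \<open>Values are written as words, and each word belongs to at most one value. Injectivity makes equality of
  values a comparison of words.\<close>

class enc =
  fixes enc :: "'a \<Rightarrow> letter list"
  assumes enc_inject: "enc x = enc y \<Longrightarrow> x = y"

lemma enc_eq_iff: "enc x = enc y \<longleftrightarrow> x = y"
  using enc_inject by blast

abbreviation sz :: "'a::enc \<Rightarrow> nat" where
  "sz x \<equiv> length (enc x)"

lemma poly_nat_mono: "m \<le> n \<Longrightarrow> poly (p :: nat poly) m \<le> poly p n"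
  by (induction p) (auto intro!: add_mono mult_mono)

text \<open>The program turns the word in register 0 into the word of the result. Registers 1 to \<open>k - 1\<close>
  are scratch space, empty before and after; all other registers may hold anything and are left alone. This
  is what allows a value to be parked in a high register while another program runs.\<close>

definition computes :: "com \<Rightarrow> nat \<Rightarrow> nat poly \<Rightarrow> ('a::enc \<Rightarrow> 'b::enc) \<Rightarrow> bool" where
  "computes c k p f \<longleftrightarrow>
     (\<forall>x. sz (f x) \<le> poly p (sz x)) \<and>
     (\<forall>x s. s 0 = enc x \<longrightarrow> (\<forall>i. 0 < i \<and> i < k \<longrightarrow> s i = []) \<longrightarrow>
        exec (poly p (sz x)) c s (s(0 := enc (f x))))"

definition pspace :: "('a::enc \<Rightarrow> 'b::enc) \<Rightarrow> bool" where
  "pspace f \<longleftrightarrow> (\<exists>c k p. computes c k p f)"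

lemma pspaceI:
  assumes "\<And>x. sz (f x) \<le> poly p (sz x)"
    and "\<And>x s. s 0 = enc x \<Longrightarrow> (\<And>i. 0 < i \<Longrightarrow> i < k \<Longrightarrow> s i = []) \<Longrightarrow>
        exec (poly p (sz x)) c s (s(0 := enc (f x)))"
  shows "pspace f"
  unfolding pspace_def computes_def
  by (intro exI[of _ c] exI[of _ k] exI[of _ p] conjI allI impI) (simp_all add: assms)

lemma pspaceE:
  assumes "pspace f"
  obtains c k p where "computes c k p f"
  using assms unfolding pspace_def by blast

lemma computes_size: "computes c k p f \<Longrightarrow> sz (f x) \<le> poly p (sz x)"
  by (simp add: computes_def)

lemma computes_exec:
  assumes "computes c k p f" "s 0 = enc x" "\<And>i. 0 < i \<Longrightarrow> i < k \<Longrightarrow> s i = []"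
    and "poly p (sz x) \<le> b" "s' = s(0 := enc (f x))"
  shows "exec b c s s'"
  using assms unfolding computes_def by (metis exec_mono)

lemma pspace_size: "pspace f \<Longrightarrow> \<exists>p :: nat poly. \<forall>x. sz (f x) \<le> poly p (sz x)"
  using computes_size by (metis pspaceE)

subsection \<open>Program fragments\<close>

definition transfer :: "nat \<Rightarrow> nat list \<Rightarrow> com" where
  "transfer a R = Loop a (- {None}) (Move a R)"

lemma exec_transfer:
  assumes "a \<notin> set R" "\<And>r. r \<in> set R \<Longrightarrow> length (s r) + length (s a) \<le> b"
    and "s' = (\<lambda>r. if r = a then [] else if r \<in> set R then rev (s a) @ s r else s r)"
  shows "exec b (transfer a R) s s'"
  using assms
proof (induction "s a" arbitrary: s)
  case Nil
  have "s' = s"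
    using Nil by (auto simp: fun_eq_iff)
  then show ?case
    unfolding transfer_def using exec.Loop_False[of s a] Nil by (metis ComplD insertI1 peek.simps(1))
next
  case (Cons l w)
  let ?t = "pushed l R (s(a := w))"
  have "\<forall>r\<in>set R. length (s r) < b"
    using Cons.prems(2) Cons.hyps(2) by (metis add_lessD1 length_Cons less_add_Suc1 order_less_le_trans
      add_Suc_right not_add_less1 nat_less_le)
  then have 1: "exec b (Move a R) s ?t"
    using Cons.hyps(2)[symmetric] Cons.prems(1) by (intro exec.Move)
  have 2: "exec b (transfer a R) ?t s'"
  proof (rule Cons.hyps(1))
    show "w = ?t a" using Cons.prems(1) by (simp add: pushed_def)
    show "length (?t r) + length (?t a) \<le> b" if "r \<in> set R" for r
      using Cons.prems(1) Cons.prems(2)[OF that] Cons.hyps(2)[symmetric] that by (auto simp: pushed_def)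
    show "s' = (\<lambda>r. if r = a then [] else if r \<in> set R then rev (?t a) @ ?t r else ?t r)"
      using Cons.prems Cons.hyps(2)[symmetric] by (auto simp: pushed_def fun_eq_iff)
  qed (fact Cons.prems(1))
  show ?case
    using 1 2 unfolding transfer_def
    by (rule exec.Loop_True[rotated]) (simp flip: Cons.hyps(2))
qed

lemma pushed_Nil: "pushed l [] s = s"
  by (simp add: pushed_def)

lemma pushed_single: "pushed l [r] s = s(r := l # s r)"
  by (auto simp: pushed_def fun_eq_iff)

lemma exec_drop: "s a = l # w \<Longrightarrow> s' = s(a := w) \<Longrightarrow> exec b (Move a []) s s'"
  using exec.Move[of s a l w "[]" b] by (simp add: pushed_Nil)

lemma exec_push: "length (s r) < b \<Longrightarrow> s' = s(r := l # s r) \<Longrightarrow> exec b (Push r l) s s'"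
  using exec.Push[of s r b l] by (simp add: pushed_single)

text \<open>Computes a value without destroying the argument: the argument is copied to register \<open>m\<close>
  while it is moved back and forth (each move reverses a word), and the result ends up, reversed, in
  register \<open>m + 2\<close>.\<close>

definition aside :: "com \<Rightarrow> nat \<Rightarrow> com" where
  "aside c m = Seq (transfer 0 [m + 1]) (Seq (transfer (m + 1) [0, m]) (Seq c
     (Seq (transfer 0 [m + 2]) (Seq (transfer m [m + 1]) (transfer (m + 1) [0])))))"

lemma exec_aside:
  assumes c: "computes c k p f" and m: "k \<le> m" "0 < m"
    and s: "s 0 = enc x" "\<And>i. 0 < i \<Longrightarrow> i < k \<Longrightarrow> s i = []" "s m = []" "s (m + 1) = []" "s (m + 2) = []"
    and b: "sz x + poly p (sz x) \<le> b" and s': "s' = s(m + 2 := rev (enc (f x)))"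
  shows "exec b (aside c m) s s'"
proof -
  note sz = computes_size[OF c, of x]
  let ?s2 = "s(m := enc x)"
  let ?s3 = "?s2(0 := enc (f x))"
  let ?s4 = "s(0 := [], m := enc x, m + 2 := rev (enc (f x)))"
  let ?s5 = "s(0 := [], m + 1 := rev (enc x), m + 2 := rev (enc (f x)))"
  have "exec b (transfer 0 [m + 1]) s (s(0 := [], m + 1 := rev (enc x)))"
    by (rule exec_transfer) (use s b m in \<open>auto simp: fun_eq_iff\<close>)
  moreover have "exec b (transfer (m + 1) [0, m]) (s(0 := [], m + 1 := rev (enc x))) ?s2"
    by (rule exec_transfer) (use s b m in \<open>auto simp: fun_eq_iff\<close>)
  moreover have "exec b c ?s2 ?s3"
    by (rule computes_exec[OF c]) (use s b m in auto)
  moreover have "exec b (transfer 0 [m + 2]) ?s3 ?s4"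
    by (rule exec_transfer) (use s b m sz in \<open>auto simp: fun_eq_iff\<close>)
  moreover have "exec b (transfer m [m + 1]) ?s4 ?s5"
    by (rule exec_transfer) (use s b m sz in \<open>auto simp: fun_eq_iff\<close>)
  moreover have "exec b (transfer (m + 1) [0]) ?s5 s'"
    by (rule exec_transfer) (use s b m sz s' in \<open>auto simp: fun_eq_iff\<close>)
  ultimately show ?thesis
    unfolding aside_def by (blast intro: exec.Seq)
qed

fun put :: "letter list \<Rightarrow> com" where
  "put [] = Skip"
| "put (l # w) = Seq (put w) (Push 0 l)"

lemma exec_put: "length w + length (s 0) \<le> b \<Longrightarrow> s' = s(0 := w @ s 0) \<Longrightarrow> exec b (put w) s s'"
proof (induction w arbitrary: s')
  case Nil
  then show ?case by (simp add: exec.Skip)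
next
  case (Cons l w)
  have "exec b (put w) s (s(0 := w @ s 0))"
    by (rule Cons.IH) (use Cons.prems in auto)
  then show ?case
    unfolding put.simps
    by (rule exec.Seq[OF _ exec_push]) (use Cons.prems in auto)
qed

lemma exec_clear: "s' = s(a := []) \<Longrightarrow> exec b (transfer a []) s s'"
  by (rule exec_transfer) auto

subsection \<open>Basic functions\<close>

text \<open>Nothing has to be done if argument and result are written in the same way. Together with the type
  \<open>raw\<close> below this makes conversions between types with related encodings free of charge.\<close>

lemma pspace_recode:
  assumes "\<And>x. enc (f x) = enc x"
  shows "pspace f"
proof (rule pspaceI)
  show "sz (f x) \<le> poly [:0, 1:] (sz x)" for x
    by (simp add: assms)
  show "exec (poly [:0, 1:] (sz x)) Skip s (s(0 := enc (f x)))"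
    if "s 0 = enc x" for x and s :: store
    using exec.Skip[of _ s] that by (simp add: assms fun_upd_idem)
qed

lemma pspace_id: "pspace (\<lambda>x. x)"
  by (rule pspace_recode) simp

lemma pspace_comp:
  assumes "pspace f" "pspace g"
  shows "pspace (\<lambda>x. g (f x))"
proof -
  obtain c k p where c: "computes c k p f" using assms(1) by (rule pspaceE)
  obtain d l q where d: "computes d l q g" using assms(2) by (rule pspaceE)
  let ?r = "p + pcompose q p"
  have le: "poly q (sz (f x)) \<le> poly q (poly p (sz x))" for x
    by (rule poly_nat_mono) (rule computes_size[OF c])
  show ?thesis
  proof (rule pspaceI)
    show "sz (g (f x)) \<le> poly ?r (sz x)" for x
      using computes_size[OF d, of "f x"] le[of x] by (simp add: poly_pcompose)
    show "exec (poly ?r (sz x)) (Seq c d) s (s(0 := enc (g (f x))))"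
      if "s 0 = enc x" "\<And>i. 0 < i \<Longrightarrow> i < max k l \<Longrightarrow> s i = []" for x and s :: store
    proof (rule exec.Seq)
      show "exec (poly ?r (sz x)) c s (s(0 := enc (f x)))"
        by (rule computes_exec[OF c]) (use that in auto)
      show "exec (poly ?r (sz x)) d (s(0 := enc (f x))) (s(0 := enc (g (f x))))"
        by (rule computes_exec[OF d, where x = "f x"])
          (use that le[of x] in \<open>auto simp: poly_pcompose\<close>)
    qed
  qed
qed

lemma pspace_const:
  fixes a :: "'b::enc"
  shows "pspace (\<lambda>x :: 'a::enc. a)"
proof (rule pspaceI)
  show "sz a \<le> poly [:sz a:] (sz x)" for x :: 'a
    by simp
  show "exec (poly [:sz a:] (sz x)) (Seq (transfer 0 []) (put (enc a))) s (s(0 := enc a))"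
    for x :: 'a and s :: store
    by (rule exec.Seq[OF exec_clear[OF refl] exec_put]) auto
qed

text \<open>Words as values that are their own encoding, in contrast to the type \<^typ>\<open>letter list\<close>,
  which is encoded element by element like any other list.\<close>

datatype raw = Raw (letters: "letter list")

instantiation raw :: enc
begin

definition "enc r = letters r"

instance
  by standard (simp add: enc_raw_def raw.expand)

end

instantiation bool :: enc
begin

definition "enc b = [Bit b]"

instance
  by standard (simp add: enc_bool_def)

end

instantiation letter :: enc
begin

definition "enc l = [l :: letter]"

instance
  by standard (simp add: enc_letter_def)

end

text \<open>A self-delimiting form of a word: each letter is announced by the bit \<^term>\<open>True\<close>, and the
  bit \<^term>\<open>False\<close> afterwards marks the end.\<close>

definition escape :: "letter list \<Rightarrow> letter list" where
  "escape w = concat (map (\<lambda>l. [Bit True, l]) w)"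

lemma escape_simps [simp]:
  "escape [] = []" "escape (l # w) = Bit True # l # escape w"
  "escape (v @ w) = escape v @ escape w" "length (escape w) = 2 * length w"
  by (simp_all add: escape_def length_concat comp_def sum_list_triv)

lemma escape_inject:
  "escape u @ Bit False # v = escape u' @ Bit False # v' \<Longrightarrow> u = u' \<and> v = v'"
proof (induction u arbitrary: u')
  case Nil
  then show ?case by (cases u') auto
next
  case (Cons l u)
  then show ?case by (cases u') auto
qed

instantiation prod :: (enc, enc) enc
begin

definition "enc x = escape (enc (fst x)) @ Bit False # enc (snd x)"

instance
  by standard (auto simp: enc_prod_def prod_eq_iff enc_eq_iff dest: escape_inject)

end

lemma sz_simps [simp]:
  "sz (Raw w) = length w" "sz (b :: bool) = 1" "sz (l :: letter) = 1"
  "sz (x, y) = 2 * sz x + sz y + 1"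
  by (simp_all add: enc_raw_def enc_bool_def enc_letter_def enc_prod_def)

text \<open>Register \<open>a\<close> contains the first component reversed and register 0 the second one; popping
  from \<open>a\<close> pushes the escaped letters in the right order.\<close>

definition combine :: "nat \<Rightarrow> com" where
  "combine a = Seq (Push 0 (Bit False)) (Loop a (- {None}) (Seq (Move a [0]) (Push 0 (Bit True))))"

lemma exec_escape:
  assumes "0 < a" "length (s 0) + 2 * length (s a) \<le> b"
    and "s' = s(0 := escape (rev (s a)) @ s 0, a := [])"
  shows "exec b (Loop a (- {None}) (Seq (Move a [0]) (Push 0 (Bit True)))) s s'"
  using assms
proof (induction "s a" arbitrary: s)
  case Nil
  then have "s' = s"
    by (auto simp: fun_eq_iff)
  then show ?case
    using exec.Loop_False[of s a] Nil by (metis ComplD insertI1 peek.simps(1))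
next
  case (Cons l w)
  let ?t = "s(0 := Bit True # l # s 0, a := w)"
  have "exec b (Move a [0]) s (pushed l [0] (s(a := w)))"
    using Cons.prems Cons.hyps(2)[symmetric] by (intro exec.Move) auto
  moreover have "exec b (Push 0 (Bit True)) (pushed l [0] (s(a := w))) ?t"
    using Cons.prems Cons.hyps(2)[symmetric]
    by (intro exec_push) (auto simp: pushed_def fun_eq_iff)
  ultimately have 1: "exec b (Seq (Move a [0]) (Push 0 (Bit True))) s ?t"
    by (rule exec.Seq)
  have 2: "exec b (Loop a (- {None}) (Seq (Move a [0]) (Push 0 (Bit True)))) ?t s'"
    using Cons.prems Cons.hyps(2)[symmetric] by (intro Cons.hyps(1)) (auto simp: fun_eq_iff)
  show ?case
    using 1 2 by (rule exec.Loop_True[rotated]) (simp flip: Cons.hyps(2))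
qed

lemma pspace_Pair:
  assumes "pspace f" "pspace g"
  shows "pspace (\<lambda>x. (f x, g x))"
proof -
  obtain c k p where c: "computes c k p f" using assms(1) by (rule pspaceE)
  obtain d l q where d: "computes d l q g" using assms(2) by (rule pspaceE)
  define m where "m = Suc (max k l)"
  have m: "k \<le> m" "l \<le> m" "0 < m" by (auto simp: m_def)
  let ?r = "[:1, 1:] + [:2:] * p + q"
  note size = computes_size[OF c] computes_size[OF d]
  show ?thesis
  proof (rule pspaceI)
    show "sz (f x, g x) \<le> poly ?r (sz x)" for x
      using size[of x] by simp
    show "exec (poly ?r (sz x)) (Seq (aside c m) (Seq d (combine (m + 2)))) s
        (s(0 := enc (f x, g x)))"
      if s: "s 0 = enc x" "\<And>i. 0 < i \<Longrightarrow> i < m + 3 \<Longrightarrow> s i = []" for x and s :: store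
    proof (intro exec.Seq)
      let ?s = "s(m + 2 := rev (enc (f x)))"
      show "exec (poly ?r (sz x)) (aside c m) s ?s"
        by (rule exec_aside[OF c]) (use s m size[of x] in auto)
      show "exec (poly ?r (sz x)) d ?s (?s(0 := enc (g x)))"
        by (rule computes_exec[OF d]) (use s m size[of x] in auto)
      show "exec (poly ?r (sz x)) (combine (m + 2)) (?s(0 := enc (g x))) (s(0 := enc (f x, g x)))"
        unfolding combine_def
        by (rule exec.Seq[OF exec_push[OF _ refl] exec_escape])
          (use s m size[of x] in \<open>auto simp: fun_eq_iff enc_prod_def\<close>)
    qed
  qed
qed

definition skip_escaped :: "nat list \<Rightarrow> com" where
  "skip_escaped R = Loop 0 {Some (Bit True)} (Seq (Move 0 []) (Move 0 R))"

lemma exec_skip_escaped: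
  assumes "s 0 = escape u @ Bit False # v" "0 \<notin> set R"
    and "\<And>r. r \<in> set R \<Longrightarrow> length (s r) + length u \<le> b"
    and "s' = (\<lambda>r. if r = 0 then Bit False # v else if r \<in> set R then rev u @ s r else s r)"
  shows "exec b (skip_escaped R) s s'"
  using assms
proof (induction u arbitrary: s)
  case Nil
  then have "s' = s"
    by (auto simp: fun_eq_iff)
  then show ?case
    using exec.Loop_False[of s 0] Nil by (simp add: skip_escaped_def)
next
  case (Cons l u)
  let ?t = "pushed l R (s(0 := escape u @ Bit False # v))"
  let ?s = "s(0 := l # escape u @ Bit False # v)"
  have "exec b (Move 0 R) ?s (pushed l R (?s(0 := escape u @ Bit False # v)))"
    using Cons.prems(2,3) by (intro exec.Move) fastforce+
  moreover have "exec b (Move 0 []) s ?s"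
    using Cons.prems(1) by (intro exec_drop) auto
  ultimately have 1: "exec b (Seq (Move 0 []) (Move 0 R)) s ?t"
    by (auto intro: exec.Seq)
  have 2: "exec b (skip_escaped R) ?t s'"
  proof (rule Cons.IH)
    show "length (?t r) + length u \<le> b" if "r \<in> set R" for r
      using Cons.prems(3)[OF that] that Cons.prems(2) by (auto simp: pushed_def)
  qed (use Cons.prems in \<open>auto simp: pushed_def fun_eq_iff\<close>)
  show ?case
    using 1 2 unfolding skip_escaped_def
    by (rule exec.Loop_True[rotated]) (simp add: Cons.prems)
qed

lemma pspace_fst': "pspace (fst :: 'a::enc \<times> 'b::enc \<Rightarrow> 'a)"
proof (rule pspaceI)
  let ?c = "Seq (skip_escaped [1]) (Seq (transfer 0 []) (transfer 1 [0]))"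
  show "sz (fst z) \<le> poly [:0, 1:] (sz z)" for z :: "'a \<times> 'b"
    by (cases z) simp
  show "exec (poly [:0, 1:] (sz z)) ?c s (s(0 := enc (fst z)))"
    if s: "s 0 = enc z" "\<And>i. 0 < i \<Longrightarrow> i < 2 \<Longrightarrow> s i = []" for z :: "'a \<times> 'b" and s :: store
  proof (intro exec.Seq)
    let ?b = "poly [:0, 1:] (sz z)"
    let ?s = "s(0 := Bit False # enc (snd z), 1 := rev (enc (fst z)))"
    have b: "sz (fst z) \<le> ?b" by (cases z) simp
    show "exec ?b (skip_escaped [1]) s ?s"
      by (rule exec_skip_escaped) (use s b in \<open>auto simp: enc_prod_def fun_eq_iff\<close>)
    show "exec ?b (transfer 0 []) ?s (?s(0 := []))"
      by (rule exec_clear) simp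
    show "exec ?b (transfer 1 [0]) (?s(0 := [])) (s(0 := enc (fst z)))"
      by (rule exec_transfer) (use s b in \<open>auto simp: fun_eq_iff\<close>)
  qed
qed

lemma pspace_snd': "pspace (snd :: 'a::enc \<times> 'b::enc \<Rightarrow> 'b)"
proof (rule pspaceI)
  let ?c = "Seq (skip_escaped []) (Move 0 [])"
  show "sz (snd z) \<le> poly [:0, 1:] (sz z)" for z :: "'a \<times> 'b"
    by (cases z) simp
  show "exec (poly [:0, 1:] (sz z)) ?c s (s(0 := enc (snd z)))"
    if s: "s 0 = enc z" "\<And>i. 0 < i \<Longrightarrow> i < 2 \<Longrightarrow> s i = []" for z :: "'a \<times> 'b" and s :: store
  proof (rule exec.Seq)
    show "exec (poly [:0, 1:] (sz z)) (skip_escaped []) s (s(0 := Bit False # enc (snd z)))"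
      by (rule exec_skip_escaped) (use s in \<open>auto simp: enc_prod_def fun_eq_iff\<close>)
  qed (rule exec_drop, auto)
qed

lemma pspace_push': "pspace (\<lambda>r. Raw (l # letters r))"
proof (rule pspaceI)
  show "sz (Raw (l # letters r)) \<le> poly [:1, 1:] (sz r)" for r
    by (simp add: enc_raw_def)
  show "exec (poly [:1, 1:] (sz r)) (Push 0 l) s (s(0 := enc (Raw (l # letters r))))"
    if "s 0 = enc r" for r and s :: store
    by (rule exec_push) (use that in \<open>auto simp: enc_raw_def\<close>)
qed

lemma pspace_pop': "pspace (\<lambda>r. Raw (tl (letters r)))"
proof (rule pspaceI)
  show "sz (Raw (tl (letters r))) \<le> poly [:0, 1:] (sz r)" for r
    by (simp add: enc_raw_def)
  show "exec (poly [:0, 1:] (sz r)) (Cond 0 {None} Skip (Move 0 [])) s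
      (s(0 := enc (Raw (tl (letters r)))))"
    if "s 0 = enc r" for r and s :: store
  proof (cases "letters r")
    case Nil
    then have "s = s(0 := enc (Raw (tl (letters r))))"
      using that by (auto simp: enc_raw_def fun_eq_iff)
    then show ?thesis
      using exec.Cond_True[OF _ exec.Skip, of s 0 "{None}"] that Nil by (simp add: enc_raw_def)
  next
    case (Cons l w)
    then show ?thesis
      using that by (intro exec.Cond_False exec_drop) (auto simp: enc_raw_def)
  qed
qed

lemma pspace_peek': "pspace (\<lambda>r. peek (letters r) \<in> P)"
proof (rule pspaceI)
  let ?c = "\<lambda>v. Seq (transfer 0 []) (Push 0 (Bit v))"
  have *: "exec b (?c v) s (s(0 := [Bit v]))" if "0 < b" for b v s
    by (rule exec.Seq[OF exec_clear[OF refl] exec_push]) (use that in auto)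
  show "sz (peek (letters r) \<in> P) \<le> poly [:1:] (sz r)" for r
    by simp
  show "exec (poly [:1:] (sz r)) (Cond 0 P (?c True) (?c False)) s
      (s(0 := enc (peek (letters r) \<in> P)))"
    if "s 0 = enc r" for r and s :: store
  proof (cases "peek (letters r) \<in> P")
    case True
    then show ?thesis
      using that * by (auto simp: enc_raw_def enc_bool_def intro: exec.Cond_True)
  next
    case False
    then show ?thesis
      using that * by (auto simp: enc_raw_def enc_bool_def intro: exec.Cond_False)
  qed
qed

lemma pspace_If:
  assumes "pspace c" "pspace f" "pspace g"
  shows "pspace (\<lambda>x. if c x then f x else g x)"
proof -
  obtain pc kc bc where c: "computes pc kc bc c" using assms(1) by (rule pspaceE)
  obtain pf kf bf where f: "computes pf kf bf f" using assms(2) by (rule pspaceE)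
  obtain pg kg bg where g: "computes pg kg bg g" using assms(3) by (rule pspaceE)
  define m where "m = Suc (max kc (max kf kg))"
  have m: "kc \<le> m" "kf \<le> m" "kg \<le> m" "0 < m" by (auto simp: m_def)
  let ?r = "[:0, 1:] + bc + bf + bg"
  let ?d = "Seq (Move (m + 2) [])"
  show ?thesis
  proof (rule pspaceI)
    show "sz (if c x then f x else g x) \<le> poly ?r (sz x)" for x
      using computes_size[OF f, of x] computes_size[OF g, of x] by simp
    show "exec (poly ?r (sz x)) (Seq (aside pc m)
          (Cond (m + 2) {Some (Bit True)} (?d pf) (?d pg))) s
        (s(0 := enc (if c x then f x else g x)))"
      if s: "s 0 = enc x" "\<And>i. 0 < i \<Longrightarrow> i < m + 3 \<Longrightarrow> s i = []" for x and s :: store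
    proof (rule exec.Seq)
      let ?s = "s(m + 2 := [Bit (c x)])"
      show "exec (poly ?r (sz x)) (aside pc m) s ?s"
        by (rule exec_aside[OF c]) (use s m in \<open>auto simp: enc_bool_def\<close>)
      have d: "exec b (Move (m + 2) []) ?s s" for b
        by (rule exec_drop) (use s m in \<open>auto simp: fun_eq_iff\<close>)
      show "exec (poly ?r (sz x)) (Cond (m + 2) {Some (Bit True)} (?d pf) (?d pg)) ?s
          (s(0 := enc (if c x then f x else g x)))"
      proof (cases "c x")
        case True
        have "exec (poly ?r (sz x)) pf s (s(0 := enc (f x)))"
          by (rule computes_exec[OF f]) (use s m in auto)
        then show ?thesis
          using True by (intro exec.Cond_True exec.Seq[OF d]) auto
      next
        case False
        have "exec (poly ?r (sz x)) pg s (s(0 := enc (g x)))"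
          by (rule computes_exec[OF g]) (use s m in auto)
        then show ?thesis
          using False by (intro exec.Cond_False exec.Seq[OF d]) auto
      qed
    qed
  qed
qed

text \<open>While loops as a relation between the first and the last value. Being inductive, it includes termination,
  and one induction establishes termination, result and size bound of a given loop.\<close>

inductive loops :: "('s::enc \<Rightarrow> bool) \<Rightarrow> ('s \<Rightarrow> 's) \<Rightarrow> nat \<Rightarrow> 's \<Rightarrow> 's \<Rightarrow> bool" for c f b where
  stop: "\<not> c x \<Longrightarrow> sz x \<le> b \<Longrightarrow> loops c f b x x"
| step: "c x \<Longrightarrow> sz x \<le> b \<Longrightarrow> loops c f b (f x) y \<Longrightarrow> loops c f b x y"

lemma loops_size: "loops c f b x y \<Longrightarrow> sz x \<le> b \<and> sz y \<le> b"
  by (induction rule: loops.induct) auto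

text \<open>The source of the closure properties for words, lists and numbers below. There is no restriction on the
  number of iterations; only the size of the intermediate values has to be polynomial in the size of
  \<open>x\<close>.\<close>

lemma pspace_while:
  fixes init :: "'a::enc \<Rightarrow> 's::enc" and h :: "'a \<Rightarrow> 's"
  assumes "pspace init" "pspace c" "pspace f"
    and loops: "\<And>x. loops c f (poly p (sz x)) (init x) (h x)"
  shows "pspace h"
proof -
  obtain pi ki bi where i: "computes pi ki bi init" using assms(1) by (rule pspaceE)
  obtain pc kc bc where c: "computes pc kc bc c" using assms(2) by (rule pspaceE)
  obtain pf kf bf where f: "computes pf kf bf f" using assms(3) by (rule pspaceE)
  define m where "m = Suc (max kc (max kf ki))"
  have m: "kc \<le> m" "kf \<le> m" "ki \<le> m" "0 < m" by (auto simp: m_def)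
  \<comment> \<open>The condition and the loop body are applied to values of size at most \<open>poly p (sz
    x)\<close>, which explains the compositions.\<close>
  define r where "r = bi + p + pcompose bc p + pcompose bf p"
  let ?body = "Seq (Move (m + 2) []) (Seq pf (aside pc m))"
  let ?loop = "Loop (m + 2) {Some (Bit True)} ?body"
  show ?thesis
  proof (rule pspaceI)
    show "sz (h x) \<le> poly r (sz x)" for x
      using loops_size[OF loops[of x]] by (simp add: r_def)
    show "exec (poly r (sz x)) (Seq pi (Seq (aside pc m) (Seq ?loop (Move (m + 2) [])))) s
        (s(0 := enc (h x)))"
      if s: "s 0 = enc x" "\<And>i. 0 < i \<Longrightarrow> i < m + 3 \<Longrightarrow> s i = []" for x and s :: store
    proof -
      let ?b = "poly r (sz x)"
      define S where "S y = s(0 := enc y, m + 2 := [Bit (c y)])" for y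
      have test: "exec ?b (aside pc m) (s(0 := enc y)) (S y)" if "sz y \<le> poly p (sz x)" for y
        by (rule exec_aside[OF c, where x = y])
          (use s m that poly_nat_mono[OF that, of bc] in
            \<open>auto simp: enc_bool_def S_def r_def poly_pcompose\<close>)
      have drop: "exec ?b (Move (m + 2) []) (S y) (s(0 := enc y))" for y
        by (rule exec_drop) (use s m in \<open>auto simp: fun_eq_iff S_def\<close>)
      have loop: "exec ?b ?loop (S y) (S z) \<and> \<not> c z" if "loops c f (poly p (sz x)) y z" for y z
        using that
      proof (induction rule: loops.induct)
        case (stop y)
        then have "peek (S y (m + 2)) \<notin> {Some (Bit True)}"
          by (simp add: S_def)
        then show ?case
          using stop by (blast intro: exec.Loop_False)
      next
        case (step y z)
        have "exec ?b pf (s(0 := enc y)) (s(0 := enc (f y)))"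
          by (rule computes_exec[OF f, where x = y])
            (use s m poly_nat_mono[OF step.hyps(2), of bf] in \<open>auto simp: r_def poly_pcompose\<close>)
        moreover have "sz (f y) \<le> poly p (sz x)"
          using loops_size[OF step.hyps(3)] by simp
        ultimately have "exec ?b ?body (S y) (S (f y))"
          using drop test by (blast intro: exec.Seq)
        moreover have "peek (S y (m + 2)) \<in> {Some (Bit True)}"
          using step.hyps(1) by (simp add: S_def)
        ultimately show ?case
          using step.IH by (blast intro: exec.Loop_True)
      qed
      have "exec ?b pi s (s(0 := enc (init x)))"
        by (rule computes_exec[OF i]) (use s m in \<open>auto simp: r_def\<close>)
      then show ?thesis
        using test[of "init x"] loop[OF loops[of x]] drop[of "h x"] loops_size[OF loops[of x]]
        by (blast intro: exec.Seq)
    qed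
  qed
qed

subsection \<open>Rules that follow the syntax of a definition\<close>

text \<open>The rules have the form \<open>pspace (\<lambda>e. F (f e) (g e))\<close> with an environment
  \<open>e\<close> that contains the values of all variables, as nested pairs. An operator that binds a
  variable has a premise in which the environment is paired with the value of that variable.\<close>

named_theorems pspace_intros

lemmas [pspace_intros] = pspace_id pspace_const pspace_Pair pspace_If

lemmas pspace_fst [pspace_intros] = pspace_comp[OF _ pspace_fst']
lemmas pspace_snd [pspace_intros] = pspace_comp[OF _ pspace_snd']
lemmas pspace_push = pspace_comp[OF _ pspace_push']
lemmas pspace_pop = pspace_comp[OF _ pspace_pop']
lemmas pspace_peek = pspace_comp[OF _ pspace_peek']

lemma pspace_Raw_enc [pspace_intros]: "pspace f \<Longrightarrow> pspace (\<lambda>x. Raw (enc (f x)))"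
  by (simp add: pspace_def computes_def enc_raw_def)

text \<open>For results that are more easily assembled as bare words.\<close>

lemma pspace_Raw_encD: "pspace (\<lambda>x. Raw (enc (f x))) \<Longrightarrow> pspace f"
  by (simp add: pspace_def computes_def enc_raw_def)

lemma pspace_Not [pspace_intros]: "pspace c \<Longrightarrow> pspace (\<lambda>x. \<not> c x)"
proof -
  have *: "(\<lambda>x. \<not> c x) = (\<lambda>x. if c x then False else True)" by auto
  show "pspace c \<Longrightarrow> ?thesis" unfolding * by (intro pspace_intros)
qed

lemma pspace_conj [pspace_intros]: "pspace c \<Longrightarrow> pspace d \<Longrightarrow> pspace (\<lambda>x. c x \<and> d x)"
proof -
  have *: "(\<lambda>x. c x \<and> d x) = (\<lambda>x. if c x then d x else False)" by auto
  show "pspace c \<Longrightarrow> pspace d \<Longrightarrow> ?thesis" unfolding * by (intro pspace_intros)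
qed

lemma pspace_disj [pspace_intros]: "pspace c \<Longrightarrow> pspace d \<Longrightarrow> pspace (\<lambda>x. c x \<or> d x)"
proof -
  have *: "(\<lambda>x. c x \<or> d x) = (\<lambda>x. if c x then True else d x)" by auto
  show "pspace c \<Longrightarrow> pspace d \<Longrightarrow> ?thesis" unfolding * by (intro pspace_intros)
qed

lemma pspace_iff: "pspace c \<Longrightarrow> pspace d \<Longrightarrow> pspace (\<lambda>x. c x \<longleftrightarrow> d x)"
proof -
  have *: "(\<lambda>x. c x \<longleftrightarrow> d x) = (\<lambda>x. if c x then d x else \<not> d x)" by auto
  show "pspace c \<Longrightarrow> pspace d \<Longrightarrow> ?thesis" unfolding * by (intro pspace_intros)
qed

lemma pspace_Let [pspace_intros]:
  assumes "pspace f" "pspace (\<lambda>z. g (fst z) (snd z))"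
  shows "pspace (\<lambda>x. let y = f x in g x y)"
  using pspace_comp[OF pspace_Pair[OF pspace_id assms(1)] assms(2)] by simp

lemma finite_letters: obtains L :: "letter list" where "set L = UNIV"
  using finite_list[of "UNIV :: letter set"] by auto

lemma pspace_all_letters:
  assumes "\<And>l :: letter. pspace (P l)"
  shows "pspace (\<lambda>x. \<forall>l. P l x)"
proof -
  obtain L :: "letter list" where L: "set L = UNIV" by (rule finite_letters)
  have "pspace (\<lambda>x. \<forall>l\<in>set K. P l x)" for K
    by (induction K) (auto intro!: pspace_intros assms)
  from this[of L] show ?thesis by (simp add: L)
qed

lemma pspace_case_letter:
  assumes u: "pspace u" and F: "\<And>l. pspace (F l)" and d: "pspace d"
  shows "pspace (\<lambda>x. case peek (letters (u x)) of Some l \<Rightarrow> F l x | None \<Rightarrow> d x)"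
proof -
  obtain L :: "letter list" where L: "set L = UNIV" by (rule finite_letters)
  have "pspace (\<lambda>x. case peek (letters (u x)) of Some l \<Rightarrow> if l \<in> set K then F l x else d x
      | None \<Rightarrow> d x)" for K
  proof (induction K)
    case Nil
    have *: "(case peek (letters (u x)) of Some l \<Rightarrow> if l \<in> set [] then F l x else d x
      | None \<Rightarrow> d x) = d x" for x by (simp split: option.split)
    show ?case unfolding * by (rule d)
  next
    case (Cons k K)
    have *: "(case peek (letters (u x)) of Some l \<Rightarrow> if l \<in> set (k # K) then F l x else d x
        | None \<Rightarrow> d x) = (if peek (letters (u x)) \<in> {Some k} then F k x
        else (case peek (letters (u x)) of Some l \<Rightarrow> if l \<in> set K then F l x else d x
          | None \<Rightarrow> d x))" for x
      by (auto split: option.split)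
    show ?case unfolding * by (intro pspace_If pspace_peek u F Cons)
  qed
  from this[of L] show ?thesis by (simp add: L cong: option.case_cong)
qed

subsection \<open>Equality\<close>

text \<open>Words are compared by deleting equal letters in front until this is no longer possible.\<close>

fun strip :: "'a list \<Rightarrow> 'a list \<Rightarrow> 'a list \<times> 'a list" where
  "strip (a # u) (b # v) = (if a = b then strip u v else (a # u, b # v))"
| "strip u v = (u, v)"

lemma strip_eq_Nil: "strip u v = ([], []) \<longleftrightarrow> u = v"
  by (induction u v rule: strip.induct) auto

lemma raw_eq_iff: "r = r' \<longleftrightarrow> letters r = letters r'"
  by (auto intro: raw.expand)

lemma pspace_eq_raw: "pspace (\<lambda>z. fst z = (snd z :: raw))"
proof -
  let ?c = "\<lambda>z. (\<not> peek (letters (fst z)) \<in> {None}) \<and>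
    (\<forall>l. peek (letters (fst z)) \<in> {Some l} \<longleftrightarrow> peek (letters (snd z)) \<in> {Some l})"
  let ?f = "\<lambda>z. (Raw (tl (letters (fst z))), Raw (tl (letters (snd z))))"
  let ?h = "\<lambda>z. map_prod Raw Raw (strip (letters (fst z)) (letters (snd z)))"
  have "loops ?c ?f b (Raw u, Raw v) (map_prod Raw Raw (strip u v))"
    if "2 * length u + length v + 1 \<le> b" for u v b
    using that
  proof (induction u v rule: strip.induct)
    case (1 k u l v)
    show ?case
    proof (cases "k = l")
      case True
      then have "loops ?c ?f b (?f (Raw (k # u), Raw (l # v))) (map_prod Raw Raw (strip u v))"
        using 1 by simp
      then have "loops ?c ?f b (Raw (k # u), Raw (l # v)) (map_prod Raw Raw (strip u v))"
        by (rule loops.step[rotated 2]) (use True 1 in auto)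
      then show ?thesis
        using True by simp
    next
      case False
      then show ?thesis
        using 1 by (auto intro: loops.stop)
    qed
  next
    case "2_1"
    then show ?case by (auto intro: loops.stop)
  next
    case ("2_2" u)
    then show ?case by (cases u) (auto intro: loops.stop)
  qed
  then have *: "loops ?c ?f (poly [:0, 1:] (sz z)) z (?h z)" for z
    by (cases z; cases "fst z"; cases "snd z") auto
  have "pspace ?h"
    by (rule pspace_while[OF pspace_id _ _ *])
      (intro pspace_intros pspace_peek pspace_pop pspace_all_letters pspace_iff)+
  then have "pspace (\<lambda>z. peek (letters (fst (?h z))) \<in> {None} \<and> peek (letters (snd (?h z))) \<in> {None})"
    by (intro pspace_intros pspace_peek)
  moreover have "peek w \<in> {None} \<longleftrightarrow> w = []" for w :: "letter list"
    by (cases w) auto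
  moreover have "(fst (strip u v) = [] \<and> snd (strip u v) = []) \<longleftrightarrow> u = v" for u v :: "letter list"
    using strip_eq_Nil[of u v] by (simp add: prod_eq_iff)
  ultimately show ?thesis
    by (simp add: raw_eq_iff)
qed

lemma pspace_eq [pspace_intros]:
  assumes "pspace f" "pspace g"
  shows "pspace (\<lambda>x. f x = g x)"
proof -
  have "pspace (\<lambda>x. Raw (enc (f x)) = Raw (enc (g x)))"
    using pspace_comp[OF pspace_Pair[OF pspace_Raw_enc[OF assms(1)] pspace_Raw_enc[OF assms(2)]]
        pspace_eq_raw] by simp
  then show ?thesis by (simp add: enc_eq_iff)
qed

subsection \<open>Lists\<close>

text \<open>A nonempty list is written like the pair of its head and its tail, so that building it is a case
  of \<open>pspace_recode\<close>.\<close>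

instantiation list :: (enc) enc
begin

primrec enc_list :: "'a list \<Rightarrow> letter list" where
  "enc_list [] = []"
| "enc_list (x # xs) = escape (enc x) @ Bit False # enc_list xs"

instance
proof
  fix xs ys :: "'a list"
  assume "enc xs = enc ys"
  then show "xs = ys"
  proof (induction xs arbitrary: ys)
    case Nil
    then show ?case by (cases ys) auto
  next
    case (Cons x xs)
    then show ?case
      by (cases ys) (auto simp: enc_eq_iff dest!: escape_inject)
  qed
qed

end

lemma sz_list [simp]: "sz [] = 0" "sz (x # xs) = 2 * sz x + 1 + sz xs" for x :: "'a::enc"
  by simp_all

declare enc_list.simps [simp del]

lemma sz_append: "sz (xs @ ys) = sz xs + sz ys" for xs :: "'a::enc list"
  by (induction xs) auto

lemma sz_drop: "sz (drop i xs) \<le> sz xs" for xs :: "'a::enc list"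
  using sz_append[of "take i xs" "drop i xs"] by simp

lemma length_le_sz: "length xs \<le> sz xs" for xs :: "'a::enc list"
  by (induction xs) auto

lemma sz_member: "x \<in> set xs \<Longrightarrow> sz x \<le> sz xs" for xs :: "'a::enc list"
  by (induction xs) auto

lemma pspace_Cons [pspace_intros]:
  assumes "pspace f" "pspace g"
  shows "pspace (\<lambda>x. f x # g x)"
proof -
  have "pspace (\<lambda>z :: 'b \<times> 'b list. fst z # snd z)"
    by (rule pspace_recode) (simp add: enc_prod_def enc_list.simps)
  from pspace_comp[OF pspace_Pair[OF assms] this] show ?thesis by simp
qed

text \<open>The empty list is not the encoding of a pair, hence it is replaced by some pair first; \<open>d\<close> is
  the value that stands in for the head.\<close>

lemma pspace_uncons: "pspace (\<lambda>xs. if xs = [] then (d, []) else (hd xs, tl xs))"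
proof (rule pspace_Raw_encD)
  let ?f = "\<lambda>xs. if xs = [] then (d, []) else (hd xs, tl xs)"
  have "Raw (enc (?f xs)) = (if xs = [] then Raw (enc (d, [] :: 'a list)) else Raw (enc xs))" for xs
    by (cases xs) (auto simp: enc_prod_def enc_list.simps)
  moreover have "pspace (\<lambda>xs. if xs = [] then Raw (enc (d, [] :: 'a list)) else Raw (enc xs))"
    by (intro pspace_intros)
  ultimately show "pspace (\<lambda>xs. Raw (enc (?f xs)))" by simp
qed

lemma pspace_tl [pspace_intros]:
  assumes "pspace f"
  shows "pspace (\<lambda>x. tl (f x))"
proof -
  have "tl (f x) = snd (if f x = [] then (undefined, []) else (hd (f x), tl (f x)))" for x
    by simp
  then show ?thesis
    using pspace_snd[OF pspace_comp[OF assms pspace_uncons[of undefined]]] by simp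
qed

lemma pspace_hd [pspace_intros]:
  assumes "pspace f"
  shows "pspace (\<lambda>x. hd (f x))"
proof -
  have "hd (f x) = fst (if f x = [] then (hd [], []) else (hd (f x), tl (f x)))" for x
    by simp
  then show ?thesis
    using pspace_fst[OF pspace_comp[OF assms pspace_uncons[of "hd []"]]] by simp
qed

lemma loops_fold:
  assumes "\<And>i. i \<le> length xs \<Longrightarrow> sz (e, drop i xs, fold (f e) (take i xs) a) \<le> b"
  shows "loops (\<lambda>z. fst (snd z) \<noteq> [])
     (\<lambda>z. (fst z, tl (fst (snd z)), f (fst z) (hd (fst (snd z))) (snd (snd z))))
     b (e, xs, a) (e, [], fold (f e) xs a)"
  using assms
proof (induction xs arbitrary: a)
  case Nil
  then show ?case
    using Nil[of 0] by (simp add: loops.stop)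
next
  case (Cons x xs)
  have "loops (\<lambda>z. fst (snd z) \<noteq> [])
     (\<lambda>z. (fst z, tl (fst (snd z)), f (fst z) (hd (fst (snd z))) (snd (snd z))))
     b (e, xs, f e x a) (e, [], fold (f e) xs (f e x a))"
    using Cons.prems[of "Suc i" for i] by (intro Cons.IH) simp
  then show ?case
    using Cons.prems[of 0] by - (rule loops.step, simp_all)
qed

lemma pspace_fold:
  assumes xs: "pspace xs" and a: "pspace a"
    and f: "pspace (\<lambda>z. f (fst z) (fst (snd z)) (snd (snd z)))"
    and bound: "\<And>e i. i \<le> length (xs e) \<Longrightarrow> sz (fold (f e) (take i (xs e)) (a e)) \<le> poly p (sz e)"
  shows "pspace (\<lambda>e. fold (f e) (xs e) (a e))"
proof -
  obtain px :: "nat poly" where px: "\<And>e. sz (xs e) \<le> poly px (sz e)"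
    using pspace_size[OF xs] by blast
  let ?p = "[:2, 2:] + [:2:] * px + p"
  have "loops (\<lambda>z. fst (snd z) \<noteq> [])
     (\<lambda>z. (fst z, tl (fst (snd z)), f (fst z) (hd (fst (snd z))) (snd (snd z))))
     (poly ?p (sz e)) (e, xs e, a e) (e, [], fold (f e) (xs e) (a e))" for e
  proof (rule loops_fold)
    fix i assume "i \<le> length (xs e)"
    then show "sz (e, drop i (xs e), fold (f e) (take i (xs e)) (a e)) \<le> poly ?p (sz e)"
      using bound[of i e] px[of e] sz_drop[of i "xs e"] by simp
  qed
  then have "pspace (\<lambda>e. (e, [] :: 'b list, fold (f e) (xs e) (a e)))"
  proof (rule pspace_while[rotated 3])
    show "pspace (\<lambda>z. (fst z, tl (fst (snd z)), f (fst z) (hd (fst (snd z))) (snd (snd z))))"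
      using pspace_comp[OF _ f, of "\<lambda>z. (fst z, hd (fst (snd z)), snd (snd z))"]
      by (simp add: pspace_intros)
  qed (intro pspace_intros xs a)+
  from pspace_snd[OF pspace_snd[OF this]] show ?thesis by simp
qed

text \<open>If each step enlarges the accumulator by an amount that depends only on the environment and the current
  list element, then the accumulator stays of polynomial size, because a list has at most as many elements
  as the letters of its encoding.\<close>

lemma pspace_fold_growth:
  assumes xs: "pspace xs" and a: "pspace a"
    and f: "pspace (\<lambda>z. f (fst z) (fst (snd z)) (snd (snd z)))"
    and growth: "\<And>e x y. sz (f e x y) \<le> sz y + poly q (sz e + sz x)"
  shows "pspace (\<lambda>e. fold (f e) (xs e) (a e))"
proof -
  obtain px :: "nat poly" where px: "\<And>e. sz (xs e) \<le> poly px (sz e)"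
    using pspace_size[OF xs] by blast
  obtain pa :: "nat poly" where pa: "\<And>e. sz (a e) \<le> poly pa (sz e)"
    using pspace_size[OF a] by blast
  have *: "sz (fold (f e) ys y) \<le> sz y + length ys * poly q (sz e + sz zs)"
    if "set ys \<subseteq> set zs" for e y ys zs
    using that
  proof (induction ys arbitrary: y)
    case (Cons x ys)
    have "poly q (sz e + sz x) \<le> poly q (sz e + sz zs)"
      using Cons.prems sz_member[of x zs] by (intro poly_nat_mono) auto
    then show ?case
      using Cons growth[of e x y] by (fastforce intro: order_trans)
  qed simp
  let ?p = "pa + px * pcompose q ([:0, 1:] + px)"
  show ?thesis
  proof (rule pspace_fold[OF xs a f])
    fix e i
    have "sz (fold (f e) (take i (xs e)) (a e))
        \<le> sz (a e) + length (take i (xs e)) * poly q (sz e + sz (xs e))"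
      by (rule *) (rule set_take_subset)
    also have "\<dots> \<le> poly pa (sz e) + poly px (sz e) * poly q (sz e + poly px (sz e))"
      using pa[of e] px[of e] length_le_sz[of "xs e"]
      by (intro add_mono mult_mono poly_nat_mono) auto
    finally show "sz (fold (f e) (take i (xs e)) (a e)) \<le> poly ?p (sz e)"
      by (simp add: poly_pcompose)
  qed
qed

lemma pspace_rev [pspace_intros]:
  assumes "pspace xs"
  shows "pspace (\<lambda>e. rev (xs e))"
proof -
  have *: "rev ys = fold (\<lambda>x acc. x # acc) ys []" for ys :: "'b list"
    by (simp add: fold_Cons_rev)
  show ?thesis
    unfolding * by (rule pspace_fold_growth[where q = "[:1, 2:]"]) (intro pspace_intros assms | simp)+
qed

lemma pspace_append [pspace_intros]:
  assumes "pspace xs" "pspace ys"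
  shows "pspace (\<lambda>e. xs e @ ys e)"
proof -
  have *: "us @ vs = fold (\<lambda>x acc. x # acc) (rev us) vs" for us vs :: "'b list"
    by (simp add: fold_Cons_rev)
  show ?thesis
    unfolding * by (rule pspace_fold_growth[where q = "[:1, 2:]"]) (intro pspace_intros assms | simp)+
qed

subsection \<open>Words\<close>

lemma pspace_push_letter [pspace_intros]:
  assumes "pspace l" "pspace r"
  shows "pspace (\<lambda>x. Raw (l x # letters (r x)))"
proof -
  have *: "Raw (l x # letters (r x)) = (case peek (letters (Raw (enc (l x)))) of
      Some k \<Rightarrow> Raw (k # letters (r x)) | None \<Rightarrow> r x)" for x
    by (simp add: enc_letter_def)
  show ?thesis
    unfolding * by (intro pspace_case_letter pspace_intros pspace_push assms)
qed

text \<open>Decomposes a word into its list of letters. The result appears in reversed order because letters are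
  popped from one stack and pushed onto another.\<close>

lemma pspace_letters_rev:
  "pspace (\<lambda>r. rev (letters r))"
proof -
  let ?c = "\<lambda>z :: raw \<times> letter list. \<not> peek (letters (fst z)) \<in> {None}"
  let ?hd = "\<lambda>z. case peek (letters (fst z)) of Some l \<Rightarrow> l | None \<Rightarrow> Minus"
  let ?f = "\<lambda>z. (Raw (tl (letters (fst z))), ?hd z # snd z)"
  have *: "loops ?c ?f b (Raw w, v) (Raw [], rev w @ v)" if "3 * length w + sz v + 1 \<le> b" for b w v
    using that
  proof (induction w arbitrary: v)
    case Nil
    then show ?case by (auto intro: loops.stop)
  next
    case (Cons l w)
    have "loops ?c ?f b (?f (Raw (l # w), v)) (Raw [], rev w @ l # v)"
      using Cons.IH[of "l # v"] Cons.prems by simp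
    then have "loops ?c ?f b (Raw (l # w), v) (Raw [], rev w @ l # v)"
      by (rule loops.step[rotated 2]) (use Cons.prems in auto)
    then show ?case by simp
  qed
  have "pspace (\<lambda>r. (Raw [], rev (letters r)))"
  proof (rule pspace_while)
    show "pspace (\<lambda>r :: raw. (r, [] :: letter list))"
      by (intro pspace_intros)
    show "pspace ?c"
      by (intro pspace_intros pspace_peek)
    show "pspace ?f"
      by (intro pspace_intros pspace_peek pspace_pop pspace_case_letter)
    show "loops ?c ?f (poly [:1, 3:] (sz r)) (r, []) (Raw [], rev (letters r))" for r
      using *[of "letters r" "[]"] by (simp add: enc_raw_def)
  qed
  from pspace_snd[OF this] show ?thesis by simp
qed

lemma pspace_letters [pspace_intros]: "pspace r \<Longrightarrow> pspace (\<lambda>x. letters (r x))"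
  using pspace_rev[OF pspace_letters_rev] by (auto dest: pspace_comp)

lemma pspace_raw_append [pspace_intros]:
  assumes "pspace u" "pspace v"
  shows "pspace (\<lambda>x. Raw (letters (u x) @ letters (v x)))"
proof -
  have "fold (\<lambda>l r. Raw (l # letters r)) w r = Raw (rev w @ letters r)" for w r
    by (induction w arbitrary: r) auto
  then have *: "Raw (letters (u x) @ letters (v x))
      = fold (\<lambda>l r. Raw (l # letters r)) (rev (letters (u x))) (v x)" for x
    by simp
  show ?thesis
    unfolding * by (rule pspace_fold_growth[where q = "[:1:]"])
      (intro pspace_intros assms | simp add: enc_raw_def)+
qed

subsection \<open>Natural numbers\<close>

lemma rev_binary: "rev (binary n) =
    (if n < 2 then [Bit (n = 1)] else Bit (odd n) # rev (binary (n div 2)))"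
  by (subst binary.simps) simp

text \<open>Numbers will be written with the least significant bit first. This order suits the increment, and it is
  the one in which a numeral is pushed onto a stack that stands reversed on its tape. Reading the numeral
  back shows that the encoding is injective.\<close>

primrec word_value :: "letter list \<Rightarrow> nat" where
  "word_value [] = 0"
| "word_value (l # w) = of_bool (l = Bit True) + 2 * word_value w"

lemma word_value_binary: "word_value (rev (binary n)) = n"
proof (induction n rule: less_induct)
  case (less n)
  show ?case
  proof (cases "n < 2")
    case True
    then show ?thesis by (cases n) (auto simp: rev_binary)
  next
    case False
    then show ?thesis
      using less[of "n div 2"] by (subst rev_binary) simp
  qed
qed

instantiation nat :: enc
begin

definition "enc n = rev (binary n)"

instance
  by standard (metis enc_nat_def word_value_binary)

end

lemma sz_nat_le_iff: "0 < k \<Longrightarrow> sz (n :: nat) \<le> k \<longleftrightarrow> n < 2 ^ k"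
proof (induction k arbitrary: n)
  case (Suc k)
  have length: "sz n = (if n < 2 then 1 else Suc (sz (n div 2)))"
    unfolding enc_nat_def by (subst rev_binary) simp
  show ?case
  proof (cases "n < 2")
    case True
    then have "n < 2 * 2 ^ k"
      using one_le_power[of "2 :: nat" k] by linarith
    then show ?thesis using True length by simp
  next
    case False
    then have "0 < sz (n div 2)" by (simp add: enc_nat_def rev_binary)
    then show ?thesis
      using False Suc.IH[of "n div 2"] length by (cases k) auto
  qed
qed simp

lemma sz_nat_pos: "0 < sz (n :: nat)"
  by (simp add: enc_nat_def rev_binary)

lemma less_power_sz: "(n :: nat) < 2 ^ sz n"
  using sz_nat_le_iff[OF sz_nat_pos[of n], of n] by simp

lemma sz_nat_mono: "m \<le> n \<Longrightarrow> sz (m :: nat) \<le> sz n"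
  using sz_nat_le_iff[OF sz_nat_pos[of n], of m] less_power_sz[of n] by simp

lemma sz_add: "sz (m + n :: nat) \<le> sz m + sz n"
proof -
  have "m + n < 2 ^ sz m * 2 ^ sz n"
  proof -
    have "(2 :: nat) \<le> 2 ^ sz m" "(2 :: nat) \<le> 2 ^ sz n"
      using sz_nat_pos[of m] sz_nat_pos[of n] by (simp_all add: self_le_power)
    then have "2 ^ sz m + 2 ^ sz n \<le> (2 :: nat) ^ sz m * 2 ^ sz n"
      using mult_le_mono[of 2 "2 ^ sz m" "2 ^ sz n" "2 ^ sz n"]
        mult_le_mono[of "2 ^ sz m" "2 ^ sz m" 2 "2 ^ sz n"] by linarith
    then show ?thesis using less_power_sz[of m] less_power_sz[of n] by linarith
  qed
  then show ?thesis
    using sz_nat_pos[of m] by (simp add: sz_nat_le_iff power_add)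
qed

lemma sz_mult: "sz (m * n :: nat) \<le> sz m + sz n"
proof -
  have "m * n < 2 ^ sz m * 2 ^ sz n"
    by (intro mult_strict_mono less_power_sz) auto
  then show ?thesis
    using sz_nat_pos[of m] by (simp add: sz_nat_le_iff power_add)
qed

lemma sz_nat_le: "sz (n :: nat) \<le> n + 1"
  using less_exp[of "n + 1"] less_trans[of n "n + 1"] by (subst sz_nat_le_iff) linarith+

lemma sz_0 [simp]: "sz (0 :: nat) = 1" and sz_1 [simp]: "sz (Suc 0) = 1"
  by (simp_all add: enc_nat_def rev_binary)

lemma sz_Suc: "sz (Suc n) \<le> Suc (sz n)"
  using sz_add[of n 1] by simp

fun increment :: "letter list \<Rightarrow> letter list" where
  "increment [] = [Bit True]"
| "increment (l # w) = (if l = Bit True then Bit False # increment w else Bit True # w)"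

lemma enc_nat_small: "enc (0 :: nat) = [Bit False]" "enc (1 :: nat) = [Bit True]"
  by (simp_all add: enc_nat_def rev_binary)

lemma enc_nat_large: "2 \<le> n \<Longrightarrow> enc (n :: nat) = Bit (odd n) # enc (n div 2)"
  by (simp add: enc_nat_def rev_binary[of n])

lemma increment_enc: "increment (enc n) = enc (Suc n)"
proof (induction n rule: less_induct)
  case (less n)
  consider "n = 0" | "n = 1" | "2 \<le> n" by linarith
  then show ?case
  proof cases
    case 3
    show ?thesis
    proof (cases "odd n")
      case True
      then have "Suc n div 2 = Suc (n div 2)" by simp
      then show ?thesis
        using 3 True less[of "n div 2"] by (simp add: enc_nat_large[of n] enc_nat_large[of "Suc n"])
    next
      case False
      then have "Suc n div 2 = n div 2" by simp
      then show ?thesis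
        using 3 False by (simp add: enc_nat_large[of n] enc_nat_large[of "Suc n"])
    qed
  qed (use enc_nat_large[of 2] in \<open>auto simp: enc_nat_small simp flip: One_nat_def numeral_2_eq_2\<close>)
qed

lemma pspace_Suc [pspace_intros]:
  assumes "pspace f"
  shows "pspace (\<lambda>x. Suc (f x))"
proof -
  let ?f = "\<lambda>_ :: raw. \<lambda>l z. if fst z then
      (if l = Bit True then (True, Raw (Bit False # letters (snd z)))
        else (False, Raw (Bit True # letters (snd z))))
      else (False, Raw (l # letters (snd z)))"
  have no_carry: "fold (?f r) w (False, Raw v) = (False, Raw (rev w @ v))" for r w v
    by (induction w arbitrary: v) auto
  define finish where
    "finish = (\<lambda>z. rev (letters (if fst z then Raw (Bit True # letters (snd z)) else snd z)))"
  have finish: "finish (True, Raw v) = rev v @ [Bit True]" "finish (False, Raw v) = rev v" for v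
    by (simp_all add: finish_def)
  have carry: "finish (fold (?f r) w (True, Raw v)) = rev v @ increment w" for r w v
    by (induction w arbitrary: v) (simp_all add: no_carry finish)
  have "pspace (\<lambda>r. fold (?f r) (letters r) (True, Raw []))"
    by (rule pspace_fold_growth[where q = "[:1:]"])
      (intro pspace_intros | auto simp: enc_raw_def)+
  then have "pspace (\<lambda>r. finish (fold (?f r) (letters r) (True, Raw [])))"
    unfolding finish_def by (intro pspace_intros)
  then have "pspace (\<lambda>r. increment (letters r))"
    by (simp add: carry)
  then have "pspace (\<lambda>x. increment (letters (Raw (enc (f x)))))"
    by (rule pspace_comp[rotated]) (intro pspace_intros assms)
  then have "pspace (\<lambda>x. increment (enc (f x)))" by simp
  then have "pspace (\<lambda>x. fold (\<lambda>l r. Raw (l # letters r)) (rev (increment (enc (f x)))) (Raw []))"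
    by (intro pspace_fold_growth[where q = "[:1:]"])
      (intro pspace_intros | simp add: enc_raw_def)+
  moreover have "fold (\<lambda>l r. Raw (l # letters r)) w r = Raw (rev w @ letters r)" for w r
    by (induction w arbitrary: r) auto
  ultimately have "pspace (\<lambda>x. Raw (enc (Suc (f x))))"
    by (simp add: increment_enc)
  then show ?thesis by (rule pspace_Raw_encD)
qed

lemma loops_rec_nat:
  assumes "\<And>i. i \<le> n e \<Longrightarrow> sz (e, i, rec_nat a (f e) i) \<le> b" "j \<le> n e"
  shows "loops (\<lambda>z. fst (snd z) \<noteq> n (fst z))
     (\<lambda>z. (fst z, Suc (fst (snd z)), f (fst z) (fst (snd z)) (snd (snd z))))
     b (e, j, rec_nat a (f e) j) (e, n e, rec_nat a (f e) (n e))"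
  using assms(2)
proof (induction j rule: inc_induct)
  case base
  then show ?case using assms(1) by (intro loops.stop) auto
next
  case (step j)
  have "loops (\<lambda>z. fst (snd z) \<noteq> n (fst z))
     (\<lambda>z. (fst z, Suc (fst (snd z)), f (fst z) (fst (snd z)) (snd (snd z))))
     b (e, Suc j, f e j (rec_nat a (f e) j)) (e, n e, rec_nat a (f e) (n e))"
    using step.IH by simp
  then show ?case
    using step.hyps assms(1)[of j] by - (rule loops.step, simp_all)
qed

text \<open>Counting up to \<open>n\<close> may take exponentially many rounds, measured in the length of the numeral
  of \<open>n\<close>. This is where polynomial space is more comfortable than polynomial time: arithmetic
  and quantifiers that are bounded by a number can be programmed in the most naive way.\<close>

lemma pspace_rec_nat:
  assumes n: "pspace n" and a: "pspace a"
    and f: "pspace (\<lambda>z. f (fst z) (fst (snd z)) (snd (snd z)))"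
    and bound: "\<And>e i. i \<le> n e \<Longrightarrow> sz (rec_nat (a e) (f e) i) \<le> poly p (sz e)"
  shows "pspace (\<lambda>e. rec_nat (a e) (f e) (n e))"
proof -
  obtain pn :: "nat poly" where pn: "\<And>e. sz (n e) \<le> poly pn (sz e)"
    using pspace_size[OF n] by blast
  let ?p = "[:2, 2:] + [:2:] * pn + p"
  have "loops (\<lambda>z. fst (snd z) \<noteq> n (fst z))
     (\<lambda>z. (fst z, Suc (fst (snd z)), f (fst z) (fst (snd z)) (snd (snd z))))
     (poly ?p (sz e)) (e, 0, a e) (e, n e, rec_nat (a e) (f e) (n e))" for e
  proof -
    have "sz (e, i, rec_nat (a e) (f e) i) \<le> poly ?p (sz e)" if "i \<le> n e" for i
      using bound[OF that] pn[of e] sz_nat_mono[OF that] by simp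
    from loops_rec_nat[where j = 0 and n = n and e = e and f = f, OF this] show ?thesis by simp
  qed
  then have "pspace (\<lambda>e. (e, n e, rec_nat (a e) (f e) (n e)))"
  proof (rule pspace_while[rotated 3])
    show "pspace (\<lambda>z. (fst z, Suc (fst (snd z)), f (fst z) (fst (snd z)) (snd (snd z))))"
      by (intro pspace_intros f)
    show "pspace (\<lambda>z :: 'a \<times> nat \<times> 'b. fst (snd z) \<noteq> n (fst z))"
      by (intro pspace_intros pspace_comp[OF _ n])
  qed (intro pspace_intros a)+
  from pspace_snd[OF pspace_snd[OF this]] show ?thesis by simp
qed

lemma pspace_bex [pspace_intros]:
  fixes n :: "'a::enc \<Rightarrow> nat"
  assumes "pspace n" "pspace (\<lambda>z. P (fst z) (snd z))"
  shows "pspace (\<lambda>e. \<exists>i<n e. P e i)"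
proof -
  have *: "(\<exists>i<m. Q i) = rec_nat False (\<lambda>i y. y \<or> Q i) m" for Q and m :: nat
    by (induction m) (auto simp: less_Suc_eq)
  have "pspace (\<lambda>z :: 'a \<times> nat \<times> bool. P (fst z) (fst (snd z)))"
    using pspace_comp[OF _ assms(2), of "\<lambda>z :: 'a \<times> nat \<times> bool. (fst z, fst (snd z))"]
    by (simp add: pspace_intros)
  then show ?thesis
    unfolding * by (intro pspace_rec_nat[where p = "[:1:]"] pspace_intros assms(1)) auto
qed

lemma pspace_ball [pspace_intros]:
  fixes n :: "'a::enc \<Rightarrow> nat"
  assumes "pspace n" "pspace (\<lambda>z. P (fst z) (snd z))"
  shows "pspace (\<lambda>e. \<forall>i<n e. P e i)"
proof -
  have *: "(\<forall>i<m. Q i) \<longleftrightarrow> \<not> (\<exists>i<m. \<not> Q i)" for Q and m :: nat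
    by blast
  show ?thesis unfolding * by (intro pspace_intros assms)
qed

lemma pspace_less [pspace_intros]:
  assumes "pspace f" "pspace g"
  shows "pspace (\<lambda>x. f x < (g x :: nat))"
proof -
  have *: "m < n \<longleftrightarrow> (\<exists>i<n. i = m)" for m n :: nat by auto
  show ?thesis
    unfolding *[of "f _"] by (intro pspace_intros pspace_comp[OF _ assms(1)] assms(2))
qed

lemma pspace_add [pspace_intros]:
  assumes "pspace f" "pspace g"
  shows "pspace (\<lambda>x. f x + g x :: nat)"
proof -
  obtain p q :: "nat poly" where p: "\<And>e. sz (f e) \<le> poly p (sz e)" "\<And>e. sz (g e) \<le> poly q (sz e)"
    using pspace_size[OF assms(1)] pspace_size[OF assms(2)] by blast
  have *: "m + n = rec_nat m (\<lambda>_. Suc) n" for m n :: nat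
    by (induction n) auto
  show ?thesis
    unfolding *
  proof (rule pspace_rec_nat[where p = "p + q"])
    fix e i assume "i \<le> g e"
    then show "sz (rec_nat (f e) (\<lambda>_. Suc) i) \<le> poly (p + q) (sz e)"
      using p(1)[of e] p(2)[of e] sz_add[of "f e" i] sz_nat_mono[of i "g e"] by (simp flip: *)
  qed (intro pspace_intros assms)+
qed

lemma pspace_mult [pspace_intros]:
  assumes "pspace f" "pspace g"
  shows "pspace (\<lambda>x. f x * g x :: nat)"
proof -
  obtain p q :: "nat poly" where p: "\<And>e. sz (f e) \<le> poly p (sz e)" "\<And>e. sz (g e) \<le> poly q (sz e)"
    using pspace_size[OF assms(1)] pspace_size[OF assms(2)] by blast
  have *: "m * n = rec_nat 0 (\<lambda>_ y. y + m) n" for m n :: nat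
    by (induction n) auto
  show ?thesis
    unfolding *
  proof (rule pspace_rec_nat[where p = "p + q"])
    fix e i assume "i \<le> g e"
    then show "sz (rec_nat 0 (\<lambda>_ y. y + f e) i) \<le> poly (p + q) (sz e)"
      using p(1)[of e] p(2)[of e] sz_mult[of "f e" i] sz_nat_mono[of i "g e"] by (simp flip: *)
  next
    show "pspace (\<lambda>z :: 'a \<times> nat \<times> nat. snd (snd z) + f (fst z))"
      by (intro pspace_intros pspace_comp[OF _ assms(1)])
  qed (intro pspace_intros assms)+
qed

lemma pspace_dvd [pspace_intros]:
  assumes "pspace f" "pspace g"
  shows "pspace (\<lambda>x. f x dvd (g x :: nat))"
proof -
  have *: "a dvd b \<longleftrightarrow> (\<exists>k<Suc b. a * k = b)" for a b :: nat
  proof (cases "a = 0")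
    case False
    have "k < Suc (a * k)" for k using False by (cases a) auto
    then show ?thesis by (metis dvd_def)
  qed auto
  show ?thesis
    unfolding * by (intro pspace_intros pspace_comp[OF _ assms(1)] pspace_comp[OF _ assms(2)] assms(2))
qed

lemma pspace_length [pspace_intros]:
  assumes "pspace xs"
  shows "pspace (\<lambda>e. length (xs e))"
proof -
  have "fold (\<lambda>_. Suc) ys n = length ys + n" for ys :: "'b list" and n
    by (induction ys arbitrary: n) auto
  then have *: "length ys = fold (\<lambda>_. Suc) ys 0" for ys :: "'b list" by simp
  show ?thesis
    unfolding * by (rule pspace_fold_growth[where q = "[:1:]"])
      (intro pspace_intros assms | simp add: sz_Suc)+
qed

lemma pspace_drop [pspace_intros]:
  assumes "pspace n" "pspace xs"
  shows "pspace (\<lambda>e. drop (n e) (xs e))"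
proof -
  obtain p :: "nat poly" where p: "\<And>e. sz (xs e) \<le> poly p (sz e)"
    using pspace_size[OF assms(2)] by blast
  have *: "drop i ys = rec_nat ys (\<lambda>_. tl) i" for i and ys :: "'b list"
  proof (induction i)
    case (Suc i)
    have "drop (Suc i) ys = tl (drop i ys)" by (simp add: drop_Suc tl_drop)
    then show ?case using Suc by simp
  qed simp
  show ?thesis
    unfolding *
  proof (rule pspace_rec_nat[where p = p])
    show "sz (rec_nat (xs e) (\<lambda>_. tl) i) \<le> poly p (sz e)" for e i
      using p[of e] sz_drop[of i "xs e"] by (simp flip: *)
  qed (intro pspace_intros assms)+
qed

text \<open>Here the number of factors itself, and not only its length, must be polynomial, since the length of a
  product may be as large as the sum of the lengths of its factors.\<close>

lemma pspace_prod [pspace_intros]: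
  assumes n: "pspace n" and f: "pspace (\<lambda>z. f (fst z) (snd z))"
    and small: "\<And>e. n e \<le> poly p (sz e)"
  shows "pspace (\<lambda>e. \<Prod>i<n e. f e i :: nat)"
proof -
  obtain q :: "nat poly" where q: "\<And>e i. sz (f e i) \<le> poly q (2 * sz e + sz i + 1)"
    using pspace_size[OF f] by fastforce
  have *: "(\<Prod>i<m. g i) = rec_nat 1 (\<lambda>i y. y * g i) m" for m and g :: "nat \<Rightarrow> nat"
    by (induction m) auto
  let ?p = "[:1:] + p * pcompose q ([:2, 2:] + p)"
  show ?thesis
    unfolding *
  proof (rule pspace_rec_nat[where p = ?p])
    fix e i assume i: "i \<le> n e"
    have "sz (\<Prod>i<j. f e i) \<le> 1 + j * poly q (2 * sz e + n e + 2)" if "j \<le> n e" for j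
      using that
    proof (induction j)
      case (Suc j)
      have "sz j \<le> n e + 1" using Suc.prems sz_nat_le[of j] by simp
      then have "poly q (2 * sz e + sz j + 1) \<le> poly q (2 * sz e + n e + 2)"
        by (intro poly_nat_mono) simp
      then show ?case
        using Suc q[of e j] sz_mult[of "\<Prod>i<j. f e i" "f e j"] by (simp add: mult.commute)
    qed simp
    from this[OF i] have "sz (\<Prod>i<i. f e i) \<le> 1 + i * poly q (2 * sz e + n e + 2)" .
    also have "\<dots> \<le> 1 + poly p (sz e) * poly q (2 * sz e + poly p (sz e) + 2)"
      using i small[of e] by (intro add_mono mult_mono poly_nat_mono) auto
    also have "\<dots> = poly ?p (sz e)" by (simp add: poly_pcompose mult_2 mult_2_right ac_simps)
    finally show "sz (rec_nat 1 (\<lambda>i y. y * f e i) i) \<le> poly ?p (sz e)" unfolding * .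
  next
    show "pspace (\<lambda>z :: 'a \<times> nat \<times> nat. snd (snd z) * f (fst z) (fst (snd z)))"
      using pspace_comp[OF _ f, of "\<lambda>z :: 'a \<times> nat \<times> nat. (fst z, fst (snd z))"]
      by (simp add: pspace_intros)
  qed (intro pspace_intros n)+
qed

section \<open>Simple paths and simple cycles\<close>

lemma length_edges: "length (edges p) = length p - 1"
  by (simp add: edges_def)

lemma nth_edges: "Suc i < length p \<Longrightarrow> edges p ! i = (p ! i, p ! Suc i)"
  by (simp add: edges_def nth_tl)

lemma edges_take_drop: "edges (take (Suc n) (drop i p)) = take n (drop i (edges p))"
proof (rule nth_equalityI)
  show "length (edges (take (Suc n) (drop i p))) = length (take n (drop i (edges p)))"
    by (auto simp: length_edges min_def)
  fix k assume "k < length (edges (take (Suc n) (drop i p)))"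
  then have "k < n" "Suc (i + k) < length p"
    by (auto simp: length_edges min_def split: if_splits)
  then show "edges (take (Suc n) (drop i p)) ! k = take n (drop i (edges p)) ! k"
    by (simp add: nth_edges length_edges)
qed

lemma set_edges_take_drop: "set (edges (take (Suc n) (drop i p))) \<subseteq> set (edges p)"
  unfolding edges_take_drop by (meson order_trans set_drop_subset set_take_subset)

text \<open>A vertex that occurs twice on a path cuts out a cycle, whose edges form a contiguous part of the edges of
  the path.\<close>

lemma cycle_between:
  assumes "is_path A p" "i < j" "j < length p" "p ! i = p ! j"
  shows "is_cycle A (take (Suc (j - i)) (drop i p))"
proof -
  let ?z = "take (Suc (j - i)) (drop i p)"
  have len: "length ?z = Suc (j - i)" using assms by simp
  then have "?z \<noteq> []" by (metis length_0_conv nat.distinct(1))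
  moreover have "set ?z \<subseteq> set p"
    by (meson order_trans set_drop_subset set_take_subset)
  moreover have "hd ?z = p ! i" using assms \<open>?z \<noteq> []\<close> by (simp add: hd_conv_nth)
  moreover have "last ?z = p ! j" using assms len \<open>?z \<noteq> []\<close> by (simp add: last_conv_nth)
  moreover have "edges ?z \<noteq> []"
    using len assms(2) by (metis diff_Suc_1 length_edges length_0_conv zero_less_diff not_less_zero)
  ultimately show ?thesis
    using assms(1,4) set_edges_take_drop[of "j - i" i p]
    unfolding is_cycle_def is_path_def by auto
qed

lemma subseq_take_drop: "subseq (take n (drop i xs)) xs"
  by (meson sublist_drop sublist_imp_subseq sublist_order.order.trans sublist_take)

lemma subseq_positions:
  assumes "subseq xs ys"
  obtains g where "strict_mono_on {..<length xs} g"
    "\<And>i. i < length xs \<Longrightarrow> g i < length ys \<and> xs ! i = ys ! g i"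
proof -
  have "\<exists>g. strict_mono_on {..<length xs} g \<and> (\<forall>i<length xs. g i < length ys \<and> xs ! i = ys ! g i)"
    using assms
  proof (induction rule: list_emb.induct)
    case (list_emb_Nil ys)
    then show ?case by (auto simp: strict_mono_on_def)
  next
    case (list_emb_Cons xs ys y)
    then obtain g where g: "strict_mono_on {..<length xs} g"
      "\<forall>i<length xs. g i < length ys \<and> xs ! i = ys ! g i" by blast
    then show ?case
      by (intro exI[of _ "\<lambda>i. Suc (g i)"]) (auto simp: strict_mono_on_def)
  next
    case (list_emb_Cons2 x y xs ys)
    then obtain g where g: "strict_mono_on {..<length xs} g"
      "\<forall>i<length xs. g i < length ys \<and> xs ! i = ys ! g i" by blast
    then show ?case
      using list_emb_Cons2(1)
      by (intro exI[of _ "case_nat 0 (\<lambda>i. Suc (g i))"])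
        (auto simp: strict_mono_on_def nth_Cons less_Suc_eq_0_disj split: nat.splits)
  qed
  then show ?thesis using that by blast
qed

text \<open>The edges of a cycle that occur as a subsequence of \<open>edges p\<close> sit at positions \<open>g 0 <
  \<dots> < g m\<close>. That they are composable means that the vertex after each position occurs again at
  the next one, and that they close up means that the vertex after the last position is the vertex at the
  first one. Both facts limit \<open>g\<close> strongly if the vertices are distinct.\<close>

lemma cycle_in_path:
  assumes z: "is_cycle A z" and sub: "subseq (edges z) (edges p)"
  obtains g m where "edges z \<noteq> []" "m = length (edges z) - 1" "strict_mono_on {..m} g"
    "\<And>i. i \<le> m \<Longrightarrow> Suc (g i) < length p \<and> edges z ! i = edges p ! g i"
    "\<And>i. i < m \<Longrightarrow> p ! Suc (g i) = p ! g (Suc i)"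
    "p ! Suc (g m) = p ! g 0"
proof -
  obtain g where g: "strict_mono_on {..<length (edges z)} g"
    "\<And>i. i < length (edges z) \<Longrightarrow> g i < length (edges p) \<and> edges z ! i = edges p ! g i"
    using subseq_positions[OF sub] by blast
  define m where "m = length (edges z) - 1"
  have ne: "edges z \<noteq> []" using z by (simp add: is_cycle_def)
  then have m: "length (edges z) = Suc m" by (simp add: m_def)
  have z_ne: "z \<noteq> []" and len_z: "length z = Suc (Suc m)"
    using m by (auto simp: length_edges)
  have pos: "Suc (g i) < length p \<and> edges z ! i = edges p ! g i" if "i \<le> m" for i
    using g(2)[of i] that m length_edges[of p] by auto
  have vertices: "z ! i = p ! g i \<and> z ! Suc i = p ! Suc (g i)" if "i \<le> m" for i
    using pos[OF that] nth_edges[of i z] nth_edges[of "g i" p] that len_z by auto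
  have "z ! 0 = z ! Suc m"
    using z z_ne len_z by (simp add: is_cycle_def hd_conv_nth last_conv_nth)
  show ?thesis
  proof (rule that[of m g])
    show "strict_mono_on {..m} g" using g(1) m by (simp add: lessThan_Suc_atMost)
    show "p ! Suc (g i) = p ! g (Suc i)" if "i < m" for i
      using vertices[of i] vertices[of "Suc i"] that by simp
    show "p ! Suc (g m) = p ! g 0"
      using vertices[of 0] vertices[of m] \<open>z ! 0 = z ! Suc m\<close> by simp
  qed (use ne pos m_def in auto)
qed

text \<open>If the vertices are distinct, the vertex after position \<open>g m\<close> cannot equal the one at
  \<open>g 0 \<le> g m\<close>.\<close>

lemma is_simple_path_iff: "is_simple_path A p \<longleftrightarrow> is_path A p \<and> distinct p"
proof (intro iffI conjI)
  assume p: "is_simple_path A p"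
  then show path: "is_path A p" by (simp add: is_simple_path_def)
  show "distinct p"
  proof (rule ccontr)
    assume "\<not> distinct p"
    then obtain i j where "i < j" "j < length p" "p ! i = p ! j"
      unfolding distinct_conv_nth by (metis linorder_neqE_nat)
    then have "is_cycle A (take (Suc (j - i)) (drop i p))"
      using cycle_between[OF path] by blast
    moreover have "subseq (edges (take (Suc (j - i)) (drop i p))) (edges p)"
      by (simp only: edges_take_drop subseq_take_drop)
    ultimately show False
      using p unfolding is_simple_path_def by blast
  qed
next
  assume p: "is_path A p \<and> distinct p"
  show "is_simple_path A p"
    unfolding is_simple_path_def
  proof (intro conjI notI)
    assume "\<exists>z. is_cycle A z \<and> subseq (edges z) (edges p)"
    then obtain z where z: "is_cycle A z" "subseq (edges z) (edges p)" by blast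
    obtain g m where "edges z \<noteq> []" "m = length (edges z) - 1" and g: "strict_mono_on {..m} g"
        "\<And>i. i \<le> m \<Longrightarrow> Suc (g i) < length p \<and> edges z ! i = edges p ! g i"
        "\<And>i. i < m \<Longrightarrow> p ! Suc (g i) = p ! g (Suc i)"
        "p ! Suc (g m) = p ! g 0"
      by (rule cycle_in_path[OF z], rule that)
    have "g 0 \<le> g m" using g(1) by (cases m) (auto simp: strict_mono_on_def less_imp_le)
    then show False
      using g(2)[of 0] g(2)[of m] g(4) p by (simp add: nth_eq_iff_index_eq)
  qed (use p in simp)
qed

text \<open>In a cycle whose vertices are distinct except for the base point, a smaller cycle would have to start at
  the base point, go on without gaps and end at the base point, hence be everything.\<close>

lemma is_simple_cycle_iff: "is_simple_cycle A c \<longleftrightarrow> is_cycle A c \<and> distinct (tl c)"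
proof (intro iffI conjI)
  assume c: "is_simple_cycle A c"
  then show cycle: "is_cycle A c" by (simp add: is_simple_cycle_def)
  then have path: "is_path A c" by (simp add: is_cycle_def)
  show "distinct (tl c)"
  proof (rule ccontr)
    assume "\<not> distinct (tl c)"
    then obtain i j where ij: "i < j" "j < length (tl c)" "tl c ! i = tl c ! j"
      unfolding distinct_conv_nth by (metis linorder_neqE_nat)
    then have ij': "Suc i < Suc j" "Suc j < length c" "c ! Suc i = c ! Suc j"
      by (auto simp: nth_tl)
    let ?z = "take (Suc (Suc j - Suc i)) (drop (Suc i) c)"
    have "is_cycle A ?z"
      using cycle_between[OF path ij'] .
    moreover have "edges ?z \<noteq> edges c"
    proof
      assume "edges ?z = edges c"
      then have "length (edges ?z) = length (edges c)" by simp
      then show False using ij' by (simp add: length_edges)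
    qed
    moreover have "subseq (edges ?z) (edges c)"
      by (simp only: edges_take_drop subseq_take_drop)
    ultimately show False
      using c unfolding is_simple_cycle_def strict_subseq_def by blast
  qed
next
  assume c: "is_cycle A c \<and> distinct (tl c)"
  have inj: "i = j" if "c ! Suc i = c ! Suc j" "Suc i < length c" "Suc j < length c" for i j
    using that c nth_eq_iff_index_eq[of "tl c" i j] by (simp add: nth_tl)
  show "is_simple_cycle A c"
    unfolding is_simple_cycle_def
  proof (intro conjI notI)
    assume "\<exists>z. is_cycle A z \<and> strict_subseq (edges z) (edges c)"
    then obtain z where z: "is_cycle A z" "subseq (edges z) (edges c)" "edges z \<noteq> edges c"
      by (auto simp: strict_subseq_def)
    obtain g m where ne: "edges z \<noteq> []" "m = length (edges z) - 1"
      and g: "strict_mono_on {..m} g"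
        "\<And>i. i \<le> m \<Longrightarrow> Suc (g i) < length c \<and> edges z ! i = edges c ! g i"
        "\<And>i. i < m \<Longrightarrow> c ! Suc (g i) = c ! g (Suc i)"
        "c ! Suc (g m) = c ! g 0"
      by (rule cycle_in_path[OF z(1,2)], rule that)
    have mono: "g 0 \<le> g m" using g(1) by (cases m) (auto simp: strict_mono_on_def less_imp_le)
    have g0: "g 0 = 0"
    proof (rule ccontr)
      assume "g 0 \<noteq> 0"
      then obtain k where "g 0 = Suc k" using not0_implies_Suc by blast
      then show False using inj[of "g m" k] g(2)[of 0] g(2)[of m] g(4) mono by auto
    qed
    have gi: "g i = i" if "i \<le> m" for i
      using that
    proof (induction i)
      case (Suc i)
      have "g i < g (Suc i)"
        using g(1) Suc.prems by (auto simp: strict_mono_on_def)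
      then obtain k where k: "g (Suc i) = Suc k" by (cases "g (Suc i)") auto
      then show ?case
        using inj[of "g i" k] g(2)[of i] g(2)[of "Suc i"] g(3)[of i] Suc by auto
    qed (rule g0)
    have "c \<noteq> []" "c ! 0 = c ! (length c - 1)"
      using c by (auto simp: is_cycle_def is_path_def hd_conv_nth last_conv_nth)
    moreover have "Suc (Suc m) \<le> length c" using g(2)[of m] gi[of m] by simp
    moreover obtain n where n: "length c = Suc (Suc n)"
      using \<open>Suc (Suc m) \<le> length c\<close> by (metis Suc_le_D Suc_le_mono)
    ultimately have "Suc m = length c - 1"
      using inj[of m n] g(4) gi[of m] g0 by simp
    then have "length (edges z) = length (edges c)"
      using ne by (simp add: length_edges[of c])
    moreover have "edges z ! i = edges c ! i" if "i < length (edges z)" for i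
      using g(2)[of i] gi[of i] that ne by auto
    ultimately show False
      using z(3) nth_equalityI by blast
  qed (use c in simp)
qed

section \<open>Lexicographic enumeration of bounded lists\<close>

text \<open>The search space for the loop variables: sequences of vertices of bounded length.\<close>

definition bounded_lists :: "nat \<Rightarrow> nat \<Rightarrow> nat list set" where
  "bounded_lists N L = {xs. length xs \<le> L \<and> set xs \<subseteq> {..<N}}"

lemma finite_bounded_lists: "finite (bounded_lists N L)"
  unfolding bounded_lists_def using finite_lists_length_le[of "{..<N}" L]
  by (simp add: conj_commute)

lemma Cons_in_bounded_lists:
  "x # xs \<in> bounded_lists N (Suc L) \<longleftrightarrow> x < N \<and> xs \<in> bounded_lists N L"
  by (auto simp: bounded_lists_def)

lemma Nil_in_bounded_lists: "[] \<in> bounded_lists N L"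
  by (simp add: bounded_lists_def)

text \<open>The successor in the lexicographic order on \<open>bounded_lists N L\<close>: append a zero if there is
  room, otherwise increase the last entry that can be increased and drop what follows. The empty list, which
  is never a successor, signals the end of the enumeration.\<close>

fun lex_next :: "nat \<Rightarrow> nat \<Rightarrow> nat list \<Rightarrow> nat list" where
  "lex_next N L [] = (if 0 < L then [0] else [])"
| "lex_next N L (x # xs) =
     (let ys = lex_next N (L - 1) xs
      in if ys \<noteq> [] then x # ys else if Suc x < N then [Suc x] else [])"

lemma lex_next:
  assumes "0 < N" "xs \<in> bounded_lists N L"
  shows "(lex_next N L xs = [] \<longrightarrow> (\<forall>zs\<in>bounded_lists N L. \<not> xs < zs)) \<and>
    (lex_next N L xs \<noteq> [] \<longrightarrow> lex_next N L xs \<in> bounded_lists N L \<and> xs < lex_next N L xs \<and>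
       (\<forall>zs\<in>bounded_lists N L. xs < zs \<longrightarrow> lex_next N L xs \<le> zs))"
  using assms(2)
proof (induction xs arbitrary: L)
  case Nil
  show ?case
  proof (cases L)
    case 0
    then show ?thesis by (auto simp: bounded_lists_def)
  next
    case (Suc k)
    have "[0] \<le> zs" if "[] < zs" for zs :: "nat list"
      using that by (cases zs) auto
    then show ?thesis
      using Suc assms(1) by (auto simp: Cons_in_bounded_lists Nil_in_bounded_lists)
  qed
next
  case (Cons x xs)
  then obtain k where L: "L = Suc k" by (cases L) (auto simp: bounded_lists_def)
  then have xs: "x < N" "xs \<in> bounded_lists N k"
    using Cons.prems by (simp_all add: Cons_in_bounded_lists)
  let ?ys = "lex_next N k xs"
  note IH = Cons.IH[OF xs(2)]
  have zs: "\<exists>y ys. zs = y # ys \<and> y < N \<and> ys \<in> bounded_lists N k \<and> (x < y \<or> x = y \<and> xs < ys)"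
    if "zs \<in> bounded_lists N L" "x # xs < zs" for zs
    using that by (cases zs) (auto simp: L Cons_in_bounded_lists)
  show ?case
  proof (cases "?ys = []")
    case False
    then have eq: "lex_next N L (x # xs) = x # ?ys"
      by (simp add: L Let_def)
    have "x # ?ys \<le> zs" if larger: "zs \<in> bounded_lists N L" "x # xs < zs" for zs
    proof -
      obtain y ys where y: "zs = y # ys" "ys \<in> bounded_lists N k" "x < y \<or> x = y \<and> xs < ys"
        using zs[OF larger] by blast
      then have "x = y \<Longrightarrow> ?ys \<le> ys" using IH False by blast
      then show ?thesis using y by auto
    qed
    then show ?thesis
      using IH xs False by (simp add: eq L Cons_in_bounded_lists)
  next
    case True
    have no: "x < y" if "zs \<in> bounded_lists N L" "x # xs < zs" "zs = y # ys" for zs y ys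
      using zs[OF that(1,2)] that(3) IH True by blast
    have least: "[Suc x] \<le> y # ys" if "x < y" for y ys
      using that by (cases ys) auto
    show ?thesis
    proof (cases "Suc x < N")
      case sx: True
      have "[Suc x] \<le> zs" if "zs \<in> bounded_lists N L" "x # xs < zs" for zs
        using zs[OF that] no[OF that] least by blast
      then show ?thesis
        using True sx by (simp add: L Cons_in_bounded_lists Nil_in_bounded_lists)
    next
      case False
      then have "\<not> x # xs < zs" if "zs \<in> bounded_lists N L" for zs
        using zs[OF that] no[OF that] by fastforce
      then show ?thesis
        using True False by (simp add: L)
    qed
  qed
qed

lemma next_in_eq_Some_iff:
  assumes "finite S"
  shows "next_in S (Some x) = Some y \<longleftrightarrow> y \<in> S \<and> x < y \<and> (\<forall>z\<in>S. x < z \<longrightarrow> y \<le> z)"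
proof -
  let ?R = "{y \<in> S. x < y}"
  have "finite ?R" using assms by simp
  then have "?R \<noteq> {} \<Longrightarrow> Min ?R = y \<longleftrightarrow> y \<in> ?R \<and> (\<forall>z\<in>?R. y \<le> z)"
    by (rule Min_eq_iff)
  then show ?thesis by (auto simp: next_in_def)
qed

lemma next_in_eq_None_iff: "next_in S (Some x) = None \<longleftrightarrow> (\<forall>z\<in>S. \<not> x < z)"
  by (auto simp: next_in_def)

lemma next_in_None: "(\<forall>z\<in>S. x < z) \<Longrightarrow> next_in S None = next_in S (Some x)"
  by (simp add: next_in_def) (metis (no_types, lifting) Collect_cong mem_Collect_eq Collect_mem_eq)

text \<open>Loop variables run over nonempty lists. Therefore the empty list can stand both for a loop that has just
  been entered and for a loop that has ended.\<close>

definition list_of_option :: "'a list option \<Rightarrow> 'a list" where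
  "list_of_option x = (case x of None \<Rightarrow> [] | Some xs \<Rightarrow> xs)"

text \<open>The recursion on which the search for the next element of a decidable subset is based.\<close>

lemma next_in_lex_next:
  assumes "0 < N" "xs \<in> bounded_lists N L"
  shows "list_of_option (next_in {ys \<in> bounded_lists N L. P ys} (Some xs)) =
    (let ys = lex_next N L xs in if ys \<noteq> [] \<and> \<not> P ys
      then list_of_option (next_in {ys \<in> bounded_lists N L. P ys} (Some ys)) else ys)"
proof -
  let ?S = "{ys \<in> bounded_lists N L. P ys}" and ?ys = "lex_next N L xs"
  have fin: "finite ?S" using finite_bounded_lists by simp
  note spec = lex_next[OF assms]
  consider "?ys = []" | "?ys \<noteq> []" "P ?ys" | "?ys \<noteq> []" "\<not> P ?ys" by blast
  then show ?thesis
  proof cases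
    case 1
    then have "next_in ?S (Some xs) = None"
      using spec by (simp add: next_in_eq_None_iff)
    then show ?thesis using 1 by (simp add: list_of_option_def)
  next
    case 2
    then have "next_in ?S (Some xs) = Some ?ys"
      using spec by (subst next_in_eq_Some_iff[OF fin]) simp
    then show ?thesis using 2 by (simp add: list_of_option_def)
  next
    case 3
    have "xs < zs \<longleftrightarrow> ?ys < zs" if "zs \<in> ?S" for zs
    proof
      assume "xs < zs"
      then have "?ys \<le> zs" using spec 3 that by blast
      then show "?ys < zs" using 3 that by (auto simp: order_le_less)
    qed (use spec 3 in \<open>auto intro: less_trans\<close>)
    then have "{zs \<in> ?S. xs < zs} = {zs \<in> ?S. ?ys < zs}"
      by blast
    then have "next_in ?S (Some xs) = next_in ?S (Some ?ys)"
      by (simp only: next_in_def option.case)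
    then show ?thesis using 3 by (simp add: Let_def)
  qed
qed

section \<open>Loop iterations by exhaustive search\<close>

text \<open>The factor in parentheses bounds the part of the encoding that belongs to one entry.\<close>

lemma sz_bounded_lists:
  "xs \<in> bounded_lists N L \<Longrightarrow> sz xs \<le> L * (2 * N + 1)"
proof (induction xs arbitrary: L)
  case (Cons x xs)
  then obtain k where L: "L = Suc k" by (cases L) (auto simp: bounded_lists_def)
  then have x: "x < N" "xs \<in> bounded_lists N k"
    using Cons.prems by (simp_all add: Cons_in_bounded_lists)
  then show ?case using Cons.IH[OF x(2)] sz_nat_le[of x] by (simp add: L)
qed simp

lemma lex_next_fold:
  "lex_next N L xs = fold (\<lambda>x r. if r \<noteq> [] then x # r else if Suc x < N then [Suc x] else [])
     (rev xs) (if length xs < L then [0] else [])"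
proof (induction xs arbitrary: L)
  case (Cons x xs)
  have "length xs < L - 1 \<longleftrightarrow> length (x # xs) < L" by auto
  then show ?case by (simp add: Cons.IH Let_def)
qed simp

lemma pspace_lex_next [pspace_intros]:
  assumes "pspace N" "pspace L" "pspace xs"
  shows "pspace (\<lambda>e. lex_next (N e) (L e) (xs e))"
  unfolding lex_next_fold
proof (rule pspace_fold_growth[where q = "[:3, 2:]"])
  show "sz (if r \<noteq> [] then x # r else if Suc x < N e then [Suc x] else [])
      \<le> sz r + poly [:3, 2:] (sz e + sz x)" for e x r
    using sz_Suc[of x] by simp
qed (intro pspace_intros pspace_comp[OF _ assms(1)] assms)+

lemma pspace_bounded_lists [pspace_intros]:
  assumes "pspace N" "pspace L" "pspace xs"
  shows "pspace (\<lambda>e. xs e \<in> bounded_lists (N e) (L e))"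
proof -
  have *: "ys \<in> bounded_lists M K \<longleftrightarrow>
      \<not> K < length ys \<and> (\<forall>i<length ys. hd (drop i ys) < M)" for ys M K
    by (auto simp: bounded_lists_def hd_drop_conv_nth all_set_conv_all_nth subset_eq)
  show ?thesis
    unfolding *
    by (intro pspace_intros assms pspace_comp[OF _ assms(1)] pspace_comp[OF _ assms(3)])
qed

text \<open>Outside the intended range the value is set to the empty list, so that the loop that computes this
  function ends for all arguments.\<close>

definition search :: "(nat list \<Rightarrow> bool) \<Rightarrow> nat \<Rightarrow> nat list \<Rightarrow> nat list" where
  "search P N xs =
     (if 0 < N \<and> xs \<in> bounded_lists N (Suc N)
      then list_of_option (next_in {ys \<in> bounded_lists N (Suc N). P ys} (Some xs)) else [])"

lemma search_lex_next:
  assumes "0 < N" "xs \<in> bounded_lists N (Suc N)"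
  shows "search P N xs =
    (let ys = lex_next N (Suc N) xs in if ys \<noteq> [] \<and> \<not> P ys then search P N ys else ys)"
  using lex_next[OF assms] assms unfolding search_def next_in_lex_next[OF assms] Let_def by auto

lemma loops_search:
  assumes N: "0 < N" and xs: "xs \<in> bounded_lists N (Suc N)"
    and b: "2 * sz e + Suc N * (2 * N + 1) + 1 \<le> b"
    and P: "\<And>ys. Q e ys \<longleftrightarrow> P ys" and N': "N' e = N"
  shows "loops (\<lambda>z. snd z \<noteq> [] \<and> \<not> Q (fst z) (snd z))
    (\<lambda>z. (fst z, lex_next (N' (fst z)) (Suc (N' (fst z))) (snd z))) b
    (e, lex_next N (Suc N) xs) (e, search P N xs)"
  using xs
proof (induction "card {zs \<in> bounded_lists N (Suc N). xs < zs}" arbitrary: xs rule: less_induct)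
  case less
  let ?U = "bounded_lists N (Suc N)" and ?ys = "lex_next N (Suc N) xs"
  note spec = lex_next[OF N less.prems]
  have U: "?ys \<in> ?U" using spec by (cases "?ys = []") (auto simp: Nil_in_bounded_lists)
  then have size: "sz (e, ?ys) \<le> b"
    using b sz_bounded_lists[OF U] by simp
  show ?case
  proof (cases "?ys \<noteq> [] \<and> \<not> P ?ys")
    case True
    then have "{zs \<in> ?U. ?ys < zs} \<subset> {zs \<in> ?U. xs < zs}"
      using spec by (auto intro: less_trans)
    then have "card {zs \<in> ?U. ?ys < zs} < card {zs \<in> ?U. xs < zs}"
      by (intro psubset_card_mono) (auto simp: finite_bounded_lists)
    from less.hyps[OF this U] have "loops (\<lambda>z. snd z \<noteq> [] \<and> \<not> Q (fst z) (snd z))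
        (\<lambda>z. (fst z, lex_next (N' (fst z)) (Suc (N' (fst z))) (snd z))) b
        (e, lex_next N (Suc N) ?ys) (e, search P N xs)"
      using True search_lex_next[OF N less.prems, of P] by simp
    then show ?thesis
      by - (rule loops.step, use True size P N' in simp_all)
  next
    case False
    then have "search P N xs = ?ys"
      using search_lex_next[OF N less.prems, of P] by (auto simp: Let_def)
    then show ?thesis
      using False size P by (auto intro: loops.stop)
  qed
qed

lemma pspace_search:
  assumes A: "pspace A" and P: "pspace (\<lambda>z. P (fst z) (snd z))" and xs: "pspace xs"
  shows "pspace (\<lambda>e. search (P e) (length (A e)) (xs e))"
proof -
  let ?N = "\<lambda>e. length (A e)"
  let ?init = "\<lambda>e. (e, if 0 < ?N e \<and> xs e \<in> bounded_lists (?N e) (Suc (?N e))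
      then lex_next (?N e) (Suc (?N e)) (xs e) else [])"
  let ?c = "\<lambda>z. snd z \<noteq> [] \<and> \<not> P (fst z) (snd z)"
  let ?f = "\<lambda>z. (fst z, lex_next (?N (fst z)) (Suc (?N (fst z))) (snd z))"
  obtain p :: "nat poly" where p: "\<And>e. sz (A e) \<le> poly p (sz e)"
    using pspace_size[OF A] by blast
  let ?p = "[:1, 2:] + ([:1:] + p) * ([:1:] + [:2:] * p)"
  have "pspace (\<lambda>e. (e, search (P e) (?N e) (xs e)))"
  proof (rule pspace_while)
    show "pspace ?init" by (intro pspace_intros A xs)
    show "pspace ?c" by (intro pspace_intros P)
    show "pspace ?f" by (intro pspace_intros pspace_comp[OF _ A])
    fix e
    have N: "?N e \<le> poly p (sz e)" using p[of e] length_le_sz[of "A e"] by simp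
    have "2 * sz e + Suc (?N e) * (2 * ?N e + 1) + 1
        \<le> 2 * sz e + Suc (poly p (sz e)) * (2 * poly p (sz e) + 1) + 1"
      using N by (intro add_mono mult_mono) auto
    also have "\<dots> = poly ?p (sz e)" by (simp add: algebra_simps)
    finally have b: "2 * sz e + Suc (?N e) * (2 * ?N e + 1) + 1 \<le> poly ?p (sz e)" .
    show "loops ?c ?f (poly ?p (sz e)) (?init e) (e, search (P e) (?N e) (xs e))"
    proof (cases "0 < ?N e \<and> xs e \<in> bounded_lists (?N e) (Suc (?N e))")
      case True
      then show ?thesis
        using loops_search[where Q = P and N' = ?N and e = e and P = "P e", OF _ _ b] by simp
    next
      case False
      then have "search (P e) (?N e) (xs e) = []" by (auto simp: search_def)
      then show ?thesis using False b by (auto intro!: loops.stop)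
    qed
  qed
  from pspace_snd[OF this] show ?thesis by simp
qed

section \<open>One step of the algorithm on coded data\<close>

text \<open>Absolute values of the entries of both matrices, row by row; they suffice to decide vanishing and
  divisibility of products.\<close>

type_synonym matrices = "nat list list \<times> nat list list"

definition entry :: "nat list list \<Rightarrow> nat \<Rightarrow> nat \<Rightarrow> nat" where
  "entry Z u v = hd (drop v (hd (drop u Z)))"

definition label :: "nat list list \<Rightarrow> nat list \<Rightarrow> nat \<Rightarrow> nat" where
  "label Z p i = entry Z (hd (drop i p)) (hd (drop (Suc i) p))"

text \<open>Tests for a product to be nonzero are carried out factor by factor. The tests below are written with
  bounded quantifiers over positions and with \<^term>\<open>hd (drop i p)\<close> in place of the
  \<open>i\<close>-th entry, the form in which the closure properties of \<^const>\<open>pspace\<close>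
  apply.\<close>

definition nonzero_labels :: "nat list list \<Rightarrow> nat list \<Rightarrow> bool" where
  "nonzero_labels Z p \<longleftrightarrow> (\<forall>i<length (tl p). label Z p i \<noteq> 0)"

definition label_product :: "nat list list \<Rightarrow> nat list \<Rightarrow> nat" where
  "label_product Z p = (\<Prod>i<length (tl p). label Z p i)"

definition no_repetition :: "nat list \<Rightarrow> bool" where
  "no_repetition p \<longleftrightarrow> (\<forall>i<length p. \<forall>j<i. hd (drop i p) \<noteq> hd (drop j p))"

definition path_test :: "matrices \<Rightarrow> nat \<Rightarrow> nat list \<Rightarrow> bool" where
  "path_test X v p \<longleftrightarrow> p \<noteq> [] \<and> hd p = v \<and> nonzero_labels (fst X) p \<and> no_repetition p"

definition nonzero_path_test :: "matrices \<Rightarrow> nat \<Rightarrow> nat list \<Rightarrow> bool" where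
  "nonzero_path_test X v p \<longleftrightarrow> path_test X v p \<and> nonzero_labels (snd X) p"

definition cycle_test :: "matrices \<Rightarrow> nat \<Rightarrow> nat list \<Rightarrow> bool" where
  "cycle_test X v c \<longleftrightarrow> tl c \<noteq> [] \<and> hd c = v \<and> hd (rev c) = v \<and>
     nonzero_labels (fst X) c \<and> no_repetition (tl c)"

lemma pspace_label [pspace_intros]:
  "pspace Z \<Longrightarrow> pspace p \<Longrightarrow> pspace i \<Longrightarrow> pspace (\<lambda>e. label (Z e) (p e) (i e))"
  unfolding label_def entry_def by (intro pspace_intros)

lemma pspace_nonzero_labels [pspace_intros]:
  "pspace Z \<Longrightarrow> pspace p \<Longrightarrow> pspace (\<lambda>e. nonzero_labels (Z e) (p e))"
  unfolding nonzero_labels_def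
  by (intro pspace_intros | erule pspace_comp[rotated])+

lemma pspace_no_repetition [pspace_intros]:
  assumes p: "pspace p"
  shows "pspace (\<lambda>e. no_repetition (p e))"
  unfolding no_repetition_def by (intro pspace_intros pspace_comp[OF _ p] p)

lemma pspace_label_product [pspace_intros]:
  assumes Z: "pspace Z" and p: "pspace p"
  shows "pspace (\<lambda>e. label_product (Z e) (p e))"
proof -
  obtain q :: "nat poly" where q: "\<And>e. sz (p e) \<le> poly q (sz e)"
    using pspace_size[OF p] by blast
  show ?thesis
    unfolding label_product_def
  proof (rule pspace_prod[where p = q])
    show "length (tl (p e)) \<le> poly q (sz e)" for e
      using q[of e] length_le_sz[of "p e"] by simp
  qed (intro pspace_intros pspace_comp[OF _ p] pspace_comp[OF _ Z] p)+
qed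

lemma pspace_path_test [pspace_intros]:
  "pspace X \<Longrightarrow> pspace v \<Longrightarrow> pspace p \<Longrightarrow> pspace (\<lambda>e. path_test (X e) (v e) (p e))"
  unfolding path_test_def by (intro pspace_intros)

lemma pspace_nonzero_path_test [pspace_intros]:
  "pspace X \<Longrightarrow> pspace v \<Longrightarrow> pspace p \<Longrightarrow> pspace (\<lambda>e. nonzero_path_test (X e) (v e) (p e))"
  unfolding nonzero_path_test_def by (intro pspace_intros)

lemma pspace_cycle_test [pspace_intros]:
  "pspace X \<Longrightarrow> pspace v \<Longrightarrow> pspace p \<Longrightarrow> pspace (\<lambda>e. cycle_test (X e) (v e) (p e))"
  unfolding cycle_test_def by (intro pspace_intros)

text \<open>Program point, vertex, the two path variables, a bit and \<open>T1\<close>. Components that are not in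
  scope at a program point have a fixed default value.\<close>

type_synonym state_code = "nat \<times> nat \<times> nat list \<times> nat list \<times> bool \<times> bool"

definition next_path :: "matrices \<Rightarrow> nat \<Rightarrow> nat list \<Rightarrow> nat list" where
  "next_path X v = search (path_test X v) (length (fst X))"

definition next_nonzero_path :: "matrices \<Rightarrow> nat \<Rightarrow> nat list \<Rightarrow> nat list" where
  "next_nonzero_path X v = search (nonzero_path_test X v) (length (fst X))"

definition next_cycle :: "matrices \<Rightarrow> nat \<Rightarrow> nat list \<Rightarrow> nat list" where
  "next_cycle X v = search (cycle_test X v) (length (fst X))"

lemma pspace_nexts [pspace_intros]:
  assumes X: "pspace X" and v: "pspace v" and p: "pspace p"
  shows "pspace (\<lambda>e. next_path (X e) (v e) (p e))"
    "pspace (\<lambda>e. next_nonzero_path (X e) (v e) (p e))"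
    "pspace (\<lambda>e. next_cycle (X e) (v e) (p e))"
  unfolding next_path_def next_nonzero_path_def next_cycle_def
  by (rule pspace_search; intro pspace_intros pspace_comp[OF _ X] pspace_comp[OF _ v] X p)+

text \<open>The numbers of the program points are those that the encoding of states writes first. At the head of the
  vertex loop (number 0) the bit tells whether a vertex has been treated already; after a call of the
  procedure Faithful (number 4) it is the returned value, and after halting (number 12) the answer.\<close>

definition step_code ::
  "matrices \<Rightarrow> nat \<Rightarrow> nat \<Rightarrow> nat list \<Rightarrow> nat list \<Rightarrow> bool \<Rightarrow> bool \<Rightarrow> state_code" where
  "step_code X g v p c b t =
    (if g = 0 then let w = (if b then Suc v else v) in
       if w < length (fst X) then (1, w, [], [], False, t) else (12, 0, [], [], True, False)
     else if g = 1 then let p' = next_nonzero_path X v p in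
       if p' = [] then (4, v, [], [], False, t) else (2, v, p', [], False, t)
     else if g = 2 then let c' = next_cycle X (hd (rev p)) c in
       if c' = [] then (1, v, p, [], False, t) else (3, v, p, c', False, t)
     else if g = 3 then
       if label_product (fst X) c dvd label_product (snd X) c
       then (2, v, p, c, False, t) else (4, v, [], [], True, t)
     else if g = 4 then if b then (0, v, [], [], True, t) else (5, v, [], [], False, t)
     else if g = 5 then let p' = next_nonzero_path X v p in
       if p' = [] then (8, v, [], [], False, t) else (6, v, p', [], False, t)
     else if g = 6 then let c' = next_cycle X (hd (rev p)) c in
       if c' = [] then (5, v, p, [], False, t) else (7, v, p, c', False, t)
     else if g = 7 then (6, v, p, c, False, nonzero_labels (snd X) c \<or> t)
     else if g = 8 then if t then (9, v, [], [], False, t) else (0, v, [], [], True, t)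
     else if g = 9 then let p' = next_nonzero_path X v p in
       if p' = [] then (12, 0, [], [], False, False) else (10, v, p', [], False, t)
     else if g = 10 then let c' = next_path X (hd (rev p)) c in
       if c' = [] then (0, v, [], [], True, t) else (11, v, p, c', False, t)
     else if g = 11 then
       if nonzero_labels (snd X) c then (10, v, p, c, False, t) else (9, v, p, [], False, t)
     else (g, v, p, c, b, t))"

lemma pspace_step_code [pspace_intros]:
  assumes "pspace X" "pspace g" "pspace v" "pspace p" "pspace c" "pspace b" "pspace t"
  shows "pspace (\<lambda>e. step_code (X e) (g e) (v e) (p e) (c e) (b e) (t e))"
  unfolding step_code_def
  by (intro pspace_intros assms assms[THEN pspace_comp[rotated]])

subsection \<open>Writing the current state\<close>

text \<open>All output is produced in reversed order, since a tape is filled by pushing letters onto a stack whose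
  top is at the right end.\<close>

definition cat :: "raw \<Rightarrow> raw \<Rightarrow> raw" where
  "cat u v = Raw (letters u @ letters v)"

lemma letters_cat [simp]: "letters (cat u v) = letters u @ letters v"
  by (simp add: cat_def)

lemma pspace_cat [pspace_intros]: "pspace u \<Longrightarrow> pspace v \<Longrightarrow> pspace (\<lambda>e. cat (u e) (v e))"
  unfolding cat_def by (intro pspace_intros)

definition nat_output :: "nat \<Rightarrow> raw" where
  "nat_output n = cat (Raw [End_Num]) (Raw (enc n))"

definition path_output :: "nat list \<Rightarrow> raw" where
  "path_output p = cat (Raw [End_List]) (fold (\<lambda>x r. cat (nat_output x) r) p (Raw []))"

definition optional_path_output :: "nat list \<Rightarrow> raw" where
  "optional_path_output p = (if p = [] then Raw [None_Mark] else path_output p)"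

definition bool_output :: "bool \<Rightarrow> raw" where
  "bool_output b = Raw (enc b)"

lemma pspace_outputs [pspace_intros]:
  shows "pspace n \<Longrightarrow> pspace (\<lambda>e. nat_output (n e))"
    and "pspace p \<Longrightarrow> pspace (\<lambda>e. path_output (p e))"
    and "pspace b \<Longrightarrow> pspace (\<lambda>e. bool_output (b e))"
proof -
  show n: "pspace (\<lambda>e. nat_output (n e))" if "pspace n" for n :: "'x::enc \<Rightarrow> nat"
    unfolding nat_output_def by (intro pspace_intros that)
  show "pspace (\<lambda>e. path_output (p e))" if "pspace p"
    unfolding path_output_def
    by (intro pspace_cat pspace_const pspace_fold_growth[where q = "[:1, 1:]"] pspace_intros n that)
      (auto simp: enc_raw_def nat_output_def)
  show "pspace (\<lambda>e. bool_output (b e))" if "pspace b"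
    unfolding bool_output_def by (intro pspace_intros that)
qed

lemma pspace_optional_path_output [pspace_intros]:
  "pspace p \<Longrightarrow> pspace (\<lambda>e. optional_path_output (p e))"
  unfolding optional_path_output_def by (intro pspace_intros)

lemma letters_nat_output [simp]: "letters (nat_output n) = rev (encode_nat n)"
  by (simp add: nat_output_def encode_nat_def enc_nat_def)

lemma letters_bool_output [simp]: "letters (bool_output b) = [Bit b]"
  by (simp add: bool_output_def enc_bool_def)

lemma letters_path_output [simp]: "letters (path_output p) = rev (encode_path p)"
proof -
  have "letters (fold (\<lambda>x r. cat (nat_output x) r) p r)
      = rev (concat (map encode_nat p)) @ letters r" for r
    by (induction p arbitrary: r) auto
  then show ?thesis by (simp add: path_output_def encode_list_def)
qed

definition output_code ::
  "nat \<Rightarrow> nat \<Rightarrow> nat list \<Rightarrow> nat list \<Rightarrow> bool \<Rightarrow> bool \<Rightarrow> raw" where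
  "output_code g v p c b t =
    cat
     (if g = 0 then cat (bool_output t) (if b then nat_output v else Raw [None_Mark])
      else if g = 1 \<or> g = 5 \<or> g = 9 then
        cat (bool_output t) (cat (optional_path_output p) (nat_output v))
      else if g = 4 then cat (bool_output t) (cat (bool_output b) (nat_output v))
      else if g = 8 then cat (bool_output t) (nat_output v)
      else if g = 12 then bool_output b
      else cat (bool_output t)
        (cat (optional_path_output c) (cat (path_output p) (nat_output v))))
     (nat_output g)"

lemma pspace_output_code [pspace_intros]:
  assumes "pspace g" "pspace v" "pspace p" "pspace c" "pspace b" "pspace t"
  shows "pspace (\<lambda>e. output_code (g e) (v e) (p e) (c e) (b e) (t e))"
  unfolding output_code_def by (intro pspace_intros assms)

definition answer_code :: "nat \<Rightarrow> bool \<Rightarrow> raw" where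
  "answer_code g b = (if g = 12 then bool_output b else Raw [])"

lemma pspace_answer_code [pspace_intros]:
  "pspace g \<Longrightarrow> pspace b \<Longrightarrow> pspace (\<lambda>e. answer_code (g e) (b e))"
  unfolding answer_code_def by (intro pspace_intros)

subsection \<open>Reading the input\<close>

text \<open>The current number, the current row, the current matrix and the list of finished matrices. Since only
  absolute values are wanted, signs will be skipped.\<close>

type_synonym parse_state = "nat \<times> nat list \<times> nat list list \<times> nat list list list"

definition parse_letter :: "letter \<Rightarrow> parse_state \<Rightarrow> parse_state" where
  "parse_letter l z =
    (let n = fst z; es = fst (snd z); rs = fst (snd (snd z)); ms = snd (snd (snd z)) in
     if l = Bit True then (Suc (n + n), es, rs, ms)
     else if l = Bit False then (n + n, es, rs, ms)
     else if l = End_Num then (0, es @ [n], rs, ms)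
     else if l = End_List then (0, [], rs @ [es], ms)
     else if l = End_Mat then (0, [], [], ms @ [rs])
     else z)"

definition parse :: "letter list \<Rightarrow> matrices" where
  "parse w = (let ms = snd (snd (snd (fold parse_letter w (0, [], [], [])))) in
     (hd ms, hd (tl ms)))"

lemma sz_double: "sz (n + n) \<le> Suc (sz n)" "sz (Suc (n + n)) \<le> Suc (sz n)"
  using less_power_sz[of n] by (simp_all add: sz_nat_le_iff)

text \<open>Closing a number, a row or a matrix moves a component into the next one and thereby doubles its share of
  the encoding. The decreasing weights compensate for this, so that each letter adds only a constant.\<close>

definition parse_potential :: "parse_state \<Rightarrow> nat" where
  "parse_potential z = 8 * sz (fst z) + 4 * sz (fst (snd z)) + 2 * sz (fst (snd (snd z)))
     + sz (snd (snd (snd z)))"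

lemma parse_potential_letter:
  "parse_potential (parse_letter l z) \<le> parse_potential z + 12"
  using sz_double[of "fst z"] sz_nat_pos[of "fst z"]
  by (auto simp: parse_potential_def parse_letter_def Let_def sz_append)

lemma parse_potential_fold:
  "parse_potential (fold parse_letter w z) \<le> parse_potential z + 12 * length w"
proof (induction w arbitrary: z)
  case (Cons l w)
  show ?case using Cons[of "parse_letter l z"] parse_potential_letter[of l z] by simp
qed simp

lemma pspace_parse [pspace_intros]:
  assumes w: "pspace w"
  shows "pspace (\<lambda>e. parse (w e))"
proof -
  obtain p :: "nat poly" where p: "\<And>e. sz (w e) \<le> poly p (sz e)"
    using pspace_size[OF w] by blast
  have letter: "pspace (\<lambda>e. parse_letter (l e) (z e))" if "pspace l" "pspace z"
    for l :: "'x::enc \<Rightarrow> letter" and z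
    unfolding parse_letter_def Let_def by (intro pspace_intros that)
  have "pspace (\<lambda>e. fold parse_letter (w e) (0, [], [], []))"
  proof (rule pspace_fold[where p = "[:11:] + [:12:] * p"])
    fix e i
    let ?z = "fold parse_letter (take i (w e)) (0, [], [], [])"
    have "sz ?z \<le> parse_potential ?z + 3"
      by (cases ?z) (simp add: parse_potential_def)
    also have "\<dots> \<le> 8 + 12 * length (take i (w e)) + 3"
      using parse_potential_fold[of "take i (w e)" "(0, [], [], [])"]
      by (simp add: parse_potential_def)
    also have "\<dots> \<le> poly ([:11:] + [:12:] * p) (sz e)"
      using p[of e] length_le_sz[of "w e"] by simp
    finally show "sz ?z \<le> poly ([:11:] + [:12:] * p) (sz e)" .
  qed (intro pspace_intros letter w)+
  then show ?thesis unfolding parse_def by (intro pspace_intros)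
qed

definition abs_mat :: "int mat \<Rightarrow> nat list list" where
  "abs_mat Z = map (map (\<lambda>z. nat \<bar>z\<bar>)) (mat_to_list Z)"

lemma parse_letter_simps [simp]:
  "parse_letter (Bit b) (n, es, rs, ms) = (if b then Suc (n + n) else n + n, es, rs, ms)"
  "parse_letter Minus (n, es, rs, ms) = (n, es, rs, ms)"
  "parse_letter End_Num (n, es, rs, ms) = (0, es @ [n], rs, ms)"
  "parse_letter End_List (n, es, rs, ms) = (0, [], rs @ [es], ms)"
  "parse_letter End_Mat (n, es, rs, ms) = (0, [], [], ms @ [rs])"
  by (simp_all add: parse_letter_def)

lemma parse_binary: "fold parse_letter (binary n) (0, es, rs, ms) = (n, es, rs, ms)"
proof (induction n rule: less_induct)
  case (less n)
  show ?case
  proof (cases "n < 2")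
    case True
    then have "n = 0 \<or> n = 1" by auto
    then show ?thesis
      by (subst binary.simps) auto
  next
    case False
    then have "fold parse_letter (binary (n div 2)) (0, es, rs, ms) = (n div 2, es, rs, ms)"
      using less by simp
    moreover have "binary n = binary (n div 2) @ [Bit (odd n)]"
      using False by (subst binary.simps) simp
    moreover have "(if odd n then Suc (n div 2 + n div 2) else n div 2 + n div 2) = n"
      by presburger
    ultimately show ?thesis
      by simp
  qed
qed

lemma parse_int: "fold parse_letter (encode_int z) (0, es, rs, ms) = (0, es @ [nat \<bar>z\<bar>], rs, ms)"
  by (simp add: encode_int_def encode_nat_def parse_binary)

lemma parse_ints:
  "fold parse_letter (concat (map encode_int zs)) (0, es, rs, ms)
    = (0, es @ map (\<lambda>z. nat \<bar>z\<bar>) zs, rs, ms)"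
  by (induction zs arbitrary: es) (simp_all add: parse_int)

lemma parse_row:
  "fold parse_letter (encode_list encode_int zs) (0, [], rs, ms)
    = (0, [], rs @ [map (\<lambda>z. nat \<bar>z\<bar>) zs], ms)"
  by (simp add: encode_list_def parse_ints)

lemma parse_rows:
  "fold parse_letter (concat (map (encode_list encode_int) zss)) (0, [], rs, ms)
    = (0, [], rs @ map (map (\<lambda>z. nat \<bar>z\<bar>)) zss, ms)"
  by (induction zss arbitrary: rs) (simp_all add: parse_row)

lemma parse_mat:
  "fold parse_letter (encode_mat Z) (0, [], [], ms) = (0, [], [], ms @ [abs_mat Z])"
  by (simp add: encode_mat_def parse_rows abs_mat_def)

lemma parse_encode_pair: "parse (encode_pair (A, B)) = (abs_mat A, abs_mat B)"
  by (simp add: parse_def encode_pair_def parse_mat)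

section \<open>The coded step simulates the algorithm\<close>

lemma length_abs_mat: "length (abs_mat Z) = dim_row Z"
  by (simp add: abs_mat_def mat_to_list_def)

lemma entry_abs_mat:
  "u < dim_row Z \<Longrightarrow> v < dim_col Z \<Longrightarrow> entry (abs_mat Z) u v = nat \<bar>Z $$ (u, v)\<bar>"
  by (simp add: entry_def abs_mat_def mat_to_list_def hd_drop_conv_nth)

lemma no_repetition_iff: "no_repetition p \<longleftrightarrow> distinct p"
  unfolding no_repetition_def distinct_conv_nth
  by (auto simp: hd_drop_conv_nth) (metis linorder_neqE_nat less_trans)

lemma prod_list_nth: "prod_list xs = (\<Prod>i<length xs. xs ! i)" for xs :: "'a::comm_monoid_mult list"
  by (induction xs) (simp_all add: prod.lessThan_Suc_shift del: prod.lessThan_Suc)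

lemma nat_abs_prod: "nat \<bar>\<Prod>i\<in>I. f i\<bar> = (\<Prod>i\<in>I. nat \<bar>f i :: int\<bar>)"
  by (induction I rule: infinite_finite_induct) (simp_all add: abs_mult nat_mult_distrib)

lemma simple_paths_bounded: "simple_paths A v \<subseteq> bounded_lists (dim_row A) (Suc (dim_row A))"
proof -
  have "length p \<le> dim_row A" if "is_simple_path A p" for p
    using that card_mono[of "{..<dim_row A}" "set p"]
    by (simp add: is_simple_path_iff is_path_def distinct_card)
  then show ?thesis
    by (auto simp: simple_paths_def bounded_lists_def is_simple_path_iff is_path_def le_SucI)
qed

lemma simple_cycles_bounded: "simple_cycles A v \<subseteq> bounded_lists (dim_row A) (Suc (dim_row A))"
proof -
  have "length p \<le> Suc (dim_row A)" if "is_simple_cycle A p" for p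
  proof -
    have "set (tl p) \<subseteq> {..<dim_row A}" "distinct (tl p)"
      using that list.set_sel(2)[of p]
      by (auto simp: is_simple_cycle_iff is_cycle_def is_path_def)
    then have "length (tl p) \<le> dim_row A"
      using card_mono[of "{..<dim_row A}" "set (tl p)"] by (simp add: distinct_card)
    then show ?thesis by simp
  qed
  then show ?thesis
    by (auto simp: simple_cycles_def bounded_lists_def is_simple_cycle_iff is_cycle_def is_path_def)
qed

lemma finite_simple_paths: "finite (simple_paths A v)"
  by (rule finite_subset[OF simple_paths_bounded finite_bounded_lists])

lemma finite_simple_cycles: "finite (simple_cycles A v)"
  by (rule finite_subset[OF simple_cycles_bounded finite_bounded_lists])

lemma list_of_option_simps [simp]: "list_of_option None = []" "list_of_option (Some xs) = xs"
  by (simp_all add: list_of_option_def)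

text \<open>Represents a state of the algorithm. In the vertex loop a missing vertex is written as 0, with the bit set
  to \<^term>\<open>False\<close>.\<close>

fun state_code :: "alg2_state \<Rightarrow> state_code" where
  "state_code (For_Vertex v t) = (0, (case v of None \<Rightarrow> 0 | Some u \<Rightarrow> u), [], [], v \<noteq> None, t)"
| "state_code (Faithful_For_Path v p t) = (1, v, list_of_option p, [], False, t)"
| "state_code (Faithful_For_Cycle v p c t) = (2, v, p, list_of_option c, False, t)"
| "state_code (Faithful_Test v p c t) = (3, v, p, c, False, t)"
| "state_code (Returned v b t) = (4, v, [], [], b, t)"
| "state_code (For_R v p t) = (5, v, list_of_option p, [], False, t)"
| "state_code (For_C v p c t) = (6, v, p, list_of_option c, False, t)"
| "state_code (Test_C v p c t) = (7, v, p, c, False, t)"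
| "state_code (Test_T1 v t) = (8, v, [], [], False, t)"
| "state_code (For_P v p t) = (9, v, list_of_option p, [], False, t)"
| "state_code (For_Q v p c t) = (10, v, p, list_of_option c, False, t)"
| "state_code (Test_Q v p c t) = (11, v, p, c, False, t)"
| "state_code (Halted b) = (12, 0, [], [], b, False)"

definition step_state :: "matrices \<Rightarrow> state_code \<Rightarrow> state_code" where
  "step_state Y z = step_code Y (fst z) (fst (snd z)) (fst (snd (snd z))) (fst (snd (snd (snd z))))
     (fst (snd (snd (snd (snd z))))) (snd (snd (snd (snd (snd z)))))"

locale katsura =
  fixes A B :: "int mat"
  assumes pair: "katsura_pair A B"
begin

definition N :: nat where "N = dim_row A"

definition X :: matrices where "X = (abs_mat A, abs_mat B)"

lemma dims: "0 < N" "dim_row A = N" "dim_col A = N" "dim_row B = N" "dim_col B = N"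
  using pair by (auto simp: katsura_pair_def N_def)

lemma length_X: "length (fst X) = N"
  by (simp add: X_def length_abs_mat N_def)

lemma label_abs_mat:
  assumes "dim_row Z = N" "dim_col Z = N" "set p \<subseteq> {..<N}" "i < length (edges p)"
  shows "label (abs_mat Z) p i = nat \<bar>Z $$ (edges p ! i)\<bar>"
proof -
  have i: "Suc i < length p" using assms(4) by (simp add: length_edges)
  then have "p ! i \<in> {..<N}" "p ! Suc i \<in> {..<N}"
    using assms(3) by (meson Suc_lessD nth_mem subsetD)+
  then show ?thesis
    using assms i by (simp add: label_def entry_abs_mat hd_drop_conv_nth nth_edges)
qed

lemma nonzero_labels_abs_mat:
  assumes "dim_row Z = N" "dim_col Z = N" "set p \<subseteq> {..<N}"
  shows "nonzero_labels (abs_mat Z) p \<longleftrightarrow> (\<forall>e\<in>set (edges p). Z $$ e \<noteq> 0)"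
  using label_abs_mat[OF assms]
  by (auto simp: nonzero_labels_def length_edges all_set_conv_all_nth)

lemma label_product_abs_mat:
  assumes "dim_row Z = N" "dim_col Z = N" "set p \<subseteq> {..<N}"
  shows "label_product (abs_mat Z) p = nat \<bar>weight Z p\<bar>"
  using label_abs_mat[OF assms]
  by (simp add: label_product_def weight_def prod_list_nth nat_abs_prod length_edges)

lemma nonzero_labels_weight:
  assumes "set p \<subseteq> {..<N}"
  shows "nonzero_labels (snd X) p \<longleftrightarrow> weight B p \<noteq> 0"
  using nonzero_labels_abs_mat[of B p] assms dims
  by (auto simp: X_def weight_def prod_list_zero_iff)

lemma path_test_iff:
  assumes "set p \<subseteq> {..<N}"
  shows "path_test X v p \<longleftrightarrow> p \<in> simple_paths A v"
  using nonzero_labels_abs_mat[of A p] assms dims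
  by (auto simp: path_test_def X_def simple_paths_def is_simple_path_iff is_path_def no_repetition_iff)

lemma nonzero_path_test_iff:
  assumes "set p \<subseteq> {..<N}"
  shows "nonzero_path_test X v p \<longleftrightarrow> p \<in> nonzero_simple_paths A B v"
  using assms by (simp add: nonzero_path_test_def path_test_iff nonzero_labels_weight
      nonzero_simple_paths_def)

lemma cycle_test_iff:
  assumes "set c \<subseteq> {..<N}"
  shows "cycle_test X v c \<longleftrightarrow> c \<in> simple_cycles A v"
proof -
  have "tl c \<noteq> [] \<longleftrightarrow> edges c \<noteq> []"
    using length_edges[of c] by (metis length_0_conv length_tl)
  moreover have "tl c \<noteq> [] \<Longrightarrow> c \<noteq> []" by auto
  ultimately show ?thesis
    using nonzero_labels_abs_mat[of A c] assms dims
    by (auto simp: cycle_test_def X_def simple_cycles_def is_simple_cycle_iff is_cycle_def is_path_def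
        no_repetition_iff hd_rev)
qed

text \<open>A loop that has not started yet agrees with one that has just treated the empty list, because the empty
  list precedes all elements of \<open>S\<close>.\<close>

lemma search_next_in:
  assumes S: "S \<subseteq> bounded_lists N (Suc N)" "[] \<notin> S"
    and P: "\<And>p. set p \<subseteq> {..<N} \<Longrightarrow> P p \<longleftrightarrow> p \<in> S"
    and x: "set_option x \<subseteq> S"
  shows "search P (length (fst X)) (list_of_option x) = list_of_option (next_in S x)"
proof -
  have *: "{p \<in> bounded_lists N (Suc N). P p} = S"
    using S(1) P by (auto simp: bounded_lists_def)
  have "list_of_option x \<in> bounded_lists N (Suc N)"
    using x S(1) by (cases x) (auto simp: Nil_in_bounded_lists)
  moreover have "next_in S (Some (list_of_option x)) = next_in S x"
  proof (cases x)
    case None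
    have "[] < p" if "p \<in> S" for p using that S(2) by (cases p) auto
    then show ?thesis using None next_in_None[of S "[]"] by (simp add: list_of_option_def)
  qed (simp add: list_of_option_def)
  ultimately show ?thesis
    using dims(1) by (simp add: search_def length_X *)
qed

lemma simple_paths: "simple_paths A v \<subseteq> bounded_lists N (Suc N)" "[] \<notin> simple_paths A v"
  using simple_paths_bounded by (auto simp: N_def simple_paths_def is_simple_path_def is_path_def)

lemma simple_cycles: "simple_cycles A v \<subseteq> bounded_lists N (Suc N)" "[] \<notin> simple_cycles A v"
  using simple_cycles_bounded
  by (auto simp: N_def simple_cycles_def is_simple_cycle_def is_cycle_def is_path_def)

lemma nonzero_simple_paths:
  "nonzero_simple_paths A B v \<subseteq> bounded_lists N (Suc N)" "[] \<notin> nonzero_simple_paths A B v"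
  using simple_paths[of v] by (auto simp: nonzero_simple_paths_def)

lemma next_path: "set_option x \<subseteq> simple_paths A v \<Longrightarrow>
    next_path X v (list_of_option x) = list_of_option (next_in (simple_paths A v) x)"
  unfolding next_path_def using simple_paths by (intro search_next_in path_test_iff)

lemma next_nonzero_path: "set_option x \<subseteq> nonzero_simple_paths A B v \<Longrightarrow>
    next_nonzero_path X v (list_of_option x) = list_of_option (next_in (nonzero_simple_paths A B v) x)"
  unfolding next_nonzero_path_def using nonzero_simple_paths
  by (intro search_next_in nonzero_path_test_iff)

lemma next_cycle: "set_option x \<subseteq> simple_cycles A v \<Longrightarrow>
    next_cycle X v (list_of_option x) = list_of_option (next_in (simple_cycles A v) x)"
  unfolding next_cycle_def using simple_cycles by (intro search_next_in cycle_test_iff)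

text \<open>Invariant of the run: the variables have values over which their loops range. It guarantees that the coded
  search starts inside its search space, and it bounds the size of the state.\<close>

fun valid :: "alg2_state \<Rightarrow> bool" where
  "valid (For_Vertex v t) \<longleftrightarrow> set_option v \<subseteq> {..<N}"
| "valid (Faithful_For_Path v p t) \<longleftrightarrow> v < N \<and> set_option p \<subseteq> nonzero_simple_paths A B v"
| "valid (Faithful_For_Cycle v p c t) \<longleftrightarrow> v < N \<and> p \<in> nonzero_simple_paths A B v \<and>
     set_option c \<subseteq> simple_cycles A (source_of p)"
| "valid (Faithful_Test v p c t) \<longleftrightarrow> v < N \<and> p \<in> nonzero_simple_paths A B v \<and>
     c \<in> simple_cycles A (source_of p)"
| "valid (Returned v b t) \<longleftrightarrow> v < N"
| "valid (For_R v p t) \<longleftrightarrow> v < N \<and> set_option p \<subseteq> nonzero_simple_paths A B v"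
| "valid (For_C v p c t) \<longleftrightarrow> v < N \<and> p \<in> nonzero_simple_paths A B v \<and>
     set_option c \<subseteq> simple_cycles A (source_of p)"
| "valid (Test_C v p c t) \<longleftrightarrow> v < N \<and> p \<in> nonzero_simple_paths A B v \<and>
     c \<in> simple_cycles A (source_of p)"
| "valid (Test_T1 v t) \<longleftrightarrow> v < N"
| "valid (For_P v p t) \<longleftrightarrow> v < N \<and> set_option p \<subseteq> nonzero_simple_paths A B v"
| "valid (For_Q v p c t) \<longleftrightarrow> v < N \<and> p \<in> nonzero_simple_paths A B v \<and>
     set_option c \<subseteq> simple_paths A (source_of p)"
| "valid (Test_Q v p c t) \<longleftrightarrow> v < N \<and> p \<in> nonzero_simple_paths A B v \<and>
     c \<in> simple_paths A (source_of p)"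
| "valid (Halted b) \<longleftrightarrow> True"

lemma next_in_lessThan_None: "next_in {..<N} None = Some 0"
proof -
  have "{y \<in> {..<N}. True} \<noteq> {}" "Min {y \<in> {..<N}. True} = 0"
    using dims(1) by (auto intro: Min_eqI)
  then show ?thesis by (simp add: next_in_def)
qed

lemma next_in_lessThan_Some:
  "next_in {..<N} (Some u) = (if Suc u < N then Some (Suc u) else None)"
  by (auto simp: next_in_eq_Some_iff next_in_eq_None_iff)

lemma next_in_member: "next_in S x = Some y \<Longrightarrow> finite S \<Longrightarrow> y \<in> S"
proof -
  assume y: "next_in S x = Some y" and S: "finite S"
  let ?R = "{y \<in> S. case x of None \<Rightarrow> True | Some x \<Rightarrow> x < y}"
  have "?R \<noteq> {}" "y = Min ?R" using y by (auto simp: next_in_def Let_def split: if_splits)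
  moreover have "finite ?R" using S by simp
  ultimately have "y \<in> ?R" using Min_in by blast
  then show "y \<in> S" by simp
qed

lemma finite_nonzero_simple_paths: "finite (nonzero_simple_paths A B v)"
  using finite_simple_paths by (simp add: nonzero_simple_paths_def)

lemma next_in_cases:
  assumes "finite S" "[] \<notin> S"
  obtains "next_in S x = None" "list_of_option (next_in S x) = []"
  | p where "next_in S x = Some p" "list_of_option (next_in S x) = p" "p \<noteq> []" "p \<in> S"
  using assms next_in_member[of S x] by (cases "next_in S x") (auto simp: list_of_option_def)

lemma set_simple_cycle: "c \<in> simple_cycles A v \<Longrightarrow> set c \<subseteq> {..<N}"
  using simple_cycles by (auto simp: bounded_lists_def)

lemma set_simple_path: "p \<in> simple_paths A v \<Longrightarrow> set p \<subseteq> {..<N}"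
  using simple_paths by (auto simp: bounded_lists_def)

text \<open>The edges of a cycle have nonzero labels in \<open>A\<close>, so the quotient is a true one, and its
  integrality is divisibility of absolute values.\<close>

lemma quotient_test:
  assumes c: "c \<in> simple_cycles A v"
  shows "(of_int (weight B c) / of_int (weight A c) :: rat) \<in> \<int> \<longleftrightarrow>
    label_product (fst X) c dvd label_product (snd X) c"
proof -
  have "weight A c \<noteq> 0"
    using c by (auto simp: simple_cycles_def is_simple_cycle_def is_cycle_def is_path_def
        weight_def prod_list_zero_iff)
  then show ?thesis
    using label_product_abs_mat[of _ c] set_simple_cycle[OF c] dims
    by (simp add: X_def of_int_div_of_int_in_Ints_iff)
qed

lemma simulation:
  assumes "valid s"
  shows "step_state X (state_code s) = state_code (alg2_step (A, B) s) \<and> valid (alg2_step (A, B) s)"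
proof -
  note [simp] = step_state_def step_code_def length_X hd_rev next_path next_nonzero_path next_cycle
  note finite = finite_nonzero_simple_paths finite_simple_cycles finite_simple_paths
  show ?thesis
    using assms
  proof (cases s)
    case (For_Vertex v t)
    then show ?thesis
      using assms dims by (cases v) (auto simp: next_in_lessThan_None next_in_lessThan_Some)
  next
    case (Faithful_For_Path v p t)
    then show ?thesis
      using assms
      by (cases rule: next_in_cases[OF finite(1) nonzero_simple_paths(2), of v p])
        auto
  next
    case (Faithful_For_Cycle v p c t)
    then show ?thesis
      using assms
      by (cases rule: next_in_cases[OF finite(2) simple_cycles(2), of "source_of p" c])
        auto
  next
    case (Faithful_Test v p c t)
    then show ?thesis
      using assms quotient_test by auto
  next
    case (Returned v b t)
    then show ?thesis using assms by auto
  next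
    case (For_R v p t)
    then show ?thesis
      using assms
      by (cases rule: next_in_cases[OF finite(1) nonzero_simple_paths(2), of v p])
        auto
  next
    case (For_C v p c t)
    then show ?thesis
      using assms
      by (cases rule: next_in_cases[OF finite(2) simple_cycles(2), of "source_of p" c])
        auto
  next
    case (Test_C v p c t)
    then show ?thesis
      using assms nonzero_labels_weight[OF set_simple_cycle] by auto
  next
    case (Test_T1 v t)
    then show ?thesis using assms by auto
  next
    case (For_P v p t)
    then show ?thesis
      using assms
      by (cases rule: next_in_cases[OF finite(1) nonzero_simple_paths(2), of v p])
        auto
  next
    case (For_Q v p c t)
    then show ?thesis
      using assms
      by (cases rule: next_in_cases[OF finite(3) simple_paths(2), of "source_of p" c])
        auto
  next
    case (Test_Q v p c t)
    then show ?thesis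
      using assms nonzero_labels_weight[OF set_simple_path] by auto
  next
    case (Halted b)
    then show ?thesis by simp
  qed
qed

end

section \<open>Procedures with steps computable in polynomial space\<close>

text \<open>The machine keeps a value of type \<open>'d\<close> in register 0 from which everything of interest can be
  computed: the next such value, the word that must be on tape 1 at the checkpoint, and the answer once the
  procedure has halted. Register 1 is emptied at the beginning of each round, because programs use it as
  scratch space, and refilled at the end.\<close>

theorem runs_in_polynomial_spaceI:
  fixes P :: "('i, 's) procedure" and start :: "raw \<Rightarrow> 'd::enc" and step :: "'d \<Rightarrow> 'd"
    and data :: "'i \<Rightarrow> nat \<Rightarrow> 'd" and q :: "nat poly"
  defines "data \<equiv> \<lambda>x i. (step ^^ i) (start (Raw (rev (encode_input P x))))"
  assumes start: "pspace start" and step: "pspace step"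
    and emit: "pspace output" and answer: "pspace answer"
    and halts: "\<And>x. valid_input P x \<Longrightarrow> \<exists>n. result P (state_after P x n) \<noteq> None"
    and output_data: "\<And>x i. valid_input P x \<Longrightarrow>
      output (data x i) = Raw (rev (encode_state P (state_after P x i)))"
    and answer_data: "\<And>x i. valid_input P x \<Longrightarrow>
      answer (data x i) = Raw (case result P (state_after P x i) of None \<Rightarrow> [] | Some b \<Rightarrow> [Bit b])"
    and size: "\<And>x i. valid_input P x \<Longrightarrow> sz (data x i) \<le> poly q (length (encode_input P x))"
  shows "runs_in_polynomial_space P"
proof -
  obtain c0 k0 p0 where c0: "computes c0 k0 p0 start" using start by (rule pspaceE)
  obtain c1 k1 p1 where c1: "computes c1 k1 p1 step" using step by (rule pspaceE)
  obtain c2 k2 p2 where c2: "computes c2 k2 p2 output" using emit by (rule pspaceE)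
  obtain c3 k3 p3 where c3: "computes c3 k3 p3 answer" using answer by (rule pspaceE)
  define m where "m = Suc (max (max k0 k1) (max k2 k3))"
  have m: "k0 \<le> m" "k1 \<le> m" "k2 \<le> m" "k3 \<le> m" "0 < m" by (auto simp: m_def)
  define init where "init = Seq c0 (Seq (aside c2 m) (transfer (m + 2) [1]))"
  define body where "body = Seq (transfer 1 []) (Seq (aside c3 m) (Seq (transfer (m + 2) [m + 3])
    (Seq c1 (Seq (aside c2 m) (transfer (m + 2) [1])))))"
  \<comment> \<open>Registers \<open>m\<close>, \<open>m + 1\<close> and \<open>m + 2\<close> are used by
    \<open>aside\<close>; register \<open>m + 3\<close> keeps the answer out of their way.\<close>
  define R where "R = insert (m + 3) (registers init \<union> registers body)"
  define T where "T = Suc (Max R)"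
  have "finite R" by (simp add: R_def finite_registers)
  then have below: "j \<in> R \<Longrightarrow> j < T" for j by (simp add: T_def le_imp_less_Suc)
  interpret machine init body "m + 3" T
  proof
    show "registers init \<union> registers body \<subseteq> {..<T}" "m + 3 < T"
      using below by (auto simp: R_def)
    then show "2 \<le> T" by simp
  qed
  \<comment> \<open>One summand for each program, applied to data of size at most \<open>q\<close>, and one
    for each word that has to be kept at the same time.\<close>
  define r where "r = [:1, 1:] + p0 + [:2:] * q + pcompose p1 q + pcompose p2 q + pcompose p3 q"
  have "executes_on M (code Checkpoint) P x \<and>
      uses_space_at_most M (encode_input P x)
        (poly ([:T:] * ([:1:] + r)) (length (encode_input P x)))" if x: "valid_input P x" for x
  proof -
    define w where "w = encode_input P x"
    define D where "D i = data x i" for i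
    define st where "st i = state_after P x i" for i
    define b where "b = poly r (length w)"
    have D_0: "D 0 = start (Raw (rev w))" and D_Suc: "D (Suc i) = step (D i)" for i
      by (simp_all add: D_def data_def w_def)
    have out: "enc (output (D i)) = rev (encode_state P (st i))" for i
      using output_data[OF x] by (simp add: D_def st_def enc_raw_def)
    have ans: "enc (answer (D i)) = (case result P (st i) of None \<Rightarrow> [] | Some b \<Rightarrow> [Bit b])" for i
      using answer_data[OF x] by (simp add: D_def st_def enc_raw_def)
    have sz_D: "sz (D i) \<le> poly q (length w)" for i
      using size[OF x] by (simp add: D_def w_def)
    have le: "poly p (sz (D i)) \<le> poly (pcompose p q) (length w)" for p i
      using poly_nat_mono[OF sz_D] by (simp add: poly_pcompose)
    have b: "length w < b" "poly p0 (length w) \<le> b" "poly p1 (sz (D i)) \<le> b"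
        "sz (D i) + poly p2 (sz (D i)) \<le> b" "sz (D i) + poly p3 (sz (D i)) \<le> b" for i
      using le[of p1 i] le[of p2 i] le[of p3 i] sz_D[of i] by (simp_all add: b_def r_def)
    \<comment> \<open>The store at a checkpoint, with register \<open>m + 3\<close> containing
      \<open>a\<close>.\<close>
    define S where "S i a = (\<lambda>j. if j = 0 then enc (D i)
      else if j = 1 then rev (encode_state P (st i)) else if j = m + 3 then a else [])" for i a
    have put_output: "exec b (Seq (aside c2 m) (transfer (m + 2) [1])) s (S i a)"
      if s: "s = (S i a)(1 := [])" for i a s
    proof (rule exec.Seq)
      let ?t = "s(m + 2 := rev (enc (output (D i))))"
      show "exec b (aside c2 m) s ?t"
        by (rule exec_aside[OF c2, where x = "D i"]) (use s m b(4)[of i] in \<open>auto simp: S_def\<close>)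
      show "exec b (transfer (m + 2) [1]) ?t (S i a)"
        by (rule exec_transfer)
          (use s m b(4)[of i] computes_size[OF c2, of "D i"] in
            \<open>auto simp: S_def fun_eq_iff out\<close>)
    qed
    have init: "exec b init (initial_store w) (S 0 [])"
      unfolding init_def
    proof (rule exec.Seq[OF _ put_output[OF refl]])
      show "exec b c0 (initial_store w) ((S 0 [])(1 := []))"
        by (rule computes_exec[OF c0, where x = "Raw (rev w)"])
          (use b(2) in \<open>auto simp: initial_store_def enc_raw_def S_def D_0 fun_eq_iff\<close>)
    qed
    have body: "exec b body (S i []) (S (Suc i) (enc (answer (D i))))" for i
      unfolding body_def
    proof (rule exec.Seq[OF exec_clear[OF refl]], intro exec.Seq[OF _ exec.Seq[OF _ exec.Seq[OF _ put_output[OF refl]]]])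
      let ?s = "(S i [])(1 := [])"
      let ?t = "?s(m + 2 := rev (enc (answer (D i))))"
      let ?u = "?s(m + 3 := enc (answer (D i)))"
      show "exec b (aside c3 m) ?s ?t"
        by (rule exec_aside[OF c3, where x = "D i"]) (use m b(5)[of i] in \<open>auto simp: S_def\<close>)
      show "exec b (transfer (m + 2) [m + 3]) ?t ?u"
        by (rule exec_transfer)
          (use m b(5)[of i] computes_size[OF c3, of "D i"] in \<open>auto simp: S_def fun_eq_iff\<close>)
      show "exec b c1 ?u ((S (Suc i) (enc (answer (D i))))(1 := []))"
        by (rule computes_exec[OF c1, where x = "D i"])
          (use m b(3)[of i] in \<open>auto simp: S_def D_Suc fun_eq_iff\<close>)
    qed
    obtain n where n: "result P (st n) \<noteq> None" "\<And>i. i < n \<Longrightarrow> result P (st i) = None"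
      using halts[OF x] exists_least_iff[of "\<lambda>n. result P (st n) \<noteq> None"] by (auto simp: st_def)
    then obtain a where a: "result P (st n) = Some a" by blast
    define \<sigma> where "\<sigma> i = S i (if i = Suc n then [Bit a] else [])" for i
    have "exec b body (\<sigma> i) (\<sigma> (Suc i))" if "i \<le> n" for i
      using body[of i] n(2)[of i] a that by (auto simp: \<sigma>_def ans order_le_less)
    moreover have "exec b init (initial_store w) (\<sigma> 0)"
      using init by (simp add: \<sigma>_def)
    moreover have "peek (\<sigma> i (m + 3)) = None" if "i \<le> n" for i
      using that by (simp add: \<sigma>_def S_def)
    moreover have "peek (\<sigma> (Suc n) (m + 3)) = Some (Bit a)"
      by (simp add: \<sigma>_def S_def)
    ultimately obtain time where time: "strict_mono_on {..n} time"
        "{t. state (config_at M w t) = code Checkpoint} = time ` {..n}"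
        "\<And>i. i \<le> n \<Longrightarrow> content (config_at M w (time i)) = (\<lambda>j. written (rev (\<sigma> i j)))"
        "\<exists>t. state (config_at M w t) = (if a then accept M else reject M)"
        "\<And>t j. head (config_at M w t) j \<le> b"
      using run[of b w \<sigma> n a] b(1) by blast
    obtain t where t: "state (config_at M w t) = (if a then accept M else reject M)"
      using time(4) by blast
    have "executes_on M (code Checkpoint) P x"
      unfolding executes_on_def w_def[symmetric]
    proof (intro exI conjI allI impI)
      show "result P (state_after P x i) = None" if "i < n" for i
        using n(2)[OF that] by (simp add: st_def)
      show "result P (state_after P x n) = Some a"
        using a by (simp add: st_def)
      show "content (config_at M w (time i)) 1 = written (encode_state P (state_after P x i))"
        if "i \<le> n" for i
        using time(3)[OF that] by (simp add: \<sigma>_def S_def st_def)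
    qed (rule time(1) time(2) t)+
    moreover have "uses_space_at_most M w (T * (1 + b))"
    proof -
      have sub: "visited_cells M w \<subseteq> {..<T} \<times> {..b}"
        using time(5) by (auto simp: visited_cells_def M_def)
      have "finite ({..<T} \<times> {..b})" "card ({..<T} \<times> {..b}) = T * (1 + b)"
        by (simp_all add: card_cartesian_product)
      then show ?thesis
        using sub card_mono[OF _ sub] finite_subset[OF sub] by (simp add: uses_space_at_most_def)
    qed
    ultimately show ?thesis by (simp add: w_def b_def)
  qed
  then show ?thesis
    unfolding runs_in_polynomial_space_def using wf by blast
qed

section \<open>Algorithm 2 halts and runs in polynomial space\<close>

definition output_state :: "state_code \<Rightarrow> raw" where
  "output_state z = output_code (fst z) (fst (snd z)) (fst (snd (snd z))) (fst (snd (snd (snd z))))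
     (fst (snd (snd (snd (snd z))))) (snd (snd (snd (snd (snd z)))))"

definition answer_state :: "state_code \<Rightarrow> raw" where
  "answer_state z = answer_code (fst z) (fst (snd (snd (snd (snd z)))))"

text \<open>The number of iterations that a loop over \<open>S\<close> has still ahead of it when \<open>x\<close> was
  treated last.\<close>

definition remaining :: "'a::linorder set \<Rightarrow> 'a option \<Rightarrow> nat" where
  "remaining S x = card {y \<in> S. case x of None \<Rightarrow> True | Some z \<Rightarrow> z < y}"

lemma remaining_next_in:
  assumes "finite S" "next_in S x = Some y"
  shows "remaining S (Some y) < remaining S x"
proof -
  let ?R = "\<lambda>x. {y \<in> S. case x of None \<Rightarrow> True | Some z \<Rightarrow> z < y}"
  have "?R x \<noteq> {}" "y = Min (?R x)" "finite (?R x)"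
    using assms by (auto simp: next_in_def Let_def split: if_splits)
  then have "y \<in> ?R x" using Min_in by blast
  then have "?R (Some y) \<subset> ?R x"
    by (auto split: option.splits)
  then show ?thesis
    unfolding remaining_def using assms(1) by (intro psubset_card_mono) auto
qed

context katsura
begin

lemma optional_path_output: "p \<noteq> Some [] \<Longrightarrow>
    letters (optional_path_output (list_of_option p)) = rev (encode_option encode_path p)"
  by (cases p) (auto simp: optional_path_output_def encode_option_def)

lemma output_state: "valid s \<Longrightarrow> output_state (state_code s) = Raw (rev (encode_alg2_state s))"
proof -
  assume valid: "valid s"
  have ne: "p \<noteq> Some []" if "set_option p \<subseteq> S" "[] \<notin> S" for p :: "path option" and S
    using that by auto
  note [simp] = output_state_def output_code_def raw_eq_iff optional_path_output
    nonzero_simple_paths(2) simple_paths(2) simple_cycles(2)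
  note sets = ne[OF _ nonzero_simple_paths(2)] ne[OF _ simple_paths(2)] ne[OF _ simple_cycles(2)]
  show ?thesis
    using valid
  proof (cases s)
    case (For_Vertex v t)
    then show ?thesis by (cases v) (auto simp: encode_option_def)
  next
    case (Faithful_Test v p c t)
    then show ?thesis using valid by (cases "c = []") (auto simp: optional_path_output_def)
  next
    case (Test_C v p c t)
    then show ?thesis using valid by (cases "c = []") (auto simp: optional_path_output_def)
  next
    case (Test_Q v p c t)
    then show ?thesis using valid by (cases "c = []") (auto simp: optional_path_output_def)
  qed (use sets in auto)
qed

lemma answer_state:
  "answer_state (state_code s) = Raw (case alg2_result s of None \<Rightarrow> [] | Some b \<Rightarrow> [Bit b])"
  by (cases s) (auto simp: answer_state_def answer_code_def raw_eq_iff)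

lemma state_code_bounds:
  assumes "valid s" "state_code s = (g, v, p, c, b, t)"
  shows "g \<le> 12 \<and> v \<le> N \<and> p \<in> bounded_lists N (Suc N) \<and> c \<in> bounded_lists N (Suc N)"
proof -
  have opt: "list_of_option x \<in> bounded_lists N (Suc N)"
    if "set_option x \<subseteq> S" "S \<subseteq> bounded_lists N (Suc N)" for x S
    using that by (cases x) (auto simp: Nil_in_bounded_lists)
  note sets = opt[OF _ nonzero_simple_paths(1)] opt[OF _ simple_paths(1)] opt[OF _ simple_cycles(1)]
    subsetD[OF nonzero_simple_paths(1)] subsetD[OF simple_paths(1)] subsetD[OF simple_cycles(1)]
  show ?thesis
    using assms sets by (cases s) (auto simp: Nil_in_bounded_lists split: option.splits)
qed

lemma sz_state_code:
  assumes "valid s"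
  shows "sz (state_code s) \<le> poly ([:40, 2:] + [:4:] * [:1, 1:] * [:1, 2:]) (sz X)"
proof -
  obtain g v p c b t where z: "state_code s = (g, v, p, c, b, t)" by (metis prod.collapse)
  note bounds = state_code_bounds[OF assms z]
  have "sz g \<le> 13" using sz_nat_le[of g] bounds by simp
  moreover have "sz v \<le> N + 1" using sz_nat_le[of v] bounds by simp
  moreover have "sz p \<le> Suc N * (2 * N + 1)" "sz c \<le> Suc N * (2 * N + 1)"
    using sz_bounded_lists bounds by blast+
  ultimately have "sz (state_code s) \<le> 40 + 2 * N + 4 * (Suc N * (2 * N + 1))"
    by (simp add: z)
  also have "\<dots> \<le> 40 + 2 * sz X + 4 * (Suc (sz X) * (2 * sz X + 1))"
  proof -
    have "N \<le> sz X"
      using length_le_sz[of "fst X"] length_X by (cases X) simp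
    then show ?thesis by (intro add_mono mult_mono) auto
  qed
  also have "\<dots> = poly ([:40, 2:] + [:4:] * [:1, 1:] * [:1, 2:]) (sz X)"
    by (simp add: algebra_simps)
  finally show ?thesis .
qed

abbreviation P_rem :: "nat \<Rightarrow> path option \<Rightarrow> nat" where
  "P_rem v \<equiv> remaining (nonzero_simple_paths A B v)"

abbreviation C_rem :: "path \<Rightarrow> path option \<Rightarrow> nat" where
  "C_rem p \<equiv> remaining (simple_cycles A (source_of p))"

abbreviation Q_rem :: "path \<Rightarrow> path option \<Rightarrow> nat" where
  "Q_rem p \<equiv> remaining (simple_paths A (source_of p))"

abbreviation V_rem :: "nat option \<Rightarrow> nat" where
  "V_rem v \<equiv> Suc (remaining {..<dim_row A} v)"

text \<open>A lexicographic rank that every step lowers until the algorithm halts. The first component counts the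
  vertices that are left, the second one the phases of the loop body (the call of Faithful, its return, the
  computation of \<open>T1\<close>, its test, the last loop). The third and fifth component belong to the
  two nested path loops, and the fourth and sixth one tell whether the program point is inside the inner
  loop, respectively inside its body.\<close>

fun rank :: "alg2_state \<Rightarrow> nat \<times> nat \<times> nat \<times> nat \<times> nat \<times> nat" where
  "rank (For_Vertex v t) = (V_rem v, 0, 0, 0, 0, 0)"
| "rank (Faithful_For_Path v p t) = (V_rem (Some v), 5, P_rem v p, 0, 0, 0)"
| "rank (Faithful_For_Cycle v p c t) = (V_rem (Some v), 5, P_rem v (Some p), 1, C_rem p c, 0)"
| "rank (Faithful_Test v p c t) = (V_rem (Some v), 5, P_rem v (Some p), 1, C_rem p (Some c), 1)"
| "rank (Returned v b t) = (V_rem (Some v), 4, 0, 0, 0, 0)"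
| "rank (For_R v p t) = (V_rem (Some v), 3, P_rem v p, 0, 0, 0)"
| "rank (For_C v p c t) = (V_rem (Some v), 3, P_rem v (Some p), 1, C_rem p c, 0)"
| "rank (Test_C v p c t) = (V_rem (Some v), 3, P_rem v (Some p), 1, C_rem p (Some c), 1)"
| "rank (Test_T1 v t) = (V_rem (Some v), 2, 0, 0, 0, 0)"
| "rank (For_P v p t) = (V_rem (Some v), 1, P_rem v p, 0, 0, 0)"
| "rank (For_Q v p c t) = (V_rem (Some v), 1, P_rem v (Some p), 1, Q_rem p c, 0)"
| "rank (Test_Q v p c t) = (V_rem (Some v), 1, P_rem v (Some p), 1, Q_rem p (Some c), 1)"
| "rank (Halted b) = (0, 0, 0, 0, 0, 0)"

abbreviation rank_order where
  "rank_order \<equiv> less_than <*lex*> less_than <*lex*> less_than <*lex*> less_than <*lex*>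
     less_than <*lex*> less_than"

lemma rank_decreases:
  assumes "alg2_result s = None"
  shows "(rank (alg2_step (A, B) s), rank s) \<in> rank_order"
proof -
  note remaining = remaining_next_in[OF finite_lessThan]
    remaining_next_in[OF finite_nonzero_simple_paths] remaining_next_in[OF finite_simple_cycles]
    remaining_next_in[OF finite_simple_paths]
  show ?thesis
    using assms by (cases s) (auto simp: remaining split: option.split)
qed

lemma halts: "\<exists>n. alg2_result ((alg2_step (A, B) ^^ n) s) \<noteq> None"
proof -
  have "wf rank_order" by (intro wf_lex_prod wf_less_than)
  then have "wf (inv_image rank_order rank)" by (rule wf_inv_image)
  then show ?thesis
  proof (induction s rule: wf_induct_rule)
    case (less s)
    show ?case
    proof (cases "alg2_result s = None")
      case True
      then have "(alg2_step (A, B) s, s) \<in> inv_image rank_order rank"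
        using rank_decreases by (simp add: inv_image_def)
      from less[OF this] obtain n
        where "alg2_result ((alg2_step (A, B) ^^ n) (alg2_step (A, B) s)) \<noteq> None" by blast
      then have "alg2_result ((alg2_step (A, B) ^^ Suc n) s) \<noteq> None"
        by (simp only: funpow_Suc_right comp_apply not_False_eq_True)
      then show ?thesis by blast
    next
      case False
      then show ?thesis by (intro exI[of _ 0]) simp
    qed
  qed
qed

end

theorem proposition7p2:
  shows "runs_in_polynomial_space algorithm2"
proof -
  define start where
    "start r = (parse (rev (letters r)), (0, 0, [], [], False, False) :: state_code)" for r
  define step where "step D = (fst D, step_state (fst D) (snd D))" for D :: "matrices \<times> state_code"
  have start: "pspace start"
    unfolding start_def by (intro pspace_intros)
  have step: "pspace step"
    unfolding step_def step_state_def by (intro pspace_intros)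
  have emit: "pspace (\<lambda>D :: matrices \<times> state_code. output_state (snd D))"
    unfolding output_state_def by (intro pspace_intros)
  have answer: "pspace (\<lambda>D :: matrices \<times> state_code. answer_state (snd D))"
    unfolding answer_state_def by (intro pspace_intros)
  obtain p :: "nat poly" where p: "\<And>r. sz (start r) \<le> poly p (sz r)"
    using pspace_size[OF start] by blast
  let ?s = "[:40, 2:] + [:4:] * [:1, 1:] * [:1, 2:] :: nat poly"
  let ?data = "\<lambda>x i. (step ^^ i) (start (Raw (rev (encode_input algorithm2 x))))"
  have data: "\<exists>A B. x = (A, B) \<and> katsura A B \<and> katsura.valid A B (state_after algorithm2 x i) \<and>
      ?data x i = (katsura.X A B, state_code (state_after algorithm2 x i))"
    if valid: "valid_input algorithm2 x" for x i
  proof -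
    obtain A B where x: "x = (A, B)" by (cases x)
    then interpret katsura A B
      using valid by unfold_locales (simp add: algorithm2_def)
    have "valid (state_after algorithm2 x i) \<and> ?data x i = (X, state_code (state_after algorithm2 x i))"
    proof (induction i)
      case 0
      then show ?case
        by (simp add: state_after_def algorithm2_def x start_def parse_encode_pair X_def)
    next
      case (Suc i)
      have "state_after algorithm2 x (Suc i) = alg2_step (A, B) (state_after algorithm2 x i)"
        by (simp add: state_after_def algorithm2_def x)
      then show ?case
        using Suc simulation by (simp add: step_def)
    qed
    then show ?thesis using x katsura_axioms by blast
  qed
  show ?thesis
  proof (rule runs_in_polynomial_spaceI[OF start step emit answer])
    fix x assume valid: "valid_input algorithm2 x"
    obtain A B where x: "x = (A, B)" by (cases x)
    then interpret katsura A B
      using valid by unfold_locales (simp add: algorithm2_def)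
    show "\<exists>n. result algorithm2 (state_after algorithm2 x n) \<noteq> None"
      using halts by (simp add: state_after_def algorithm2_def x)
    fix i
    have d: "valid (state_after algorithm2 x i)" "?data x i = (X, state_code (state_after algorithm2 x i))"
      using data[OF valid, of i] x by auto
    show "output_state (snd (?data x i)) = Raw (rev (encode_state algorithm2 (state_after algorithm2 x i)))"
      using d output_state by (simp add: algorithm2_def)
    show "answer_state (snd (?data x i)) = Raw (case result algorithm2 (state_after algorithm2 x i) of
        None \<Rightarrow> [] | Some b \<Rightarrow> [Bit b])"
      using d answer_state by (simp add: algorithm2_def)
    let ?n = "length (encode_input algorithm2 x)"
    have "start (Raw (rev (encode_input algorithm2 x))) = (X, (0, 0, [], [], False, False))"
      by (simp add: start_def algorithm2_def x parse_encode_pair X_def)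
    then have X: "sz X \<le> poly p ?n"
      using p[of "Raw (rev (encode_input algorithm2 x))"] by simp
    have "sz (state_code (state_after algorithm2 x i)) \<le> poly ?s (poly p ?n)"
      using sz_state_code[OF d(1)] poly_nat_mono[OF X, of ?s] by linarith
    then show "sz (?data x i) \<le> poly ([:2:] * p + pcompose ?s p + [:1:]) ?n"
      using X by (simp only: d(2) sz_simps poly_add poly_mult poly_pcompose) simp
  qed
qed

end
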